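(* Let $d\ge1$, $\beta>0$, $\omega<-\lambda_0$, let $1<p<\frac{d+2}{d-2}$ if $d\ge3$ and $1<p<\infty$ if $d=1,2$, and let one of the following hold: (i) $\Omega=0$, $V(\mathbf{x})\ge0$ for all $\mathbf{x}\in\mathbb{R}^d$, and $\lim_{|\mathbf{x}|\to\infty}V(\mathbf{x})=\infty$; (ii) $d\ge2$, $V(\mathbf{x})=\frac12\sum_{j=1}^d\gamma_j^2x_j^2$ with $\gamma_j>0$ for all $j$, and $0<|\Omega|<\min\{\gamma_1,\gamma_2\}$. Then there exists $\phi_g\in X$ such that $$S_{\Omega,\omega}(\phi_g)=\inf_{\phi\in X}S_{\Omega,\omega}(\phi)=\inf_{\phi\in\mathcal{M}}S_{\Omega,\omega}(\phi).$$
   Context: Functions are complex-valued on $\mathbb{R}^d$, $\mathbf{x}=(x_1,\dots,x_d)$; $\Omega,\omega,\beta\in\mathbb{R}$ and $V:\mathbb{R}^d\to[0,\infty)$ is a given real potential. Let $L_V^2(\mathbb{R}^d)=\{\phi:\int_{\mathbb{R}^d}V|\phi|^2d\mathbf{x}<\infty\}$ and $X=H^1(\mathbb{R}^d)\cap L_V^2(\mathbb{R}^d)$. The angular momentum operator is $L_z=i(x_2\partial_{x_1}-x_1\partial_{x_2})$ if $d\ge2$ and $L_z=0$ if $d=1$. Put $L_\Omega(\phi)=-\Omega\int_{\mathbb{R}^d}\overline{\phi}\,L_z\phi\,d\mathbf{x}$ (equal to $0$ when $\Omega=0$). For $\phi\in X$ define the action functional $$S_{\Omega,\omega}(\phi)=\tfrac12\|\nabla\phi\|_{L^2}^2+\int_{\mathbb{R}^d}V|\phi|^2d\mathbf{x}+\tfrac{2\beta}{p+1}\|\phi\|_{L^{p+1}}^{p+1}+L_\Omega(\phi)+\omega\|\phi\|_{L^2}^2$$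 and the Nehari functional $$K_{\Omega,\omega}(\phi)=\tfrac12\|\nabla\phi\|_{L^2}^2+\int_{\mathbb{R}^d}V|\phi|^2d\mathbf{x}+\beta\|\phi\|_{L^{p+1}}^{p+1}+L_\Omega(\phi)+\omega\|\phi\|_{L^2}^2.$$ The Nehari manifold is $\mathcal{M}=\{\phi\in X\setminus\{0\}:K_{\Omega,\omega}(\phi)=0\}$, and $$\lambda_0=\inf\left\{\tfrac12\|\nabla u\|_{L^2}^2+\int_{\mathbb{R}^d}V|u|^2d\mathbf{x}+L_\Omega(u):u\in X,\ \|u\|_{L^2}=1\right\}.$$ *)

theory Defs
  imports "HOL-Analysis.Analysis"
begin

definition partial_deriv :: "'n::finite \<Rightarrow> (real^'n \<Rightarrow> real) \<Rightarrow> real^'n \<Rightarrow> real" where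
  "partial_deriv i f x = frechet_derivative f (at x) (axis i 1)"

(* C^infinity: every iterated partial derivative exists and is differentiable everywhere. *)
definition smooth :: "(real^'n::finite \<Rightarrow> real) \<Rightarrow> bool" where
  "smooth f \<longleftrightarrow> (\<forall>is. \<forall>x. foldr partial_deriv is f differentiable at x)"

definition test_functions :: "(real^'n::finite \<Rightarrow> real) set" where
  "test_functions = {\<psi>. smooth \<psi> \<and> compact (closure {x. \<psi> x \<noteq> 0})}"

definition locally_integrable :: "(real^'n::finite \<Rightarrow> complex) \<Rightarrow> bool" where
  "locally_integrable f \<longleftrightarrow> (\<forall>K. compact K \<longrightarrow> set_integrable lebesgue K f)"

definition has_weak_partial ::
    "'n::finite \<Rightarrow> (real^'n \<Rightarrow> complex) \<Rightarrow> (real^'n \<Rightarrow> complex) \<Rightarrow> bool" where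
  "has_weak_partial i f g \<longleftrightarrow> locally_integrable f \<and> locally_integrable g \<and>
     (\<forall>\<psi>\<in>test_functions.
        (\<integral>x. f x * of_real (partial_deriv i \<psi> x) \<partial>lebesgue)
          = - (\<integral>x. g x * of_real (\<psi> x) \<partial>lebesgue))"

(* A representative of the weak partial derivative, which is unique up to null sets;
   all functionals below depend only on its equivalence class. *)
definition weak_partial :: "'n::finite \<Rightarrow> (real^'n \<Rightarrow> complex) \<Rightarrow> real^'n \<Rightarrow> complex" where
  "weak_partial i f = (SOME g. has_weak_partial i f g)"

definition weak_gradient :: "(real^'n::finite \<Rightarrow> complex) \<Rightarrow> real^'n \<Rightarrow> complex^'n" where
  "weak_gradient f x = (\<chi> i. weak_partial i f x)"

(* Elements of the function spaces are functions, not equivalence classes. *)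
definition Lp_space :: "real \<Rightarrow> (real^'n::finite \<Rightarrow> complex) set" where
  "Lp_space q = {f \<in> borel_measurable lebesgue. integrable lebesgue (\<lambda>x. norm (f x) powr q)}"

definition Lp_norm :: "real \<Rightarrow> (real^'n::finite \<Rightarrow> 'b::real_normed_vector) \<Rightarrow> real" where
  "Lp_norm q f = (\<integral>x. norm (f x) powr q \<partial>lebesgue) powr (1 / q)"

definition H1_space :: "(real^'n::finite \<Rightarrow> complex) set" where
  "H1_space = {f \<in> Lp_space 2. \<forall>i. \<exists>g\<in>Lp_space 2. has_weak_partial i f g}"

definition L2V_space :: "(real^'n::finite \<Rightarrow> real) \<Rightarrow> (real^'n \<Rightarrow> complex) set" where
  "L2V_space V = {\<phi>. integrable lebesgue (\<lambda>x. V x * (cmod (\<phi> x))\<^sup>2)}"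

definition X_space :: "(real^'n::finite \<Rightarrow> real) \<Rightarrow> (real^'n \<Rightarrow> complex) set" where
  "X_space V = H1_space \<inter> L2V_space V"

(* The argument e enumerates the coordinates: x_j is x $ e j for j = 1, ..., d, d = CARD('n). *)
definition angular_momentum ::
    "(nat \<Rightarrow> 'n::finite) \<Rightarrow> (real^'n \<Rightarrow> complex) \<Rightarrow> real^'n \<Rightarrow> complex" where
  "angular_momentum e \<phi> x =
     (if CARD('n) \<ge> 2
      then \<i> * (of_real (x $ e 2) * weak_partial (e 1) \<phi> x
                - of_real (x $ e 1) * weak_partial (e 2) \<phi> x)
      else 0)"

(* The real part only serves to obtain a real number: L_z is symmetric, so the integral
   of cnj \<phi> * L_z \<phi> is real whenever it converges absolutely. *)
definition L_rot ::
    "(nat \<Rightarrow> 'n::finite) \<Rightarrow> real \<Rightarrow> (real^'n \<Rightarrow> complex) \<Rightarrow> real" where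
  "L_rot e \<Omega> \<phi> = - \<Omega> * Re (\<integral>x. cnj (\<phi> x) * angular_momentum e \<phi> x \<partial>lebesgue)"

definition action ::
    "(nat \<Rightarrow> 'n::finite) \<Rightarrow> (real^'n \<Rightarrow> real) \<Rightarrow> real \<Rightarrow> real \<Rightarrow> real \<Rightarrow> real
       \<Rightarrow> (real^'n \<Rightarrow> complex) \<Rightarrow> real" where
  "action e V \<beta> p \<Omega> \<omega> \<phi> =
     1 / 2 * (Lp_norm 2 (weak_gradient \<phi>))\<^sup>2
     + (\<integral>x. V x * (cmod (\<phi> x))\<^sup>2 \<partial>lebesgue)
     + 2 * \<beta> / (p + 1) * Lp_norm (p + 1) \<phi> powr (p + 1)
     + L_rot e \<Omega> \<phi>
     + \<omega> * (Lp_norm 2 \<phi>)\<^sup>2"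

definition nehari ::
    "(nat \<Rightarrow> 'n::finite) \<Rightarrow> (real^'n \<Rightarrow> real) \<Rightarrow> real \<Rightarrow> real \<Rightarrow> real \<Rightarrow> real
       \<Rightarrow> (real^'n \<Rightarrow> complex) \<Rightarrow> real" where
  "nehari e V \<beta> p \<Omega> \<omega> \<phi> =
     1 / 2 * (Lp_norm 2 (weak_gradient \<phi>))\<^sup>2
     + (\<integral>x. V x * (cmod (\<phi> x))\<^sup>2 \<partial>lebesgue)
     + \<beta> * Lp_norm (p + 1) \<phi> powr (p + 1)
     + L_rot e \<Omega> \<phi>
     + \<omega> * (Lp_norm 2 \<phi>)\<^sup>2"

(* Being nonzero in X means not vanishing almost everywhere. *)
definition nehari_manifold ::
    "(nat \<Rightarrow> 'n::finite) \<Rightarrow> (real^'n \<Rightarrow> real) \<Rightarrow> real \<Rightarrow> real \<Rightarrow> real \<Rightarrow> real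
       \<Rightarrow> (real^'n \<Rightarrow> complex) set" where
  "nehari_manifold e V \<beta> p \<Omega> \<omega> =
     {\<phi> \<in> X_space V. \<not> (AE x in lebesgue. \<phi> x = 0) \<and> nehari e V \<beta> p \<Omega> \<omega> \<phi> = 0}"

(* Infima are taken in ereal, so that they mean the same as on paper also for sets that
   are empty or unbounded below. *)
definition lambda0 ::
    "(nat \<Rightarrow> 'n::finite) \<Rightarrow> (real^'n \<Rightarrow> real) \<Rightarrow> real \<Rightarrow> ereal" where
  "lambda0 e V \<Omega> =
     (INF u \<in> {u \<in> X_space V. Lp_norm 2 u = 1}.
        ereal (1 / 2 * (Lp_norm 2 (weak_gradient u))\<^sup>2
               + (\<integral>x. V x * (cmod (u x))\<^sup>2 \<partial>lebesgue) + L_rot e \<Omega> u))"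

end

theory Submission
  imports Defs
begin

text \<open>The analytic input is one inequality: if \<open>P\<^sub>\<epsilon> f\<close> averages \<open>f\<close> over the cells of the grid
  \<open>\<epsilon> \<int>\<^sup>n\<close>, then \<open>\<parallel>f - P\<^sub>\<epsilon> f\<parallel> \<le> C \<epsilon> \<parallel>\<nabla>f\<parallel>\<close> in \<open>L\<^sup>2\<close>. It gives the subcritical Sobolev embedding:
  if \<open>f \<in> L\<^sup>q\<close>, then \<open>\<bar>P\<^sub>\<epsilon> f\<bar> \<le> t\<close> for \<open>\<epsilon>\<close> of order \<open>t\<close> to the power \<open>- q / n\<close>, so the set where
  \<open>\<bar>f\<bar> > 2 t\<close> has measure of order \<open>t\<close> to the power \<open>- 2 - 2 q / n\<close>, and the exponent improves step by
  step. It also gives compactness in \<open>L\<^sup>2\<close>: along a subsequence all cell averages converge, and the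
  potential prevents mass from escaping to infinity.

  A minimizing sequence that converges in \<open>L\<^sup>2\<close> converges in \<open>H\<^sup>1\<close>, because the midpoint of two
  almost minimizers has almost minimal action and the quadratic part of the action obeys the
  parallelogram identity; no weak convergence is needed. Fatou's lemma then shows that the limit
  is a minimizer. As \<open>\<omega> < - \<lambda>\<^sub>0\<close>, the action takes negative values, so the minimizer is nonzero,
  and the derivative of \<open>t \<mapsto> S (t \<phi>)\<close> at \<open>t = 1\<close> puts it on the Nehari manifold.\<close>

text \<open>Weak derivatives are accessible only through test functions, and products of
  one-variable functions suffice for them: partial derivatives of such products and their averages
  along an axis are again products. This turns a weak derivative into a formula for the translates
  of a function, and the inequality for cell averages is an integral over translates.

  The functionals are integrals of densities in three independent variables: the point, the value
  \<open>a\<close> and the gradient \<open>v\<close>. Convexity, coercivity and scaling thereby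
  become statements about numbers. Two terms threaten coercivity. \<open>\<omega>\<close> may be
  negative: far out the potential absorbs its term, and on the remaining ball the power
  \<open>p + 1\<close> does, because \<beta> > 0. The rotation term has unbounded coefficients and
  no sign, but pointwise it is at most a fraction \<theta> < 1 of the gradient and potential terms.

  Measurability needs care as well: weak gradients are arbitrary choices up to null sets, and
  \<open>V\<close> itself need not be measurable. Completeness of Lebesgue measure repairs both,
  since a function that agrees almost everywhere with a measurable one is measurable.\<close>

abbreviation nn_L2 :: "'a measure \<Rightarrow> ('a \<Rightarrow> 'b::real_normed_vector) \<Rightarrow> ennreal" where
  "nn_L2 M f \<equiv> \<integral>\<^sup>+x. ennreal ((norm (f x))^2) \<partial>M"

abbreviation sq_int :: "'a measure \<Rightarrow> ('a \<Rightarrow> 'b::real_normed_vector) \<Rightarrow> real" where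
  "sq_int M f \<equiv> \<integral>x. (norm (f x))^2 \<partial>M"

abbreviation grad :: "(real^'n::finite \<Rightarrow> complex) \<Rightarrow> real^'n \<Rightarrow> 'n \<Rightarrow> complex" where
  "grad \<phi> x \<equiv> \<lambda>i. weak_partial i \<phi> x"

subsection \<open>Smooth test functions of product form\<close>

text \<open>The derivative is quantified existentially so that the inductions below can supply it as
  a formula. Each order asks for one more derivative on the whole line; all orders together amount
  to infinite differentiability.\<close>

primrec differentiable_times :: "nat \<Rightarrow> (real \<Rightarrow> real) \<Rightarrow> bool" where
  "differentiable_times 0 f \<longleftrightarrow> True"
| "differentiable_times (Suc k) f \<longleftrightarrow>
     (\<exists>f'. (\<forall>t. (f has_real_derivative f' t) (at t)) \<and> differentiable_times k f')"

lemma differentiable_times_SucI: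
  assumes "\<And>t. (f has_real_derivative f' t) (at t)" "differentiable_times k f'"
  shows "differentiable_times (Suc k) f"
  using assms by (auto intro!: exI[of _ f'])

definition smooth1 :: "(real \<Rightarrow> real) \<Rightarrow> bool" where
  "smooth1 f \<longleftrightarrow> (\<forall>k. differentiable_times k f)"

lemma differentiable_times_Suc_D: "differentiable_times (Suc k) f \<Longrightarrow> differentiable_times k f"
proof (induction k arbitrary: f)
  case (Suc k)
  then obtain f' where f': "\<forall>t. (f has_real_derivative f' t) (at t)"
    "differentiable_times (Suc k) f'"
    by auto
  then have "differentiable_times k f'" using Suc.IH by blast
  then show ?case using f' by auto
qed simp

lemma differentiable_times_add:
  "differentiable_times k f \<Longrightarrow> differentiable_times k g \<Longrightarrow> differentiable_times k (\<lambda>t. f t + g t)"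
proof (induction k arbitrary: f g)
  case (Suc k)
  obtain f' g' where *: "\<forall>t. (f has_real_derivative f' t) (at t)" "differentiable_times k f'"
     "\<forall>t. (g has_real_derivative g' t) (at t)" "differentiable_times k g'"
    using Suc.prems by auto
  have "\<forall>t. ((\<lambda>t. f t + g t) has_real_derivative f' t + g' t) (at t)"
    using * by (auto intro!: derivative_intros)
  then show ?case using Suc.IH * by auto
qed simp

lemma differentiable_times_mult:
  "differentiable_times k f \<Longrightarrow> differentiable_times k g \<Longrightarrow> differentiable_times k (\<lambda>t. f t * g t)"
proof (induction k arbitrary: f g)
  case (Suc k)
  obtain f' g' where *: "\<forall>t. (f has_real_derivative f' t) (at t)" "differentiable_times k f'"
     "\<forall>t. (g has_real_derivative g' t) (at t)" "differentiable_times k g'"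
    using Suc.prems by auto
  have "\<forall>t. ((\<lambda>t. f t * g t) has_real_derivative f' t * g t + g' t * f t) (at t)"
    using * by (auto intro!: DERIV_mult)
  moreover have "differentiable_times k (\<lambda>t. f' t * g t + g' t * f t)"
    using Suc.IH * Suc.prems differentiable_times_Suc_D by (intro differentiable_times_add) blast+
  ultimately show ?case by auto
qed simp

lemma differentiable_times_const: "differentiable_times k (\<lambda>t. c)"
proof (induction k arbitrary: c)
  case (Suc k)
  show ?case by (rule differentiable_times_SucI[where f'="\<lambda>_. 0"]) (use Suc in auto)
qed simp

lemma differentiable_times_affine:
  "differentiable_times k f \<Longrightarrow> differentiable_times k (\<lambda>t. f (c * t + d))"
proof (induction k arbitrary: f)
  case (Suc k)
  obtain f' where *: "\<And>t. (f has_real_derivative f' t) (at t)" "differentiable_times k f'"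
    using Suc.prems by auto
  have "((\<lambda>t. f (c * t + d)) has_real_derivative c * f' (c * t + d)) (at t)" for t
  proof -
    have "((\<lambda>t. c * t + d) has_real_derivative c) (at t)"
      by (auto intro!: derivative_eq_intros)
    from DERIV_chain2[OF *(1) this] show ?thesis by (simp add: mult.commute)
  qed
  then show ?case
    by (rule differentiable_times_SucI)
      (intro differentiable_times_mult differentiable_times_const Suc.IH *)
qed simp

lemma smooth1_DERIV: "smooth1 f \<Longrightarrow> (f has_real_derivative deriv f t) (at t)"
proof -
  assume "smooth1 f"
  then have "differentiable_times (Suc 0) f" unfolding smooth1_def by blast
  then show ?thesis by (auto simp: DERIV_deriv_iff_real_differentiable real_differentiable_def)
qed

lemma smooth1_deriv: "smooth1 f \<Longrightarrow> smooth1 (deriv f)"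
  unfolding smooth1_def
proof
  fix k assume "\<forall>k. differentiable_times k f"
  then have "differentiable_times (Suc k) f" by blast
  then obtain f' where f': "\<forall>t. (f has_real_derivative f' t) (at t)" "differentiable_times k f'"
    by auto
  then have "deriv f = f'" by (auto simp: DERIV_imp_deriv)
  then show "differentiable_times k (deriv f)" using f' by simp
qed

lemma smooth1_I:
  assumes "\<And>t. (f has_real_derivative f' t) (at t)" "smooth1 f'"
  shows "smooth1 f"
  unfolding smooth1_def
proof
  fix k show "differentiable_times k f"
    using assms differentiable_times_Suc_D unfolding smooth1_def by (cases k) auto
qed

lemma smooth1_add: "smooth1 f \<Longrightarrow> smooth1 g \<Longrightarrow> smooth1 (\<lambda>t. f t + g t)"
  and smooth1_mult: "smooth1 f \<Longrightarrow> smooth1 g \<Longrightarrow> smooth1 (\<lambda>t. f t * g t)"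
  and smooth1_const: "smooth1 (\<lambda>t. c)"
  and smooth1_affine: "smooth1 f \<Longrightarrow> smooth1 (\<lambda>t. f (c * t + d))"
  by (auto simp: smooth1_def differentiable_times_add differentiable_times_mult
      differentiable_times_const differentiable_times_affine)

lemma smooth1_continuous: "smooth1 f \<Longrightarrow> continuous_on A f"
  by (meson DERIV_isCont continuous_at_imp_continuous_on smooth1_DERIV)

section \<open>A smooth cutoff on the line\<close>

definition exp_recip :: "nat \<Rightarrow> real \<Rightarrow> real" where
  "exp_recip n t = (if t > 0 then exp (- 1 / t) / t ^ n else 0)"

text \<open>A single term of the series of \<open>exp (1 / t)\<close> gives this. Decay of order two
  at the origin makes the difference quotients of \<open>exp_recip n\<close> at \<open>0\<close>
  tend to zero.\<close>

lemma exp_recip_bound: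
  "\<bar>exp_recip n t\<bar> \<le> fact (n + 2) * t^2"
proof (cases "t > 0")
  case True
  have "(1 / t) ^ (n + 2) / fact (n + 2) \<le> exp (1 / t)"
  proof -
    have s: "summable (\<lambda>k. (1 / t) ^ k / fact k)"
      using summable_exp[of "1 / t"] by (simp add: field_simps)
    have "(\<Sum>k\<in>{n + 2}. (1 / t) ^ k / fact k) \<le> (\<Sum>k. (1 / t) ^ k / fact k)"
      using s True by (intro sum_le_suminf) auto
    then show ?thesis by (simp add: exp_def field_simps)
  qed
  then have "exp (- 1 / t) \<le> fact (n + 2) * t ^ (n + 2)"
    using True by (simp add: exp_minus divide_simps power_divide del: fact_Suc power_Suc) (simp add: mult_ac)
  then show ?thesis
    using True by (simp add: exp_recip_def field_simps power_add power2_eq_square del: fact_Suc)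
qed (simp add: exp_recip_def)

lemma exp_recip_DERIV:
  "(exp_recip n has_real_derivative (exp_recip (n + 2) t + - real n * exp_recip (n + 1) t)) (at t)"
proof -
  consider "t > 0" | "t < 0" | "t = 0" by linarith
  then show ?thesis
  proof cases
    case 1
    have "((\<lambda>t. exp (- 1 / t) / t ^ n) has_real_derivative
       (exp_recip (n + 2) t + - real n * exp_recip (n + 1) t)) (at t)"
      using 1
      apply (auto intro!: derivative_eq_intros simp: exp_recip_def)
      apply (cases n)
       apply (auto simp: field_simps power2_eq_square)
      done
    then show ?thesis
      by (rule has_field_derivative_transform_within_open[where S="{0<..}"])
        (use 1 in \<open>auto simp: exp_recip_def\<close>)
  next
    case 2
    have "((\<lambda>t. 0) has_real_derivative
       (exp_recip (n + 2) t + - real n * exp_recip (n + 1) t)) (at t)"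
      using 2 by (auto intro!: derivative_eq_intros simp: exp_recip_def)
    then show ?thesis
      by (rule has_field_derivative_transform_within_open[where S="{..<0}"])
        (use 2 in \<open>auto simp: exp_recip_def\<close>)
  next
    case 3
    have "((\<lambda>h. exp_recip n h / h) \<longlongrightarrow> 0) (at 0)"
    proof (rule Lim_null_comparison)
      show "\<forall>\<^sub>F h in at 0. norm (exp_recip n h / h) \<le> fact (n + 2) * \<bar>h\<bar>"
      proof (rule always_eventually, rule allI)
        fix h :: real
        show "norm (exp_recip n h / h) \<le> fact (n + 2) * \<bar>h\<bar>"
        proof (cases "h = 0")
          case False
          have "\<bar>exp_recip n h\<bar> \<le> fact (n + 2) * \<bar>h\<bar> * \<bar>h\<bar>"
            using exp_recip_bound[of n h] by (simp add: power2_eq_square mult.assoc del: fact_Suc)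
          then show ?thesis using False by (simp add: pos_divide_le_eq del: fact_Suc)
        qed (simp del: fact_Suc)
      qed
      show "((\<lambda>h. fact (n + 2) * \<bar>h\<bar>) \<longlongrightarrow> 0) (at (0::real))"
        by (auto intro!: tendsto_eq_intros simp del: fact_Suc)
    qed
    then show ?thesis using 3 by (simp add: DERIV_def exp_recip_def)
  qed
qed

text \<open>The powers of \<open>t\<close> in the denominator make the family closed under
  differentiation up to linear combinations, so the induction on the order has to treat all
  \<open>n\<close> at once.\<close>

lemma smooth1_exp_recip: "smooth1 (exp_recip n)"
proof -
  have "differentiable_times k (exp_recip n)" for k
  proof (induction k arbitrary: n)
    case (Suc k)
    show ?case
      by (rule differentiable_times_SucI[OF exp_recip_DERIV])
        (intro differentiable_times_add differentiable_times_mult differentiable_times_const Suc)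
  qed simp
  then show ?thesis by (simp add: smooth1_def)
qed

text \<open>For \<open>c > 0\<close> the scale \<open>c\<close> affects the steepness and not the
  support, so letting it grow fills the open interval from below.\<close>

definition bump :: "real \<Rightarrow> real \<Rightarrow> real \<Rightarrow> real \<Rightarrow> real" where
  "bump c a b t = exp_recip 0 (c * (t - a)) * exp_recip 0 (c * (b - t))"

lemma smooth1_bump: "smooth1 (bump c a b)"
proof -
  have "smooth1 (\<lambda>t. exp_recip 0 (c * t + (- c * a)) * exp_recip 0 (- c * t + c * b))"
    by (intro smooth1_mult smooth1_affine smooth1_exp_recip)
  then show ?thesis unfolding bump_def by (simp add: algebra_simps)
qed

lemma bump_range: "0 \<le> bump c a b t" "bump c a b t \<le> 1"
proof -
  have "0 \<le> exp_recip 0 s" "exp_recip 0 s \<le> 1" for s by (auto simp: exp_recip_def)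
  then show "0 \<le> bump c a b t" "bump c a b t \<le> 1"
    unfolding bump_def by (auto intro!: mult_le_one)
qed

lemma bump_support: "c > 0 \<Longrightarrow> t \<notin> {a<..<b} \<Longrightarrow> bump c a b t = 0"
  by (auto simp: bump_def exp_recip_def zero_less_mult_iff)

lemma bump_LIMSEQ: "(\<lambda>n. bump (real (Suc n)) a b t) \<longlonglongrightarrow> indicator {a<..<b} t"
proof (cases "t \<in> {a<..<b}")
  case True
  have *: "(\<lambda>n. exp_recip 0 (real (Suc n) * s)) \<longlonglongrightarrow> 1" if "s > 0" for s
  proof -
    have "(\<lambda>n. exp ((- 1 / s) * inverse (real (Suc n)))) \<longlonglongrightarrow> exp ((- 1 / s) * 0)"
      by (intro tendsto_intros LIMSEQ_inverse_real_of_nat)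
    moreover have "exp ((- 1 / s) * inverse (real (Suc n))) = exp_recip 0 (real (Suc n) * s)" for n
      using that by (simp add: exp_recip_def divide_simps mult_pos_pos add_pos_pos)
    ultimately show ?thesis by simp
  qed
  have "(\<lambda>n. bump (real (Suc n)) a b t) \<longlonglongrightarrow> 1 * 1"
    unfolding bump_def using True by (intro tendsto_mult *) auto
  then show ?thesis using True by simp
next
  case False
  then have "bump (real (Suc n)) a b t = 0" for n by (intro bump_support) auto
  then show ?thesis using False by simp
qed

section \<open>Products of one-variable functions as test functions\<close>

lemma partial_deriv_prod:
  fixes g :: "'n::finite \<Rightarrow> real \<Rightarrow> real"
  assumes "\<And>i. smooth1 (g i)"
  shows "(\<lambda>x::real^'n. \<Prod>i\<in>UNIV. g i (x $ i)) differentiable (at x)"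
    and "partial_deriv j (\<lambda>x::real^'n. \<Prod>i\<in>UNIV. g i (x $ i)) =
      (\<lambda>x. \<Prod>i\<in>UNIV. (g(j := deriv (g j))) i (x $ i))"
proof -
  have d: "((\<lambda>x::real^'n. \<Prod>i\<in>UNIV. g i (x $ i)) has_derivative
     (\<lambda>y. \<Sum>i\<in>UNIV. (y $ i * deriv (g i) (x $ i)) * (\<Prod>j\<in>UNIV - {i}. g j (x $ j)))) (at x)" for x
  proof (rule has_derivative_prod)
    fix i :: 'n
    have "(g i has_derivative (\<lambda>y. deriv (g i) (x $ i) * y)) (at (x $ i))"
      using smooth1_DERIV[OF assms] by (simp add: has_field_derivative_def)
    then show "((\<lambda>x. g i (x $ i)) has_derivative (\<lambda>y. y $ i * deriv (g i) (x $ i))) (at x)"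
      using has_derivative_compose[of "\<lambda>x. x $ i" "\<lambda>y. y $ i" x UNIV "g i"]
      by (simp add: bounded_linear_imp_has_derivative bounded_linear_vec_nth mult.commute)
  qed
  then show "(\<lambda>x::real^'n. \<Prod>i\<in>UNIV. g i (x $ i)) differentiable (at x)"
    by (auto simp: differentiable_def)
  show "partial_deriv j (\<lambda>x::real^'n. \<Prod>i\<in>UNIV. g i (x $ i)) =
      (\<lambda>x. \<Prod>i\<in>UNIV. (g(j := deriv (g j))) i (x $ i))"
  proof
    fix x :: "real^'n"
    have "partial_deriv j (\<lambda>x::real^'n. \<Prod>i\<in>UNIV. g i (x $ i)) x =
      (\<Sum>i\<in>UNIV. (axis j 1 $ i * deriv (g i) (x $ i)) * (\<Prod>j\<in>UNIV - {i}. g j (x $ j)))"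
      unfolding partial_deriv_def by (subst frechet_derivative_at[OF d[of x], symmetric]) simp
    also have "\<dots> = (\<Sum>i\<in>UNIV. if i = j then deriv (g i) (x $ i) * (\<Prod>j\<in>UNIV - {i}. g j (x $ j)) else 0)"
      by (intro sum.cong) (auto simp: axis_def)
    also have "\<dots> = deriv (g j) (x $ j) * (\<Prod>i\<in>UNIV - {j}. g i (x $ i))"
      by simp
    also have "\<dots> = (\<Prod>i\<in>UNIV. (g(j := deriv (g j))) i (x $ i))"
      by (subst prod.remove[of UNIV j]) auto
    finally show "partial_deriv j (\<lambda>x::real^'n. \<Prod>i\<in>UNIV. g i (x $ i)) x =
      (\<Prod>i\<in>UNIV. (g(j := deriv (g j))) i (x $ i))" .
  qed
qed

text \<open>A partial derivative of a product replaces one factor by its derivative. Every iterated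
  partial derivative is therefore again a product with smooth factors, and differentiability of such
  products covers all of them.\<close>

lemma smooth_prod:
  fixes g :: "'n::finite \<Rightarrow> real \<Rightarrow> real"
  assumes "\<And>i. smooth1 (g i)"
  shows "smooth (\<lambda>x::real^'n. \<Prod>i\<in>UNIV. g i (x $ i))"
proof -
  have "\<exists>g'. (\<forall>i. smooth1 (g' i)) \<and>
     foldr partial_deriv is (\<lambda>x::real^'n. \<Prod>i\<in>UNIV. g i (x $ i)) = (\<lambda>x. \<Prod>i\<in>UNIV. g' i (x $ i))" for "is"
  proof (induction "is")
    case Nil
    then show ?case using assms by auto
  next
    case (Cons j "is")
    then obtain g' where g': "\<And>i. smooth1 (g' i)"
     "foldr partial_deriv is (\<lambda>x::real^'n. \<Prod>i\<in>UNIV. g i (x $ i)) = (\<lambda>x. \<Prod>i\<in>UNIV. g' i (x $ i))"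
      by auto
    show ?case
      by (rule exI[of _ "g'(j := deriv (g' j))"])
        (use g' in \<open>auto simp: partial_deriv_prod(2) smooth1_deriv\<close>)
  qed
  note ex = this
  have "foldr partial_deriv is (\<lambda>x::real^'n. \<Prod>i\<in>UNIV. g i (x $ i)) differentiable at x" for "is" x
  proof -
    obtain g' where g': "\<And>i. smooth1 (g' i)"
     "foldr partial_deriv is (\<lambda>x::real^'n. \<Prod>i\<in>UNIV. g i (x $ i)) = (\<lambda>x. \<Prod>i\<in>UNIV. g' i (x $ i))"
      using ex[of "is"] by auto
    show ?thesis unfolding g'(2) by (rule partial_deriv_prod(1)[OF g'(1)])
  qed
  then show ?thesis
    by (auto simp: smooth_def)
qed

lemma test_functions_prod:
  fixes g :: "'n::finite \<Rightarrow> real \<Rightarrow> real"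
  assumes "\<And>i. smooth1 (g i)" and "\<And>i t. t \<notin> {a i..b i} \<Longrightarrow> g i t = 0"
  shows "(\<lambda>x::real^'n. \<Prod>i\<in>UNIV. g i (x $ i)) \<in> test_functions"
proof -
  have "{x::real^'n. (\<Prod>i\<in>UNIV. g i (x $ i)) \<noteq> 0} \<subseteq> cbox (\<chi> i. a i) (\<chi> i. b i)"
    using assms(2) by (fastforce simp: mem_box_cart)
  then have "closure {x::real^'n. (\<Prod>i\<in>UNIV. g i (x $ i)) \<noteq> 0} \<subseteq> cbox (\<chi> i. a i) (\<chi> i. b i)"
    by (simp add: closure_minimal closed_cbox)
  then have "compact (closure {x::real^'n. (\<Prod>i\<in>UNIV. g i (x $ i)) \<noteq> 0})"
    using bounded_subset[OF bounded_cbox] by (auto simp: compact_eq_bounded_closed)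
  then show ?thesis by (simp add: test_functions_def smooth_prod assms(1))
qed

subsection \<open>Weak derivatives\<close>

lemma norm_le_one_plus_square: "norm z \<le> 1 + (norm z)^2"
  using sum_squares_bound[of 1 "norm z"] norm_ge_zero[of z] by (simp del: norm_ge_zero)

lemma norm_add_square_le: "(norm (a + b))^2 \<le> 2 * (norm a)^2 + 2 * (norm b)^2"
proof -
  have "(norm (a + b))^2 \<le> (norm a + norm b)^2" by (intro power_mono norm_triangle_ineq) auto
  then show ?thesis using sum_squares_bound[of "norm a" "norm b"] by (simp add: power2_sum)
qed

lemma Cauchy_Schwarz_integral:
  fixes f g :: "'a \<Rightarrow> 'b::{real_normed_field, banach, second_countable_topology}"
  assumes [measurable]: "f \<in> borel_measurable M" "g \<in> borel_measurable M"
    and f: "integrable M (\<lambda>x. (norm (f x))^2)" and g: "integrable M (\<lambda>x. (norm (g x))^2)"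
  shows "integrable M (\<lambda>x. f x * g x)"
    and "(norm (\<integral>x. f x * g x \<partial>M))^2 \<le> (\<integral>x. (norm (f x))^2 \<partial>M) * (\<integral>x. (norm (g x))^2 \<partial>M)"
proof -
  show i: "integrable M (\<lambda>x. f x * g x)"
  proof (rule Bochner_Integration.integrable_bound)
    show "integrable M (\<lambda>x. (norm (f x))^2 + (norm (g x))^2)" using f g by simp
    have "a * b \<le> a^2 + b^2" if "a \<ge> 0" "b \<ge> 0" for a b :: real
      using sum_squares_bound[of a b] mult_nonneg_nonneg[OF that] by linarith
    then show "AE x in M. norm (f x * g x) \<le> norm ((norm (f x))^2 + (norm (g x))^2)"
      by (simp add: norm_mult)
  qed simp
  have "(norm (\<integral>x. f x * g x \<partial>M))^2 \<le> (\<integral>x. norm (f x) * norm (g x) \<partial>M)^2"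
    using integral_norm_bound[of M "\<lambda>x. f x * g x"] by (intro power_mono) (auto simp: norm_mult)
  moreover
  have "ennreal ((\<integral>x. norm (f x) * norm (g x) \<partial>M)^2)
    \<le> ennreal ((\<integral>x. (norm (f x))^2 \<partial>M) * (\<integral>x. (norm (g x))^2 \<partial>M))"
  proof -
    have "ennreal ((\<integral>x. norm (f x) * norm (g x) \<partial>M)^2)
        = (\<integral>\<^sup>+x. ennreal (norm (f x)) * ennreal (norm (g x)) \<partial>M)^2"
      using integrable_norm[OF i]
      by (subst ennreal_power[symmetric], simp)
        (simp add: norm_mult nn_integral_eq_integral ennreal_mult[symmetric])
    also have "\<dots> \<le> (\<integral>\<^sup>+x. ennreal (norm (f x)) ^ 2 \<partial>M) * (\<integral>\<^sup>+x. ennreal (norm (g x)) ^ 2 \<partial>M)"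
      by (rule Cauchy_Schwarz_nn_integral) auto
    also have "\<dots> = ennreal (\<integral>x. (norm (f x))^2 \<partial>M) * ennreal (\<integral>x. (norm (g x))^2 \<partial>M)"
      using f g by (simp add: ennreal_power nn_integral_eq_integral)
    finally show ?thesis by (simp add: ennreal_mult)
  qed
  then have "(\<integral>x. norm (f x) * norm (g x) \<partial>M)^2
    \<le> (\<integral>x. (norm (f x))^2 \<partial>M) * (\<integral>x. (norm (g x))^2 \<partial>M)"
    by (subst (asm) ennreal_le_iff) (auto intro!: mult_nonneg_nonneg)
  ultimately show "(norm (\<integral>x. f x * g x \<partial>M))^2
      \<le> (\<integral>x. (norm (f x))^2 \<partial>M) * (\<integral>x. (norm (g x))^2 \<partial>M)"
    by (rule order_trans)
qed

section \<open>Test functions and local integrability\<close>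

lemma test_function_differentiable: "\<psi> \<in> test_functions \<Longrightarrow> \<psi> differentiable at x"
  unfolding test_functions_def smooth_def by (auto dest!: spec[of _ "[]"])

lemma test_function_continuous: "\<psi> \<in> test_functions \<Longrightarrow> continuous_on A \<psi>"
  by (meson continuous_at_imp_continuous_on differentiable_imp_continuous_within
      test_function_differentiable)

lemma partial_deriv_test_function:
  assumes "\<psi> \<in> test_functions"
  shows "partial_deriv i \<psi> \<in> test_functions"
proof -
  let ?K = "closure {x. \<psi> x \<noteq> 0}"
  have "smooth (partial_deriv i \<psi>)"
    unfolding smooth_def
  proof (intro allI)
    fix "is" x
    \<comment> \<open>\<open>foldr\<close> applies the last entry of the list first, so
      differentiating along \<open>i\<close> before the rest means appending
      \<open>i\<close>.\<close>
    have "foldr partial_deriv (is @ [i]) \<psi> differentiable at x"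
      using assms unfolding test_functions_def smooth_def by blast
    then show "foldr partial_deriv is (partial_deriv i \<psi>) differentiable at x" by simp
  qed
  moreover have "partial_deriv i \<psi> x = 0" if "x \<notin> ?K" for x
  proof -
    have "(\<psi> has_derivative (\<lambda>_. 0)) (at x)"
    proof (rule has_derivative_transform_within_open)
      show "((\<lambda>_. 0) has_derivative (\<lambda>_. 0)) (at x)" by simp
      show "open (- ?K)" by auto
      show "x \<in> - ?K" using that by simp
      show "0 = \<psi> y" if "y \<in> - ?K" for y
        using that closure_subset[of "{x. \<psi> x \<noteq> 0}"] by auto
    qed
    then show ?thesis unfolding partial_deriv_def by (metis frechet_derivative_at)
  qed
  then have "{x. partial_deriv i \<psi> x \<noteq> 0} \<subseteq> ?K" by blast
  then have "closure {x. partial_deriv i \<psi> x \<noteq> 0} \<subseteq> ?K" by (simp add: closure_minimal)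
  then have "compact (closure {x. partial_deriv i \<psi> x \<noteq> 0})"
    using assms bounded_subset[of ?K] unfolding test_functions_def compact_eq_bounded_closed by auto
  ultimately show ?thesis by (simp add: test_functions_def)
qed

lemma test_function_bound:
  assumes "\<psi> \<in> test_functions"
  obtains M K where "compact K" "M \<ge> 0" "\<And>x. \<bar>\<psi> x\<bar> \<le> M * indicator K x"
proof -
  let ?K = "closure {x. \<psi> x \<noteq> 0}"
  have K: "compact ?K" using assms by (simp add: test_functions_def)
  have "compact (\<psi> ` ?K)"
    by (rule compact_continuous_image[OF test_function_continuous[OF assms] K])
  then obtain M where M: "\<forall>y\<in>\<psi> ` ?K. norm y \<le> M"
    using compact_imp_bounded bounded_iff by metis
  have "\<bar>\<psi> x\<bar> \<le> max M 0 * indicator ?K x" for x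
  proof (cases "x \<in> ?K")
    case True
    then show ?thesis using M by (auto simp: indicator_def)
  next
    case False
    then have "\<psi> x = 0" using closure_subset[of "{x. \<psi> x \<noteq> 0}"] by auto
    then show ?thesis by (simp add: indicator_def)
  qed
  then show ?thesis using that[OF K, of "max M 0"] by simp
qed

lemma test_function_measurable:
  "\<psi> \<in> test_functions \<Longrightarrow> \<psi> \<in> borel_measurable borel"
  by (simp add: borel_measurable_continuous_onI test_function_continuous)

lemma lborel_measurable_imp_lebesgue: "f \<in> borel_measurable borel \<Longrightarrow> f \<in> borel_measurable lebesgue"
  by (rule measurable_completion) simp

lemma test_function_integrable_square:
  assumes "\<psi> \<in> test_functions"
  shows "integrable lebesgue (\<lambda>x. (norm (complex_of_real (\<psi> x)))^2)"
proof -
  obtain M K where MK: "compact K" "M \<ge> 0" "\<And>x. \<bar>\<psi> x\<bar> \<le> M * indicator K x"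
    using test_function_bound[OF assms] by metis
  have K: "K \<in> lmeasurable" using MK lmeasurable_compact by blast
  then have "integrable lebesgue (\<lambda>x. M^2 * indicator K x)"
    by (intro integrable_mult_right) (auto simp: integrable_on_indicator fmeasurable_def)
  then show ?thesis
  proof (rule Bochner_Integration.integrable_bound)
    show "(\<lambda>x. (cmod (complex_of_real (\<psi> x)))^2) \<in> borel_measurable lebesgue"
      using lborel_measurable_imp_lebesgue[OF test_function_measurable[OF assms]] by simp
    have "\<bar>\<psi> x\<bar>^2 \<le> (M * indicator K x)^2" for x
      using MK(3) by (intro power_mono) auto
    then have "(\<psi> x)^2 \<le> M^2 * indicator K x" for x
      by (metis (no_types, opaque_lifting) indicator_def mult.right_neutral mult_zero_right power2_abs
          power_mult_distrib power_one zero_power2 of_bool_def)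
    then show "AE x in lebesgue. norm ((cmod (complex_of_real (\<psi> x)))^2) \<le> norm (M^2 * indicator K x)"
      by (intro AE_I2) (simp add: order_trans[OF _ abs_ge_self])
  qed
qed

text \<open>The definition speaks of restrictions to compact sets; global measurability comes from
  writing \<open>f\<close> as the pointwise limit of its restrictions to growing balls.\<close>

lemma locally_integrable_imp_measurable:
  fixes f :: "real^'n::finite \<Rightarrow> complex"
  assumes "locally_integrable f"
  shows "f \<in> borel_measurable lebesgue"
proof (rule borel_measurable_LIMSEQ_metric)
  fix k :: nat
  have "set_integrable lebesgue (cball 0 (real k)) f"
    using assms by (simp add: locally_integrable_def)
  then show "(\<lambda>x. indicator (cball 0 (real k)) x *\<^sub>R f x) \<in> borel_measurable lebesgue"
    unfolding set_integrable_def by (rule borel_measurable_integrable)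
next
  fix x :: "real^'n"
  obtain N :: nat where "norm x \<le> real N" using real_arch_simple by blast
  then have "\<forall>\<^sub>F k in sequentially. indicator (cball 0 (real k)) x *\<^sub>R f x = f x"
    by (intro eventually_sequentiallyI[of N]) auto
  then show "(\<lambda>k. indicator (cball 0 (real k)) x *\<^sub>R f x) \<longlonglongrightarrow> f x"
    by (rule tendsto_eventually)
qed

lemma locally_integrable_mult_test_function:
  fixes f :: "real^'n::finite \<Rightarrow> complex"
  assumes f: "locally_integrable f" and "\<psi> \<in> test_functions"
  shows "integrable lebesgue (\<lambda>x. f x * of_real (\<psi> x))"
proof -
  obtain M K where MK: "compact K" "M \<ge> 0" "\<And>x. \<bar>\<psi> x\<bar> \<le> M * indicator K x"
    using test_function_bound[OF assms(2)] by metis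
  have "set_integrable lebesgue K f" using f MK by (simp add: locally_integrable_def)
  then have "integrable lebesgue (\<lambda>x. M * norm (indicator K x *\<^sub>R f x))"
    unfolding set_integrable_def by (intro integrable_mult_right integrable_norm)
  then show ?thesis
  proof (rule Bochner_Integration.integrable_bound)
    show "(\<lambda>x. f x * complex_of_real (\<psi> x)) \<in> borel_measurable lebesgue"
      using locally_integrable_imp_measurable[OF f]
        lborel_measurable_imp_lebesgue[OF test_function_measurable[OF assms(2)]] by measurable
    show "AE x in lebesgue. norm (f x * complex_of_real (\<psi> x)) \<le> norm (M * norm (indicator K x *\<^sub>R f x))"
    proof (rule AE_I2)
      fix x
      have "norm (f x * complex_of_real (\<psi> x)) = norm (f x) * \<bar>\<psi> x\<bar>" by (simp add: norm_mult)
      also have "\<dots> \<le> norm (f x) * (M * indicator K x)"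
        using MK(3)[of x] by (intro mult_left_mono) auto
      finally show "norm (f x * complex_of_real (\<psi> x)) \<le> norm (M * norm (indicator K x *\<^sub>R f x))"
        using MK(2) by (simp add: mult_ac abs_mult)
    qed
  qed
qed

lemma square_integrable_imp_locally_integrable:
  fixes f :: "real^'n::finite \<Rightarrow> complex"
  assumes f: "f \<in> borel_measurable lebesgue" "integrable lebesgue (\<lambda>x. (norm (f x))^2)"
  shows "locally_integrable f"
  unfolding locally_integrable_def set_integrable_def
proof (intro allI impI)
  fix K :: "(real^'n) set" assume K: "compact K"
  then have K': "K \<in> lmeasurable" using lmeasurable_compact by blast
  show "integrable lebesgue (\<lambda>x. indicator K x *\<^sub>R f x)"
  proof (rule Bochner_Integration.integrable_bound)
    show "integrable lebesgue (\<lambda>x. indicator K x + (norm (f x))^2)"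
      using K' f(2) by (intro Bochner_Integration.integrable_add) (auto simp: integrable_on_indicator fmeasurable_def)
    show "(\<lambda>x. indicator K x *\<^sub>R f x) \<in> borel_measurable lebesgue"
      using K' f(1) by (intro borel_measurable_scaleR borel_measurable_indicator) auto
    show "AE x in lebesgue. norm (indicator K x *\<^sub>R f x) \<le> norm (indicator K x + (norm (f x))^2)"
      by (auto simp: indicator_def norm_le_one_plus_square intro!: AE_I2)
  qed
qed

text \<open>The hypothesis speaks of products only, because these are the functions with which the
  translation formula can be tested. They suffice: products of bumps converge boundedly to the
  indicator of an open box, so \<open>u\<close> has integral zero over every box, and
  differentiating these integrals recovers \<open>u\<close>.\<close>

lemma fundamental_lemma:
  fixes u :: "real^'n::finite \<Rightarrow> complex"
  assumes u: "locally_integrable u"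
    and zero: "\<And>(g::'n \<Rightarrow> real \<Rightarrow> real) a b. (\<And>i. smooth1 (g i)) \<Longrightarrow> (\<And>i t. t \<notin> {a i..b i} \<Longrightarrow> g i t = 0) \<Longrightarrow>
       (\<integral>x. u x * of_real (\<Prod>i\<in>UNIV. g i (x $ i)) \<partial>lebesgue) = 0"
  shows "AE x in lebesgue. u x = 0"
proof -
  have int: "integral (cbox a b) u = 0" for a b
  proof -
    define bm where "bm = (\<lambda>n x. \<Prod>i\<in>UNIV. bump (real (Suc n)) (a $ i) (b $ i) (x $ i))"
    have sb: "set_integrable lebesgue (cbox a b) u"
      using u by (simp add: locally_integrable_def)
    then have sb': "set_integrable lebesgue (box a b) u"
      by (rule set_integrable_subset) (auto simp: box_subset_cbox)
    have "(\<lambda>n. \<integral>x. u x * of_real (bm n x) \<partial>lebesgue) \<longlonglongrightarrow> (\<integral>x. indicator (box a b) x *\<^sub>R u x \<partial>lebesgue)"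
    proof (rule integral_dominated_convergence)
      show "integrable lebesgue (\<lambda>x. norm (indicator (cbox a b) x *\<^sub>R u x))"
        using sb unfolding set_integrable_def by (rule integrable_norm)
      show "(\<lambda>x. indicator (box a b) x *\<^sub>R u x) \<in> borel_measurable lebesgue"
        using sb' unfolding set_integrable_def by (rule borel_measurable_integrable)
      show "(\<lambda>x. u x * of_real (bm n x)) \<in> borel_measurable lebesgue" for n
      proof -
        have "bm n \<in> test_functions" unfolding bm_def
          by (rule test_functions_prod[where a="\<lambda>i. a $ i" and b="\<lambda>i. b $ i"])
            (auto simp: smooth1_bump intro!: bump_support)
        from locally_integrable_mult_test_function[OF u this] show ?thesis
          by (rule borel_measurable_integrable)
      qed
      show "AE x in lebesgue. (\<lambda>n. u x * of_real (bm n x)) \<longlonglongrightarrow> indicator (box a b) x *\<^sub>R u x"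
      proof (rule AE_I2)
        fix x
        have "(\<lambda>n. bm n x) \<longlonglongrightarrow> (\<Prod>i\<in>UNIV. indicator {a $ i<..<b $ i} (x $ i))"
          unfolding bm_def by (intro tendsto_prod bump_LIMSEQ)
        also have "(\<Prod>i\<in>UNIV. indicator {a $ i<..<b $ i} (x $ i)) = (indicator (box a b) x :: real)"
          by (auto simp: indicator_def mem_box_cart)
        finally have "(\<lambda>n. u x * of_real (bm n x)) \<longlonglongrightarrow> u x * of_real (indicator (box a b) x)"
          by (intro tendsto_intros)
        then show "(\<lambda>n. u x * of_real (bm n x)) \<longlonglongrightarrow> indicator (box a b) x *\<^sub>R u x"
          by (simp add: scaleR_conv_of_real mult.commute)
      qed
      show "AE x in lebesgue. norm (u x * of_real (bm n x)) \<le> norm (indicator (cbox a b) x *\<^sub>R u x)" for n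
      proof (rule AE_I2)
        fix x
        have "\<bar>bm n x\<bar> \<le> indicator (cbox a b) x"
        proof (cases "x \<in> cbox a b")
          case True
          then show ?thesis unfolding bm_def
            by (auto simp: abs_prod intro!: prod_le_1 bump_range simp del: of_nat_Suc)
              (auto simp: abs_le_iff bump_range intro: order_trans[OF _ bump_range(1)])
        next
          case False
          then obtain i where "\<not> (a $ i \<le> x $ i \<and> x $ i \<le> b $ i)"
            unfolding mem_box_cart by blast
          then have "x $ i \<notin> {a $ i<..<b $ i}" by auto
          then have "bump (real (Suc n)) (a $ i) (b $ i) (x $ i) = 0" by (intro bump_support) auto
          then have "bm n x = 0" unfolding bm_def by (intro prod_zero) auto
          then show ?thesis by simp
        qed
        then have "cmod (u x) * \<bar>bm n x\<bar> \<le> cmod (u x) * indicator (cbox a b) x"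
          by (intro mult_left_mono) auto
        then show "norm (u x * of_real (bm n x)) \<le> norm (indicator (cbox a b) x *\<^sub>R u x)"
          by (simp add: norm_mult mult.commute)
      qed
    qed
    moreover have "(\<integral>x. u x * of_real (bm n x) \<partial>lebesgue) = 0" for n
      unfolding bm_def
      by (rule zero[where a="\<lambda>i. a $ i" and b="\<lambda>i. b $ i"])
        (auto simp: smooth1_bump intro!: bump_support)
    ultimately have "(\<integral>x. indicator (box a b) x *\<^sub>R u x \<partial>lebesgue) = 0"
      by (simp add: LIMSEQ_const_iff)
    then have "integral (box a b) u = 0"
      using set_lebesgue_integral_eq_integral(2)[OF sb'] by (simp add: set_lebesgue_integral_def)
    then show ?thesis by (simp add: integral_open_interval)
  qed
  have "u integrable_on cbox a b" for a b
    using u set_lebesgue_integral_eq_integral(1)[of "cbox a b" u]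
    by (simp add: locally_integrable_def compact_cbox)
  \<comment> \<open>Lebesgue differentiation: off a null set, the means of \<open>u\<close> over the
    cubes with corner \<open>x\<close> and side \<open>h\<close> tend to \<open>u x\<close>.\<close>
  then obtain N where N: "negligible N"
       "\<And>x e. \<lbrakk>x \<notin> N; 0 < e\<rbrakk> \<Longrightarrow>
               \<exists>d>0. \<forall>h. 0 < h \<and> h < d \<longrightarrow>
                         norm(integral (cbox x (x + h *\<^sub>R One)) u /\<^sub>R h ^ DIM(real^'n) - u x) < e"
    using integrable_ccontinuous_explicit by metis
  have "u x = 0" if "x \<notin> N" for x
  proof (rule ccontr)
    assume "u x \<noteq> 0"
    with N(2)[OF that, of "norm (u x)"] obtain d where
      "d > 0" and d: "\<And>h. 0 < h \<and> h < d \<Longrightarrow>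
         norm(integral (cbox x (x + h *\<^sub>R One)) u /\<^sub>R h ^ DIM(real^'n) - u x) < norm (u x)" by auto
    with d[of "d / 2"] show False by (simp add: int)
  qed
  then show ?thesis
    using N(1) by (intro AE_I'[of N]) (auto simp: negligible_iff_null_sets)
qed

section \<open>Calculus of weak partial derivatives\<close>

lemma has_weak_partialD:
  assumes "has_weak_partial i f g"
  shows "locally_integrable f" "locally_integrable g"
    "\<psi> \<in> test_functions \<Longrightarrow> (\<integral>x. f x * of_real (partial_deriv i \<psi> x) \<partial>lebesgue)
          = - (\<integral>x. g x * of_real (\<psi> x) \<partial>lebesgue)"
  using assms by (auto simp: has_weak_partial_def)

text \<open>\<open>weak_partial\<close> is an arbitrary choice about which only the defining
  property is known. Uniqueness transfers what is known of an exhibited weak derivative to the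
  chosen one, up to null sets.\<close>

lemma has_weak_partial_unique:
  fixes f :: "real^'n::finite \<Rightarrow> complex"
  assumes "has_weak_partial i f g" "has_weak_partial i f g'"
  shows "AE x in lebesgue. g x = g' x"
proof -
  note g = has_weak_partialD[OF assms(1)] and g' = has_weak_partialD[OF assms(2)]
  have "AE x in lebesgue. g x - g' x = 0"
  proof (rule fundamental_lemma)
    show "locally_integrable (\<lambda>x. g x - g' x)"
      using g(2) g'(2) by (auto simp: locally_integrable_def intro: set_integral_diff)
    fix h :: "'n \<Rightarrow> real \<Rightarrow> real" and a b
    assume "\<And>i. smooth1 (h i)" "\<And>i t. t \<notin> {a i..b i} \<Longrightarrow> h i t = 0"
    then have t: "(\<lambda>x. \<Prod>i\<in>UNIV. h i (x $ i)) \<in> test_functions" (is "?\<psi> \<in> _")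
      by (rule test_functions_prod)
    have "(\<integral>x. g x * of_real (?\<psi> x) \<partial>lebesgue) = (\<integral>x. g' x * of_real (?\<psi> x) \<partial>lebesgue)"
      using g(3)[OF t] g'(3)[OF t] by simp
    then show "(\<integral>x. (g x - g' x) * of_real (?\<psi> x) \<partial>lebesgue) = 0"
      using locally_integrable_mult_test_function[OF g(2) t] locally_integrable_mult_test_function[OF g'(2) t]
      by (simp add: left_diff_distrib)
  qed
  then show ?thesis by simp
qed

lemma has_weak_partial_weak_partial: "has_weak_partial i f g \<Longrightarrow> has_weak_partial i f (weak_partial i f)"
  unfolding weak_partial_def by (rule someI[of "has_weak_partial i f"])

lemma locally_integrable_cong_AE:
  fixes f f' :: "real^'n::finite \<Rightarrow> complex"
  assumes "locally_integrable f" "AE x in lebesgue. f x = f' x" "f' \<in> borel_measurable lebesgue"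
  shows "locally_integrable f'"
  unfolding locally_integrable_def set_integrable_def
proof (intro allI impI)
  fix K :: "(real^'n) set" assume K: "compact K"
  then have "integrable lebesgue (\<lambda>x. indicator K x *\<^sub>R f x)"
    using assms(1) by (auto simp: locally_integrable_def set_integrable_def)
  then show "integrable lebesgue (\<lambda>x. indicator K x *\<^sub>R f' x)"
  proof (rule integrable_cong_AE_imp)
    have "K \<in> sets lebesgue" using K lmeasurable_compact by blast
    then show "(\<lambda>x. indicator K x *\<^sub>R f' x) \<in> borel_measurable lebesgue"
      using assms(3) by (intro borel_measurable_scaleR borel_measurable_indicator) auto
    show "AE x in lebesgue. indicator K x *\<^sub>R f x = indicator K x *\<^sub>R f' x"
      using assms(2) by auto
  qed
qed

lemma has_weak_partial_cong_AE:
  fixes f f' :: "real^'n::finite \<Rightarrow> complex"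
  assumes "has_weak_partial i f g" "AE x in lebesgue. f x = f' x" "AE x in lebesgue. g x = g' x"
    "f' \<in> borel_measurable lebesgue" "g' \<in> borel_measurable lebesgue"
  shows "has_weak_partial i f' g'"
  unfolding has_weak_partial_def
proof (intro conjI ballI)
  note fg = has_weak_partialD[OF assms(1)]
  show l: "locally_integrable f'" "locally_integrable g'"
    using locally_integrable_cong_AE fg assms by blast+
  fix \<psi> :: "real^'n \<Rightarrow> real" assume \<psi>: "\<psi> \<in> test_functions"
  note m = locally_integrable_mult_test_function[THEN borel_measurable_integrable]
  have "(\<integral>x. f' x * of_real (partial_deriv i \<psi> x) \<partial>lebesgue) =
      (\<integral>x. f x * of_real (partial_deriv i \<psi> x) \<partial>lebesgue)"
    using assms(2) by (intro integral_cong_AE m fg l partial_deriv_test_function \<psi>) auto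
  moreover have "(\<integral>x. g' x * of_real (\<psi> x) \<partial>lebesgue) = (\<integral>x. g x * of_real (\<psi> x) \<partial>lebesgue)"
    using assms(3) by (intro integral_cong_AE m fg l \<psi>) auto
  ultimately show "(\<integral>x. f' x * of_real (partial_deriv i \<psi> x) \<partial>lebesgue)
          = - (\<integral>x. g' x * of_real (\<psi> x) \<partial>lebesgue)"
    using fg(3)[OF \<psi>] by simp
qed

lemma has_weak_partial_linear:
  fixes f f' :: "real^'n::finite \<Rightarrow> complex"
  assumes "has_weak_partial i f g" "has_weak_partial i f' g'"
  shows "has_weak_partial i (\<lambda>x. c * f x + d * f' x) (\<lambda>x. c * g x + d * g' x)"
  unfolding has_weak_partial_def
proof (intro conjI ballI)
  note fg = has_weak_partialD[OF assms(1)] and fg' = has_weak_partialD[OF assms(2)]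
  show "locally_integrable (\<lambda>x. c * f x + d * f' x)" "locally_integrable (\<lambda>x. c * g x + d * g' x)"
    using fg fg' by (auto simp: locally_integrable_def intro!: set_integral_add set_integrable_mult_right)
  fix \<psi> :: "real^'n \<Rightarrow> real" assume \<psi>: "\<psi> \<in> test_functions"
  note i = locally_integrable_mult_test_function[OF _ \<psi>]
    locally_integrable_mult_test_function[OF _ partial_deriv_test_function[OF \<psi>]]
  show "(\<integral>x. (c * f x + d * f' x) * of_real (partial_deriv i \<psi> x) \<partial>lebesgue)
          = - (\<integral>x. (c * g x + d * g' x) * of_real (\<psi> x) \<partial>lebesgue)"
    using i fg fg' \<psi> by (simp add: distrib_right mult.assoc)
qed

text \<open>For a fixed test function both sides of the defining identity are pairings with a square
  integrable function, hence continuous in square mean by Cauchy-Schwarz. Through this closedness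
  the limit of a minimizing sequence obtains its gradient.\<close>

lemma has_weak_partial_L2_limit:
  fixes f :: "real^'n::finite \<Rightarrow> complex"
  assumes wp: "\<And>n. has_weak_partial i (fn n) (gn n)"
    and f: "f \<in> borel_measurable lebesgue" "integrable lebesgue (\<lambda>x. (norm (f x))^2)"
    and g: "g \<in> borel_measurable lebesgue" "integrable lebesgue (\<lambda>x. (norm (g x))^2)"
    and fn: "\<And>n. integrable lebesgue (\<lambda>x. (norm (fn n x - f x))^2)"
      "(\<lambda>n. sq_int lebesgue (\<lambda>x. fn n x - f x)) \<longlonglongrightarrow> 0"
    and gn: "\<And>n. integrable lebesgue (\<lambda>x. (norm (gn n x - g x))^2)"
      "(\<lambda>n. sq_int lebesgue (\<lambda>x. gn n x - g x)) \<longlonglongrightarrow> 0"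
  shows "has_weak_partial i f g"
  unfolding has_weak_partial_def
proof (intro conjI ballI)
  show l: "locally_integrable f" "locally_integrable g"
    using f g square_integrable_imp_locally_integrable by blast+
  have lim: "(\<lambda>n. \<integral>x. hn n x * of_real (\<psi> x) \<partial>lebesgue) \<longlonglongrightarrow> (\<integral>x. h x * of_real (\<psi> x) \<partial>lebesgue)"
    if \<psi>: "\<psi> \<in> test_functions" and h: "locally_integrable h" "\<And>n. locally_integrable (hn n)"
      "\<And>n. integrable lebesgue (\<lambda>x. (norm (hn n x - h x))^2)"
      "(\<lambda>n. sq_int lebesgue (\<lambda>x. hn n x - h x)) \<longlonglongrightarrow> 0" for \<psi> h hn
  proof -
    let ?P = "sq_int lebesgue (\<lambda>x. complex_of_real (\<psi> x))"
    define D where "D n = (\<integral>x. hn n x * of_real (\<psi> x) \<partial>lebesgue) - (\<integral>x. h x * of_real (\<psi> x) \<partial>lebesgue)" for n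
    have "(norm (D n))^2 \<le> sq_int lebesgue (\<lambda>x. hn n x - h x) * ?P" for n
    proof -
      have "D n = (\<integral>x. (hn n x - h x) * of_real (\<psi> x) \<partial>lebesgue)"
        using locally_integrable_mult_test_function[OF h(1) \<psi>]
          locally_integrable_mult_test_function[OF h(2) \<psi>, of n]
        by (simp add: left_diff_distrib D_def)
      then show ?thesis
        using lborel_measurable_imp_lebesgue[OF test_function_measurable[OF \<psi>]]
         Cauchy_Schwarz_integral(2)[of "\<lambda>x. hn n x - h x" lebesgue "\<lambda>x. of_real (\<psi> x)"]
          locally_integrable_imp_measurable[OF h(1)] locally_integrable_imp_measurable[OF h(2)]
          h(3) test_function_integrable_square[OF \<psi>]
        by simp
    qed
    then have "\<forall>\<^sub>F n in sequentially. norm ((norm (D n))^2) \<le> sq_int lebesgue (\<lambda>x. hn n x - h x) * ?P"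
      by simp
    moreover have "(\<lambda>n. sq_int lebesgue (\<lambda>x. hn n x - h x) * ?P) \<longlonglongrightarrow> 0"
      using tendsto_mult_right[OF h(4), of ?P] by simp
    ultimately have "(\<lambda>n. (norm (D n))^2) \<longlonglongrightarrow> 0"
      by (rule Lim_null_comparison)
    then have "(\<lambda>n. norm (D n)) \<longlonglongrightarrow> 0"
      by simp
    then show ?thesis unfolding D_def by (simp only: tendsto_norm_zero_iff LIM_zero_iff)
  qed
  fix \<psi> :: "real^'n \<Rightarrow> real" assume \<psi>: "\<psi> \<in> test_functions"
  have "(\<lambda>n. \<integral>x. fn n x * of_real (partial_deriv i \<psi> x) \<partial>lebesgue) \<longlonglongrightarrow> (\<integral>x. f x * of_real (partial_deriv i \<psi> x) \<partial>lebesgue)"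
    using has_weak_partialD(1)[OF wp] by (intro lim partial_deriv_test_function \<psi> l fn) auto
  moreover have "(\<lambda>n. - (\<integral>x. gn n x * of_real (\<psi> x) \<partial>lebesgue)) \<longlonglongrightarrow> - (\<integral>x. g x * of_real (\<psi> x) \<partial>lebesgue)"
    using has_weak_partialD(2)[OF wp] by (intro tendsto_minus lim \<psi> l gn) auto
  ultimately show "(\<integral>x. f x * of_real (partial_deriv i \<psi> x) \<partial>lebesgue)
          = - (\<integral>x. g x * of_real (\<psi> x) \<partial>lebesgue)"
    unfolding has_weak_partialD(3)[OF wp \<psi>] by (rule LIMSEQ_unique)
qed

subsection \<open>Translations and averages over grid cells\<close>

lemma borel_measurable_vec_nth [measurable]: "(\<lambda>x::real^'n::finite. x $ i) \<in> borel_measurable borel"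
  by (intro borel_measurable_continuous_onI continuous_intros)

lemma nn_integral_lborel_translation:
  fixes F :: "'a::euclidean_space \<Rightarrow> ennreal"
  assumes [measurable]: "F \<in> borel_measurable borel"
  shows "(\<integral>\<^sup>+x. F (x + c) \<partial>lborel) = (\<integral>\<^sup>+x. F x \<partial>lborel)"
proof -
  have "(\<integral>\<^sup>+x. F x \<partial>lborel) = (\<integral>\<^sup>+x. F x \<partial>distr lborel borel ((+) c))"
    by (simp add: lborel_distr_plus)
  also have "\<dots> = (\<integral>\<^sup>+x. F (x + c) \<partial>lborel)"
    by (subst nn_integral_distr) (auto simp: add.commute)
  finally show ?thesis by simp
qed

lemma integral_lborel_translation:
  fixes F :: "'a::euclidean_space \<Rightarrow> 'b::{banach, second_countable_topology}"
  assumes [measurable]: "F \<in> borel_measurable borel"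
  shows "(\<integral>x. F (x + c) \<partial>lborel) = (\<integral>x. F x \<partial>lborel)"
proof -
  have "(\<integral>x. F x \<partial>lborel) = (\<integral>x. F x \<partial>distr lborel borel ((+) c))"
    by (simp add: lborel_distr_plus)
  also have "\<dots> = (\<integral>x. F (x + c) \<partial>lborel)"
    by (subst integral_distr) (auto simp: add.commute)
  finally show ?thesis by simp
qed

text \<open>Integrability is not assumed: the integral of a function that is not integrable is
  \<open>0\<close> by convention, and the bound is then trivial.\<close>

lemma ennreal_norm_integral_le:
  fixes F :: "'a \<Rightarrow> 'b::{banach, second_countable_topology}"
  shows "ennreal (norm (\<integral>x. F x \<partial>M)) \<le> (\<integral>\<^sup>+x. ennreal (norm (F x)) \<partial>M)"
proof (cases "integrable M F")
  case True
  then show ?thesis by (rule integral_norm_bound_ennreal)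
next
  case False
  then show ?thesis by (simp add: not_integrable_integral_eq)
qed

lemma ennreal_norm_integral_square_le:
  fixes F :: "'a \<Rightarrow> 'b::{banach, second_countable_topology}"
  assumes [measurable]: "F \<in> borel_measurable M" "A \<in> sets M"
  shows "ennreal ((norm (\<integral>x. indicator A x *\<^sub>R F x \<partial>M))^2)
    \<le> emeasure M A * (\<integral>\<^sup>+x. indicator A x * ennreal ((norm (F x))^2) \<partial>M)"
proof -
  have "ennreal (norm (\<integral>x. indicator A x *\<^sub>R F x \<partial>M))
      \<le> (\<integral>\<^sup>+x. indicator A x * (indicator A x * ennreal (norm (F x))) \<partial>M)"
    by (rule order_trans[OF ennreal_norm_integral_le]) (auto intro!: nn_integral_mono simp: indicator_def)
  then have "(ennreal (norm (\<integral>x. indicator A x *\<^sub>R F x \<partial>M)))^2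
      \<le> (\<integral>\<^sup>+x. indicator A x * (indicator A x * ennreal (norm (F x))) \<partial>M)^2"
    by (intro power_mono) auto
  also have "\<dots> \<le> (\<integral>\<^sup>+x. (indicator A x)^2 \<partial>M) * (\<integral>\<^sup>+x. (indicator A x * ennreal (norm (F x)))^2 \<partial>M)"
    by (rule Cauchy_Schwarz_nn_integral) auto
  also have "(\<integral>\<^sup>+x. (indicator A x)^2 \<partial>M) = (\<integral>\<^sup>+x. indicator A x \<partial>M)"
    by (intro nn_integral_cong) (auto simp: indicator_def)
  also have "(\<integral>\<^sup>+x. (indicator A x * ennreal (norm (F x)))^2 \<partial>M)
     = (\<integral>\<^sup>+x. indicator A x * ennreal ((norm (F x))^2) \<partial>M)"
    by (intro nn_integral_cong) (auto simp: indicator_def ennreal_power)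
  finally show ?thesis by (simp add: ennreal_power)
qed

text \<open>\<open>\<theta>\<close> is the convolution of \<open>\<eta>\<close> with the indicator
  of \<open>{0..h}\<close>. Its derivative is a difference of translates of \<open>\<eta>\<close>,
  so a difference of translates of a product test function becomes a partial derivative of another
  one.\<close>

lemma smooth1_translation_average:
  assumes \<eta>: "smooth1 \<eta>" and "h > 0"
  defines "\<theta> \<equiv> \<lambda>t. integral {0..h} (\<lambda>s. \<eta> (t - s))"
  shows "smooth1 \<theta>" "deriv \<theta> = (\<lambda>t. \<eta> t - \<eta> (t - h))"
    "\<theta> t = (\<integral>s. indicator {0..h} s * \<eta> (t - s) \<partial>lborel)"
proof -
  have cont: "continuous_on A (\<lambda>s. \<eta> (t - s))" for A t
    by (rule continuous_on_compose2[OF smooth1_continuous[OF \<eta>, of UNIV]]) (auto intro!: continuous_intros)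
  have D: "(\<theta> has_real_derivative (\<eta> t - \<eta> (t - h))) (at t)" for t
  proof -
    have "((\<lambda>t. integral (cbox 0 h) (\<lambda>s. \<eta> (t - s))) has_field_derivative
       integral (cbox 0 h) (\<lambda>s. deriv \<eta> (t - s))) (at t within UNIV)"
    proof (rule leibniz_rule_field_derivative)
      show "((\<lambda>x. \<eta> (x - s)) has_field_derivative deriv \<eta> (x - s)) (at x within UNIV)" for x s
        using smooth1_DERIV[OF \<eta>, of "x - s"] DERIV_shift[of \<eta> "deriv \<eta> (x - s)" x "- s"]
        by simp
      show "(\<lambda>s. \<eta> (x - s)) integrable_on cbox 0 h" for x
        by (rule integrable_continuous) (rule cont)
      show "continuous_on (UNIV \<times> cbox 0 h) (\<lambda>(x, t). deriv \<eta> (x - t))"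
        unfolding case_prod_unfold
        by (rule continuous_on_compose2[OF smooth1_continuous[OF smooth1_deriv[OF \<eta>], of UNIV]])
          (auto intro!: continuous_intros)
    qed auto
    moreover have "((\<lambda>s. deriv \<eta> (t - s)) has_integral ((- \<eta> (t - h)) - (- \<eta> (t - 0)))) {0..h}"
    proof (rule fundamental_theorem_of_calculus)
      show "0 \<le> h" using \<open>h > 0\<close> by simp
      fix s
      have "((\<lambda>s. t - s) has_real_derivative - 1) (at s)"
        by (auto intro!: derivative_eq_intros)
      from DERIV_chain2[OF smooth1_DERIV[OF \<eta>, of "t - s"] this]
      have "((\<lambda>s. - \<eta> (t - s)) has_real_derivative deriv \<eta> (t - s)) (at s)"
        by (auto intro!: derivative_eq_intros)
      then show "((\<lambda>s. - \<eta> (t - s)) has_vector_derivative deriv \<eta> (t - s)) (at s within {0..h})"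
        by (simp add: has_real_derivative_iff_has_vector_derivative[symmetric]
            has_field_derivative_at_within)
    qed
    ultimately show ?thesis by (simp add: \<theta>_def integral_unique)
  qed
  then show "deriv \<theta> = (\<lambda>t. \<eta> t - \<eta> (t - h))"
    by (auto simp: DERIV_imp_deriv)
  have "smooth1 (\<lambda>t. \<eta> t + (- 1) * \<eta> (1 * t + - h))"
    by (intro smooth1_add smooth1_mult smooth1_const smooth1_affine \<eta>)
  then have "smooth1 (\<lambda>t. \<eta> t - \<eta> (t - h))" by simp
  with D show "smooth1 \<theta>" by (rule smooth1_I)
  have "set_integrable lborel {0..h} (\<lambda>s. \<eta> (t - s))"
    by (rule borel_integrable_compact[OF compact_Icc cont, unfolded set_integrable_def[symmetric]])
  then show "\<theta> t = (\<integral>s. indicator {0..h} s * \<eta> (t - s) \<partial>lborel)"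
    using set_borel_integral_eq_integral(2)[of "{0..h}" "\<lambda>s. \<eta> (t - s)"]
    by (simp add: \<theta>_def set_lebesgue_integral_def)
qed

text \<open>Fubini and translation invariance are applied to \<open>lborel\<close> and its products,
  hence to Borel functions; passing there from Lebesgue measurable functions costs a null
  set.\<close>

lemma complex_borel_representative:
  fixes f :: "'a::euclidean_space \<Rightarrow> complex"
  assumes "f \<in> borel_measurable lebesgue"
  obtains f' where "f' \<in> borel_measurable borel" "AE x in lebesgue. f x = f' x"
proof -
  have "(\<lambda>x. Re (f x)) \<in> borel_measurable lebesgue" "(\<lambda>x. Im (f x)) \<in> borel_measurable lebesgue"
    using assms by measurable
  then obtain a b where ab [measurable]: "a \<in> borel_measurable lborel" "b \<in> borel_measurable lborel"
    and "AE x in lborel. Re (f x) = a x" "AE x in lborel. Im (f x) = b x"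
    using completion_ex_borel_measurable_real by metis
  then have "AE x in lebesgue. Re (f x) = a x" "AE x in lebesgue. Im (f x) = b x"
    by (auto intro: AE_completion)
  then have "AE x in lebesgue. f x = Complex (a x) (b x)"
    by eventually_elim (auto simp: complex_eq_iff)
  moreover have "(\<lambda>x. Complex (a x) (b x)) \<in> borel_measurable borel"
  proof -
    have "(\<lambda>x. of_real (a x) + \<i> * of_real (b x)) \<in> borel_measurable borel"
      using ab by measurable
    then show ?thesis by (simp add: Complex_eq)
  qed
  ultimately show ?thesis using that by blast
qed

text \<open>The licence for Fubini in the translation formula:
  \<open>|A B| \<le> |A|^2 + |B|^2\<close>, the square integrals of the slices are bounded uniformly
  in \<open>s\<close>, and \<open>s\<close> ranges over an interval of length
  \<open>h\<close>.\<close>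

lemma integrable_slices:
  fixes A B :: "real \<Rightarrow> 'a::euclidean_space \<Rightarrow> complex"
  assumes [measurable]: "(\<lambda>(s, x). A s x) \<in> borel_measurable (borel \<Otimes>\<^sub>M borel)"
      "(\<lambda>(s, x). B s x) \<in> borel_measurable (borel \<Otimes>\<^sub>M borel)"
    and le: "\<And>s. (nn_L2 lborel (A s)) \<le> CA" "\<And>s. (nn_L2 lborel (B s)) \<le> CB"
    and C: "CA < \<infinity>" "CB < \<infinity>" and h: "h \<ge> 0"
  shows "integrable (lborel \<Otimes>\<^sub>M lborel) (\<lambda>(s, x). indicator {0..h} s *\<^sub>R (A s x * B s x))"
proof (rule integrableI_bounded)
  have "(\<integral>\<^sup>+z. norm (case z of (s, x) \<Rightarrow> indicator {0..h} s *\<^sub>R (A s x * B s x)) \<partial>(lborel \<Otimes>\<^sub>M lborel))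
    = (\<integral>\<^sup>+s. (\<integral>\<^sup>+x. norm (indicator {0..h} s *\<^sub>R (A s x * B s x)) \<partial>lborel) \<partial>lborel)"
    by (subst lborel.nn_integral_fst[symmetric]) (auto simp: case_prod_unfold)
  also have "\<dots> \<le> (\<integral>\<^sup>+s. (CA + CB) * indicator {0..h} s \<partial>lborel)"
  proof (rule nn_integral_mono)
    fix s :: real
    have "(\<integral>\<^sup>+x. norm (indicator {0..h} s *\<^sub>R (A s x * B s x)) \<partial>lborel)
      \<le> (\<integral>\<^sup>+x. indicator {0..h} s * (ennreal ((norm (A s x))^2) + ennreal ((norm (B s x))^2)) \<partial>lborel)"
    proof (rule nn_integral_mono)
      fix x
      have "0 \<le> norm (A s x) * norm (B s x)" by simp
      then have "norm (A s x) * norm (B s x) \<le> (norm (A s x))^2 + (norm (B s x))^2"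
        using sum_squares_bound[of "norm (A s x)" "norm (B s x)"] by linarith
      then show "ennreal (norm (indicator {0..h} s *\<^sub>R (A s x * B s x)))
        \<le> indicator {0..h} s * (ennreal ((norm (A s x))^2) + ennreal ((norm (B s x))^2))"
        by (auto simp: norm_mult indicator_def ennreal_plus[symmetric] simp del: ennreal_plus intro!: ennreal_leI)
    qed
    also have "\<dots> = indicator {0..h} s * ((nn_L2 lborel (A s)) + nn_L2 lborel (B s))"
      by (subst nn_integral_cmult) (auto simp: nn_integral_add)
    also have "\<dots> \<le> indicator {0..h} s * (CA + CB)"
      by (intro mult_left_mono add_mono le) auto
    finally show "(\<integral>\<^sup>+x. norm (indicator {0..h} s *\<^sub>R (A s x * B s x)) \<partial>lborel) \<le> (CA + CB) * indicator {0..h} s"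
      by (simp add: mult.commute)
  qed
  also have "\<dots> = (CA + CB) * ennreal h"
    using h by (subst nn_integral_cmult_indicator) auto
  also have "\<dots> < \<infinity>" using C by (simp add: ennreal_mult_less_top)
  finally show "(\<integral>\<^sup>+z. norm (case z of (s, x) \<Rightarrow> indicator {0..h} s *\<^sub>R (A s x * B s x)) \<partial>(lborel \<Otimes>\<^sub>M lborel)) < \<infinity>" .
qed measurable

text \<open>The fundamental theorem of calculus along one axis. Tested with a product
  \<open>X\<close>, the left side becomes the integral of \<open>f\<close> times
  \<open>X (x - h *\<^sub>R ?e) - X x\<close>, which is minus the partial derivative of
  \<open>P\<close>, the integral of \<open>X (x - s *\<^sub>R ?e)\<close> over \<open>s\<close> in
  \<open>{0..h}\<close>. The definition of the weak derivative moves the derivative onto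
  \<open>f\<close>, and Fubini turns the integral of \<open>g P\<close> into that of
  \<open>G X\<close>. The bound on \<open>G\<close> is Cauchy-Schwarz on the segment followed by
  translation invariance.\<close>

lemma translation_formula:
  fixes f g :: "real^'n::finite \<Rightarrow> complex"
  assumes fm [measurable]: "f \<in> borel_measurable borel" and f2: "integrable lborel (\<lambda>x. (norm (f x))^2)"
    and gm [measurable]: "g \<in> borel_measurable borel" and g2: "integrable lborel (\<lambda>x. (norm (g x))^2)"
    and wp: "has_weak_partial i f g" and h: "h > 0"
  defines "G \<equiv> \<lambda>x. \<integral>s. indicator {0..h} s *\<^sub>R g (x + s *\<^sub>R axis i 1) \<partial>lborel"
  shows "nn_L2 lborel G \<le> ennreal (h^2) * nn_L2 lborel g"
    and "AE x in lborel. f (x + h *\<^sub>R axis i 1) - f x = G x"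
proof -
  let ?e = "axis i 1 :: real^'n"
  let ?g2 = "nn_L2 lborel g"
  have g2': "?g2 < \<infinity>" using g2 by (simp add: integrable_iff_bounded)
  have Gm [measurable]: "G \<in> borel_measurable borel" unfolding G_def by measurable
  have "nn_L2 lborel G
     \<le> (\<integral>\<^sup>+x. ennreal h * (\<integral>\<^sup>+s. indicator {0..h} s * ennreal ((norm (g (x + s *\<^sub>R ?e)))^2) \<partial>lborel) \<partial>lborel)"
    unfolding G_def
    using h ennreal_norm_integral_square_le[of "\<lambda>s. g (_ + s *\<^sub>R ?e)" lborel "{0..h}"]
    by (intro nn_integral_mono) simp
  also have "\<dots> = ennreal h * (\<integral>\<^sup>+x. (\<integral>\<^sup>+s. indicator {0..h} s * ennreal ((norm (g (x + s *\<^sub>R ?e)))^2) \<partial>lborel) \<partial>lborel)"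
    by (rule nn_integral_cmult) measurable
  also have "(\<integral>\<^sup>+x. (\<integral>\<^sup>+s. indicator {0..h} s * ennreal ((norm (g (x + s *\<^sub>R ?e)))^2) \<partial>lborel) \<partial>lborel)
     = (\<integral>\<^sup>+s. (\<integral>\<^sup>+x. indicator {0..h} s * ennreal ((norm (g (x + s *\<^sub>R ?e)))^2) \<partial>lborel) \<partial>lborel)"
    by (rule lborel_pair.Fubini') measurable
  also have "\<dots> = (\<integral>\<^sup>+s. ?g2 * indicator {0..h} s \<partial>lborel)"
    by (subst nn_integral_cmult)
      (auto intro!: nn_integral_cong simp: nn_integral_lborel_translation[where F="\<lambda>x. ennreal ((norm (g x))^2)"] mult.commute)
  also have "\<dots> = ?g2 * ennreal h"
    using h by (subst nn_integral_cmult_indicator) auto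
  also have "ennreal h * (?g2 * ennreal h) = ennreal (h^2) * ?g2"
    using h by (simp add: power2_eq_square ennreal_mult mult_ac)
  finally show G2: "nn_L2 lborel G \<le> ennreal (h^2) * ?g2" .
  have G2': "integrable lborel (\<lambda>x. (norm (G x))^2)"
    using le_less_trans[OF G2] g2' by (simp add: integrable_iff_bounded ennreal_mult_less_top)
  have fh2: "integrable lborel (\<lambda>x. (norm (f (x + h *\<^sub>R ?e)))^2)"
    using f2 nn_integral_lborel_translation[where F="\<lambda>x. ennreal ((norm (f x))^2)"]
    by (simp add: integrable_iff_bounded)
  have li: "locally_integrable F" if [measurable]: "F \<in> borel_measurable borel"
     and "integrable lborel (\<lambda>x. (norm (F x))^2)" for F :: "real^'n \<Rightarrow> complex"
    using that by (intro square_integrable_imp_locally_integrable lborel_measurable_imp_lebesgue)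
      (simp_all add: integrable_completion)
  note lif = li[OF _ f2] li[OF _ fh2] li[OF _ G2'] li[OF _ g2]
  have "AE x in lebesgue. f (x + h *\<^sub>R ?e) - f x - G x = 0"
  proof (rule fundamental_lemma)
    show "locally_integrable (\<lambda>x. f (x + h *\<^sub>R ?e) - f x - G x)"
      using lif by (auto simp: locally_integrable_def intro!: set_integral_diff)
    fix \<eta> :: "'n \<Rightarrow> real \<Rightarrow> real" and a b
    assume \<eta>: "\<And>i. smooth1 (\<eta> i)" "\<And>i t. t \<notin> {a i..b i} \<Longrightarrow> \<eta> i t = 0"
    define X where "X = (\<lambda>x::real^'n. \<Prod>j\<in>UNIV. \<eta> j (x $ j))"
    define \<theta> where "\<theta> = (\<lambda>t. integral {0..h} (\<lambda>s. \<eta> i (t - s)))"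
    define P where "P = (\<lambda>x::real^'n. \<Prod>j\<in>UNIV. (\<eta>(i := \<theta>)) j (x $ j))"
    note \<theta> = smooth1_translation_average[OF \<eta>(1)[of i] h, folded \<theta>_def]
    have X: "X \<in> test_functions" unfolding X_def by (rule test_functions_prod[OF \<eta>])
    have Xm [measurable]: "X \<in> borel_measurable borel" by (rule test_function_measurable[OF X])
    have \<theta>0: "\<theta> t = 0" if "t \<notin> {a i..b i + h}" for t
    proof -
      have "integral {0..h} (\<lambda>s. \<eta> i (t - s)) = integral {0..h} (\<lambda>s. 0)"
        using that by (intro integral_cong \<eta>(2)) auto
      then show ?thesis by (simp add: \<theta>_def)
    qed
    have P: "P \<in> test_functions" unfolding P_def
      by (rule test_functions_prod[where a=a and b="b(i := b i + h)"]) (use \<eta> \<theta> \<theta>0 in auto)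
    have prod_split: "(\<Prod>j\<in>UNIV. (\<eta>(i := \<rho>)) j (x $ j)) = (\<Prod>j\<in>UNIV - {i}. \<eta> j (x $ j)) * \<rho> (x $ i)"
      for \<rho> and x :: "real^'n"
      by (subst prod.remove[of UNIV i]) (auto simp: mult.commute)
    have X_shift: "X (x - s *\<^sub>R ?e) = (\<Prod>j\<in>UNIV - {i}. \<eta> j (x $ j)) * \<eta> i (x $ i - s)" for x s
    proof -
      have "X (x - s *\<^sub>R ?e) = (\<Prod>j\<in>UNIV - {i}. \<eta> j ((x - s *\<^sub>R ?e) $ j)) * \<eta> i ((x - s *\<^sub>R ?e) $ i)"
        unfolding X_def by (subst prod.remove[of UNIV i]) (auto simp: mult.commute)
      also have "(\<Prod>j\<in>UNIV - {i}. \<eta> j ((x - s *\<^sub>R ?e) $ j)) = (\<Prod>j\<in>UNIV - {i}. \<eta> j (x $ j))"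
        by (intro prod.cong) (auto simp: axis_def)
      finally show ?thesis by (simp add: axis_def)
    qed
    have dP: "partial_deriv i P x = X x - X (x - h *\<^sub>R ?e)" for x
    proof -
      have "partial_deriv i P = (\<lambda>x. \<Prod>j\<in>UNIV. ((\<eta>(i := \<theta>))(i := deriv ((\<eta>(i := \<theta>)) i))) j (x $ j))"
        unfolding P_def by (rule partial_deriv_prod(2)) (use \<eta> \<theta> in auto)
      also have "(\<eta>(i := \<theta>))(i := deriv ((\<eta>(i := \<theta>)) i)) = \<eta>(i := \<lambda>t. \<eta> i t - \<eta> i (t - h))"
        by (simp add: \<theta>(2))
      finally have "partial_deriv i P x = (\<Prod>j\<in>UNIV - {i}. \<eta> j (x $ j)) * (\<eta> i (x $ i) - \<eta> i (x $ i - h))"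
        unfolding prod_split by simp
      moreover have "X x = X (x - 0 *\<^sub>R ?e)" by simp
      ultimately show ?thesis by (simp only: X_shift) (simp add: algebra_simps)
    qed
    have P_eq: "P x = (\<integral>s. indicator {0..h} s * X (x - s *\<^sub>R ?e) \<partial>lborel)" for x
    proof -
      let ?c = "\<Prod>j\<in>UNIV - {i}. \<eta> j (x $ j)"
      have "P x = ?c * (\<integral>s. indicator {0..h} s * \<eta> i (x $ i - s) \<partial>lborel)"
        unfolding P_def prod_split by (simp only: \<theta>_def \<theta>(3))
      also have "\<dots> = (\<integral>s. ?c * (indicator {0..h} s * \<eta> i (x $ i - s)) \<partial>lborel)"
        by (rule integral_mult_right_zero[symmetric])
      finally show ?thesis by (simp add: X_shift mult_ac)
    qed
    have X2: "nn_L2 lborel (\<lambda>x. complex_of_real (X x)) < \<infinity>"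
      using test_function_integrable_square[OF X] by (simp add: integrable_iff_bounded nn_integral_completion)
    have i1: "integrable (lborel \<Otimes>\<^sub>M lborel) (\<lambda>(s,x). indicator {0..h} s *\<^sub>R (g (x + s *\<^sub>R ?e) * of_real (X x)))"
      using nn_integral_lborel_translation[where F="\<lambda>x. ennreal ((norm (g x))^2)"] X2 g2' h
      by (intro integrable_slices[where CA="?g2" and CB="nn_L2 lborel (\<lambda>x. complex_of_real (X x))"]) auto
    have i2: "integrable (lborel \<Otimes>\<^sub>M lborel) (\<lambda>(s,x). indicator {0..h} s *\<^sub>R (g x * of_real (X (x - s *\<^sub>R ?e))))"
      using nn_integral_lborel_translation[where F="\<lambda>x. ennreal ((norm (complex_of_real (X x)))^2)" and c="- (_ *\<^sub>R ?e)"] X2 g2' h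
      by (intro integrable_slices[where CA="?g2" and CB="nn_L2 lborel (\<lambda>x. complex_of_real (X x))"]) auto
    have GX: "(\<integral>x. G x * of_real (X x) \<partial>lborel) = (\<integral>x. g x * of_real (P x) \<partial>lborel)"
    proof -
      have "(\<integral>x. G x * of_real (X x) \<partial>lborel)
        = (\<integral>x. (\<integral>s. indicator {0..h} s *\<^sub>R (g (x + s *\<^sub>R ?e) * of_real (X x)) \<partial>lborel) \<partial>lborel)"
        unfolding G_def by (subst integral_mult_left_zero[symmetric]) simp
      also have "\<dots> = (\<integral>s. (\<integral>x. indicator {0..h} s *\<^sub>R (g (x + s *\<^sub>R ?e) * of_real (X x)) \<partial>lborel) \<partial>lborel)"
        by (rule lborel_pair.Fubini_integral[OF i1])
      also have "\<dots> = (\<integral>s. (\<integral>x. indicator {0..h} s *\<^sub>R (g x * of_real (X (x - s *\<^sub>R ?e))) \<partial>lborel) \<partial>lborel)"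
      proof (rule Bochner_Integration.integral_cong[OF refl])
        fix s :: real
        show "(\<integral>x. indicator {0..h} s *\<^sub>R (g (x + s *\<^sub>R ?e) * of_real (X x)) \<partial>lborel)
          = (\<integral>x. indicator {0..h} s *\<^sub>R (g x * of_real (X (x - s *\<^sub>R ?e))) \<partial>lborel)"
          using integral_lborel_translation[where c="s *\<^sub>R ?e" and
              F="\<lambda>x. indicator {0..h} s *\<^sub>R (g x * of_real (X (x - s *\<^sub>R ?e)))"] by simp
      qed
      also have "\<dots> = (\<integral>x. (\<integral>s. indicator {0..h} s *\<^sub>R (g x * of_real (X (x - s *\<^sub>R ?e))) \<partial>lborel) \<partial>lborel)"
        by (rule lborel_pair.Fubini_integral[OF i2, symmetric])
      also have "\<dots> = (\<integral>x. g x * of_real (P x) \<partial>lborel)"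
      proof (rule Bochner_Integration.integral_cong[OF refl])
        fix x :: "real^'n"
        have "(\<integral>s. indicator {0..h} s *\<^sub>R (g x * of_real (X (x - s *\<^sub>R ?e))) \<partial>lborel)
           = (\<integral>s. g x * complex_of_real (indicator {0..h} s * X (x - s *\<^sub>R ?e)) \<partial>lborel)"
          by (intro Bochner_Integration.integral_cong) (auto simp: scaleR_conv_of_real)
        also have "\<dots> = g x * of_real (P x)" unfolding P_eq
          by (simp only: integral_mult_right_zero integral_complex_of_real)
        finally show "(\<integral>s. indicator {0..h} s *\<^sub>R (g x * of_real (X (x - s *\<^sub>R ?e))) \<partial>lborel) = g x * of_real (P x)" .
      qed
      finally show ?thesis .
    qed
    have iX: "integrable lborel (\<lambda>x. F x * of_real (\<psi> x))" if [measurable]: "F \<in> borel_measurable borel"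
      and "locally_integrable F" and \<psi>: "\<psi> \<in> test_functions" for F \<psi>
    proof -
      have [measurable]: "\<psi> \<in> borel_measurable borel" by (rule test_function_measurable[OF \<psi>])
      have "integrable lebesgue (\<lambda>x. F x * of_real (\<psi> x))"
        by (rule locally_integrable_mult_test_function[OF that(2) \<psi>])
      then show ?thesis by (subst (asm) integrable_completion) measurable
    qed
    have [measurable]: "P \<in> borel_measurable borel" "partial_deriv i P \<in> borel_measurable borel"
      by (rule test_function_measurable[OF P] test_function_measurable[OF partial_deriv_test_function[OF P]])+
    \<comment> \<open>By \<open>dP\<close> the translate of \<open>X\<close> is \<open>X\<close>
      minus a partial derivative of \<open>P\<close>, and \<open>f\<close> times a test function is
      known to be integrable.\<close>
    have ifX: "integrable lborel (\<lambda>x. f x * of_real (X (x - h *\<^sub>R ?e)))"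
    proof -
      have "integrable lborel (\<lambda>x. f x * of_real (X x) - f x * of_real (partial_deriv i P x))"
        by (intro Bochner_Integration.integrable_diff iX lif X partial_deriv_test_function P) measurable
      then show ?thesis by (simp add: dP algebra_simps)
    qed
    have "(\<integral>x. (f (x + h *\<^sub>R ?e) - f x - G x) * of_real (X x) \<partial>lborel)
       = (\<integral>x. f (x + h *\<^sub>R ?e) * of_real (X x) \<partial>lborel) - (\<integral>x. f x * of_real (X x) \<partial>lborel)
         - (\<integral>x. G x * of_real (X x) \<partial>lborel)"
      using iX[OF _ _ X] lif by (simp add: left_diff_distrib)
    also have "(\<integral>x. f (x + h *\<^sub>R ?e) * of_real (X x) \<partial>lborel) = (\<integral>x. f x * of_real (X (x - h *\<^sub>R ?e)) \<partial>lborel)"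
      using integral_lborel_translation[where c="h *\<^sub>R ?e" and
              F="\<lambda>x. f x * of_real (X (x - h *\<^sub>R ?e))"] by simp
    also have "(\<integral>x. f x * of_real (X (x - h *\<^sub>R ?e)) \<partial>lborel) - (\<integral>x. f x * of_real (X x) \<partial>lborel)
       = - (\<integral>x. f x * of_real (partial_deriv i P x) \<partial>lborel)"
      using ifX iX[OF _ _ X] lif by (simp add: dP right_diff_distrib)
    also have "(\<integral>x. f x * of_real (partial_deriv i P x) \<partial>lborel) = - (\<integral>x. g x * of_real (P x) \<partial>lborel)"
      using has_weak_partialD(3)[OF wp P] by (simp add: integral_completion)
    finally have "(\<integral>x. (f (x + h *\<^sub>R ?e) - f x - G x) * of_real (X x) \<partial>lborel) = 0"
      by (simp add: GX)
    moreover have "(\<lambda>x. (f (x + h *\<^sub>R ?e) - f x - G x) * complex_of_real (X x)) \<in> borel_measurable lborel"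
      by measurable
    ultimately have "(\<integral>x. (f (x + h *\<^sub>R ?e) - f x - G x) * of_real (X x) \<partial>lebesgue) = 0"
      by (simp only: integral_completion)
    then show "(\<integral>x. (f (x + h *\<^sub>R ?e) - f x - G x) * of_real (\<Prod>i\<in>UNIV. \<eta> i (x $ i)) \<partial>lebesgue) = 0"
      by (simp only: X_def)
  qed
  then show "AE x in lborel. f (x + h *\<^sub>R axis i 1) - f x = G x"
    by (simp add: AE_completion_iff)
qed

lemma translation_estimate_axis:
  fixes f g :: "real^'n::finite \<Rightarrow> complex"
  assumes fm [measurable]: "f \<in> borel_measurable borel" and f2: "integrable lborel (\<lambda>x. (norm (f x))^2)"
    and gm: "g \<in> borel_measurable borel" and g2: "integrable lborel (\<lambda>x. (norm (g x))^2)"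
    and wp: "has_weak_partial i f g"
  shows "nn_L2 lborel (\<lambda>x. f (x + h *\<^sub>R axis i 1) - f x)
     \<le> ennreal (h^2) * nn_L2 lborel g"
proof -
  have pos: "nn_L2 lborel (\<lambda>x. f (x + h *\<^sub>R axis i 1) - f x)
     \<le> ennreal (h^2) * nn_L2 lborel g" if h: "h > 0" for h
  proof -
    note tf = translation_formula[OF fm f2 gm g2 wp h]
    have "nn_L2 lborel (\<lambda>x. f (x + h *\<^sub>R axis i 1) - f x)
      = nn_L2 lborel (\<lambda>x. \<integral>s. indicator {0..h} s *\<^sub>R g (x + s *\<^sub>R axis i 1) \<partial>lborel)"
      by (rule nn_integral_cong_AE) (use tf(2) in auto)
    then show ?thesis using tf(1) by simp
  qed
  consider "h > 0" | "h = 0" | "h < 0" by linarith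
  then show ?thesis
  proof cases
    case 3
    \<comment> \<open>Translating the integrand by \<open>h\<close> along the axis reverses the
      direction of the step and leaves the integral unchanged.\<close>
    have "nn_L2 lborel (\<lambda>x. f (x + h *\<^sub>R axis i 1) - f x)
      = nn_L2 lborel (\<lambda>x. f (x + (- h) *\<^sub>R axis i 1) - f x)"
      using nn_integral_lborel_translation[where F="\<lambda>x. ennreal ((norm (f (x + (- h) *\<^sub>R axis i 1) - f x))^2)"
          and c="h *\<^sub>R axis i 1"]
      by (simp add: norm_minus_commute)
    then show ?thesis using pos[of "- h"] 3 by simp
  qed (use pos in auto)
qed

lemma translation_estimate:
  fixes f :: "real^'n::finite \<Rightarrow> complex"
  assumes fm [measurable]: "f \<in> borel_measurable borel" and f2: "integrable lborel (\<lambda>x. (norm (f x))^2)"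
    and gm: "\<And>i. g i \<in> borel_measurable borel" and g2: "\<And>i. integrable lborel (\<lambda>x. (norm (g i x))^2)"
    and wp: "\<And>i. has_weak_partial i f (g i)" and v: "\<And>i. \<bar>v $ i\<bar> \<le> r"
  shows "nn_L2 lborel (\<lambda>x. f (x + v) - f x)
     \<le> ennreal (2 ^ CARD('n) * r^2 * (\<Sum>i\<in>UNIV. sq_int lborel (g i)))"
proof -
  define \<gamma> where "\<gamma> i = sq_int lborel (g i)" for i
  have \<gamma>0: "\<gamma> i \<ge> 0" for i by (simp add: \<gamma>_def)
  have \<gamma>: "nn_L2 lborel (g i) = ennreal (\<gamma> i)" for i
    unfolding \<gamma>_def by (rule nn_integral_eq_integral[OF g2]) simp
  \<comment> \<open>Induction on the set of coordinates in which \<open>v\<close> may be nonzero.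
    Each coordinate adds one step along an axis, and splitting it off with
    \<open>norm_add_square_le\<close> costs a factor \<open>2\<close>; this is the origin of the
    power of two.\<close>
  have "finite S \<Longrightarrow> (\<And>i. i \<notin> S \<Longrightarrow> v $ i = 0) \<Longrightarrow> (\<And>i. \<bar>v $ i\<bar> \<le> r) \<Longrightarrow>
    (nn_L2 lborel (\<lambda>x. f (x + v) - f x)) \<le> ennreal (2 ^ card S * r^2 * (\<Sum>i\<in>S. \<gamma> i))" for S v
  proof (induction S arbitrary: v rule: finite_induct)
    case empty
    then have "v = 0" by (simp add: vec_eq_iff)
    then show ?case by simp
  next
    case (insert j S)
    define w where "w = (\<chi> i. if i = j then 0 else v $ i)"
    have vw: "v = w + (v $ j) *\<^sub>R axis j 1"
      by (auto simp: w_def vec_eq_iff axis_def)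
    have r: "r \<ge> 0" using insert.prems(2)[of j] by linarith
    have IH: "nn_L2 lborel (\<lambda>x. f (x + w) - f x) \<le> ennreal (2 ^ card S * r^2 * (\<Sum>i\<in>S. \<gamma> i))"
      using insert.prems r by (intro insert.IH) (auto simp: w_def)
    have sq: "(v $ j)^2 \<le> r^2"
      using insert.prems(2)[of j] r by (metis power2_abs power_mono abs_ge_zero)
    have "nn_L2 lborel (\<lambda>x. f (x + w + (v $ j) *\<^sub>R axis j 1) - f (x + w))
       = nn_L2 lborel (\<lambda>x. f (x + (v $ j) *\<^sub>R axis j 1) - f x)"
      using nn_integral_lborel_translation[where c=w and
          F="\<lambda>x. ennreal ((norm (f (x + (v $ j) *\<^sub>R axis j 1) - f x))^2)"] by simp
    also have "\<dots> \<le> ennreal ((v $ j)^2) * ennreal (\<gamma> j)"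
      using translation_estimate_axis[OF fm f2 gm g2 wp] by (simp add: \<gamma>)
    also have "\<dots> \<le> ennreal (r^2 * \<gamma> j)"
      using sq \<gamma>0 by (simp add: ennreal_mult[symmetric] ennreal_leI mult_right_mono)
    finally have A: "nn_L2 lborel (\<lambda>x. f (x + w + (v $ j) *\<^sub>R axis j 1) - f (x + w))
       \<le> ennreal (r^2 * \<gamma> j)" .
    have "nn_L2 lborel (\<lambda>x. f (x + v) - f x)
      \<le> (\<integral>\<^sup>+x. 2 * ennreal ((norm (f (x + w + (v $ j) *\<^sub>R axis j 1) - f (x + w)))^2)
           + 2 * ennreal ((norm (f (x + w) - f x))^2) \<partial>lborel)"
    proof (rule nn_integral_mono)
      fix x
      let ?a = "f (x + w + (v $ j) *\<^sub>R axis j 1) - f (x + w)" and ?b = "f (x + w) - f x"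
      have "x + v = x + w + (v $ j) *\<^sub>R axis j 1" by (subst vw) (simp add: add.assoc)
      then have "f (x + v) - f x = ?a + ?b" by (simp only:) simp
      then have "(norm (f (x + v) - f x))^2 \<le> 2 * (norm ?a)^2 + 2 * (norm ?b)^2"
        by (simp only: norm_add_square_le)
      then have "ennreal ((norm (f (x + v) - f x))^2) \<le> ennreal (2 * (norm ?a)^2 + 2 * (norm ?b)^2)"
        by (rule ennreal_leI)
      then show "ennreal ((norm (f (x + v) - f x))^2) \<le> 2 * ennreal ((norm ?a)^2) + 2 * ennreal ((norm ?b)^2)"
        by (simp add: ennreal_plus ennreal_mult)
    qed
    also have "\<dots> = 2 * nn_L2 lborel (\<lambda>x. f (x + w + (v $ j) *\<^sub>R axis j 1) - f (x + w))
        + 2 * nn_L2 lborel (\<lambda>x. f (x + w) - f x)"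
      by (subst nn_integral_add) (auto simp: nn_integral_cmult)
    also have "\<dots> \<le> 2 * ennreal (r^2 * \<gamma> j) + 2 * ennreal (2 ^ card S * r^2 * (\<Sum>i\<in>S. \<gamma> i))"
      by (intro add_mono mult_left_mono A IH) auto
    also have "\<dots> = ennreal (2 * (r^2 * \<gamma> j) + 2 * (2 ^ card S * r^2 * (\<Sum>i\<in>S. \<gamma> i)))"
      using \<gamma>0 by (simp add: ennreal_plus ennreal_mult sum_nonneg)
    also have "\<dots> \<le> ennreal (2 ^ card (insert j S) * r^2 * (\<Sum>i\<in>insert j S. \<gamma> i))"
    proof (rule ennreal_leI)
      have "r^2 * \<gamma> j * 1 \<le> r^2 * \<gamma> j * 2 ^ card S" using \<gamma>0 by (intro mult_left_mono) auto
      then show "2 * (r^2 * \<gamma> j) + 2 * (2 ^ card S * r^2 * (\<Sum>i\<in>S. \<gamma> i))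
         \<le> 2 ^ card (insert j S) * r^2 * (\<Sum>i\<in>insert j S. \<gamma> i)"
        using insert.hyps by (simp add: algebra_simps)
    qed
    finally show ?case .
  qed
  from this[of UNIV v] show ?thesis using v by (simp add: \<gamma>_def)
qed

section \<open>Grid cells and the inequality for cell averages\<close>

definition cell :: "real \<Rightarrow> real^'n::finite \<Rightarrow> (real^'n) set" where
  "cell \<epsilon> x = {y. \<forall>i. \<lfloor>y $ i / \<epsilon>\<rfloor> = \<lfloor>x $ i / \<epsilon>\<rfloor>}"

definition cell_avg :: "real \<Rightarrow> (real^'n::finite \<Rightarrow> complex) \<Rightarrow> real^'n \<Rightarrow> complex" where
  "cell_avg \<epsilon> f x = (1 / \<epsilon> ^ CARD('n)) *\<^sub>R (\<integral>y. indicator (cell \<epsilon> x) y *\<^sub>R f y \<partial>lebesgue)"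

lemma cell_sets [measurable]: "cell \<epsilon> x \<in> sets borel"
  unfolding cell_def by measurable

lemma cell_indicator_measurable [measurable]:
  "(\<lambda>(x, y). indicator (cell \<epsilon> x) y :: 'b::{zero_neq_one, topological_space})
     \<in> borel_measurable (borel \<Otimes>\<^sub>M (borel :: (real^'n::finite) measure))"
proof -
  have "{z::(real^'n) \<times> (real^'n). \<forall>i. \<lfloor>snd z $ i / \<epsilon>\<rfloor> = \<lfloor>fst z $ i / \<epsilon>\<rfloor>} \<in> sets (borel \<Otimes>\<^sub>M borel)"
  proof -
    have "Measurable.pred (borel \<Otimes>\<^sub>M borel) (\<lambda>z::(real^'n) \<times> (real^'n). \<forall>i. \<lfloor>snd z $ i / \<epsilon>\<rfloor> = \<lfloor>fst z $ i / \<epsilon>\<rfloor>)"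
      by measurable
    then show ?thesis by (simp add: pred_def space_pair_measure)
  qed
  then have "indicator {z::(real^'n) \<times> (real^'n). \<forall>i. \<lfloor>snd z $ i / \<epsilon>\<rfloor> = \<lfloor>fst z $ i / \<epsilon>\<rfloor>}
      \<in> (borel \<Otimes>\<^sub>M borel) \<rightarrow>\<^sub>M (borel :: 'b measure)"
    by (rule borel_measurable_indicator)
  moreover have "indicator {z::(real^'n) \<times> (real^'n). \<forall>i. \<lfloor>snd z $ i / \<epsilon>\<rfloor> = \<lfloor>fst z $ i / \<epsilon>\<rfloor>}
     = (\<lambda>(x, y). indicator (cell \<epsilon> x) y :: 'b)"
    by (auto simp: fun_eq_iff indicator_def cell_def)
  ultimately show ?thesis by simp
qed

lemma cell_Linf: "y \<in> cell \<epsilon> x \<Longrightarrow> \<epsilon> > 0 \<Longrightarrow> \<bar>y $ i - x $ i\<bar> \<le> \<epsilon>"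
proof -
  assume "y \<in> cell \<epsilon> x" and e: "\<epsilon> > 0"
  then have "\<lfloor>y $ i / \<epsilon>\<rfloor> = \<lfloor>x $ i / \<epsilon>\<rfloor>" by (simp add: cell_def)
  then have "\<bar>y $ i / \<epsilon> - x $ i / \<epsilon>\<bar> \<le> 1" by linarith
  then have "\<bar>(y $ i - x $ i) / \<epsilon>\<bar> \<le> 1" by (simp add: diff_divide_distrib)
  then show ?thesis using e by (simp add: abs_divide)
qed

lemma emeasure_cbox_cart:
  fixes a b :: "real^'n::finite"
  assumes "\<And>i. a $ i \<le> b $ i"
  shows "emeasure lborel (cbox a b) = ennreal (\<Prod>i\<in>UNIV. b $ i - a $ i)"
proof -
  have ne: "cbox a b \<noteq> {}" using assms by (auto simp: interval_ne_empty_cart)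
  have "emeasure lborel (cbox a b) = ennreal (measure lborel (cbox a b))"
    by (rule emeasure_eq_ennreal_measure) (simp add: emeasure_lborel_cbox_eq)
  then show ?thesis by (simp add: content_cbox_cart[OF ne])
qed

lemma emeasure_cell:
  fixes x :: "real^'n::finite"
  assumes e: "\<epsilon> > 0"
  shows "emeasure lborel (cell \<epsilon> x) = ennreal (\<epsilon> ^ CARD('n))"
proof -
  define a b :: "real^'n" where "a = (\<chi> i. \<epsilon> * of_int \<lfloor>x $ i / \<epsilon>\<rfloor>)" and "b = (\<chi> i. \<epsilon> * of_int \<lfloor>x $ i / \<epsilon>\<rfloor> + \<epsilon>)"
  have c: "emeasure lborel (cbox a b) = ennreal (\<epsilon> ^ CARD('n))"
    using e by (subst emeasure_cbox_cart) (auto simp: a_def b_def)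
  have iff: "y \<in> cell \<epsilon> x \<longleftrightarrow> (\<forall>i. a $ i \<le> y $ i \<and> y $ i < b $ i)" for y
    unfolding cell_def a_def b_def using e by (auto simp: floor_eq_iff field_simps)
  have "emeasure lborel (cell \<epsilon> x) = emeasure lborel (cbox a b)"
  proof (rule antisym)
    show "emeasure lborel (cell \<epsilon> x) \<le> emeasure lborel (cbox a b)"
      by (rule emeasure_mono) (auto simp: iff mem_box_cart less_imp_le)
    have "emeasure lborel (cbox a b) = emeasure lborel (box a b)"
      by (simp add: emeasure_lborel_cbox_eq emeasure_lborel_box_eq)
    also have "\<dots> \<le> emeasure lborel (cell \<epsilon> x)"
      by (rule emeasure_mono) (auto simp: iff mem_box_cart less_imp_le)
    finally show "emeasure lborel (cbox a b) \<le> emeasure lborel (cell \<epsilon> x)" .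
  qed
  then show ?thesis by (simp add: c)
qed

lemma cell_avg_measurable [measurable]:
  assumes [measurable]: "f \<in> borel_measurable borel"
  shows "cell_avg \<epsilon> f \<in> borel_measurable borel"
proof -
  have "cell_avg \<epsilon> f = (\<lambda>x. (1 / \<epsilon> ^ CARD('a)) *\<^sub>R (\<integral>y. indicator (cell \<epsilon> x) y *\<^sub>R f y \<partial>lborel))"
    unfolding cell_avg_def by (intro ext arg_cong2[where f=scaleR] refl integral_completion) measurable
  then show ?thesis by simp
qed

text \<open>By Cauchy-Schwarz the squared deviation from the average is at most the average of
  \<open>|f x - f y|^2\<close> over the cell. The cell of \<open>x\<close> lies in
  \<open>x + B\<close>, so after exchanging the integrals only square norms of
  \<open>f (x + v) - f x\<close> with \<open>v\<close> in \<open>B\<close> remain. The ratio of the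
  volume of \<open>B\<close> to that of a cell is one factor \<open>2 ^ CARD('n)\<close>, and
  \<open>translation_estimate\<close> contributes the other.\<close>

lemma Poincare_borel:
  fixes f :: "real^'n::finite \<Rightarrow> complex"
  assumes fm [measurable]: "f \<in> borel_measurable borel" and f2: "integrable lborel (\<lambda>x. (norm (f x))^2)"
    and gm: "\<And>i. g i \<in> borel_measurable borel" and g2: "\<And>i. integrable lborel (\<lambda>x. (norm (g i x))^2)"
    and wp: "\<And>i. has_weak_partial i f (g i)" and e: "\<epsilon> > 0"
  shows "nn_L2 lborel (\<lambda>x. f x - cell_avg \<epsilon> f x)
     \<le> ennreal (4 ^ CARD('n) * \<epsilon>^2 * (\<Sum>i\<in>UNIV. sq_int lborel (g i)))"
proof -
  define B :: "(real^'n) set" where "B = cbox (\<chi> i. - \<epsilon>) (\<chi> i. \<epsilon>)"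
  define k where "k = \<epsilon> ^ CARD('n)"
  have k: "k > 0" using e by (simp add: k_def)
  define C where "C = 2 ^ CARD('n) * \<epsilon>^2 * (\<Sum>i\<in>UNIV. sq_int lborel (g i))"
  have C0: "C \<ge> 0" by (auto simp: C_def intro!: mult_nonneg_nonneg sum_nonneg)
  have B [measurable]: "B \<in> sets borel" by (simp add: B_def)
  have eB: "emeasure lborel B = ennreal (2 ^ CARD('n) * k)"
    unfolding B_def using e by (subst emeasure_cbox_cart) (auto simp: k_def power_mult_distrib mult_2[symmetric])
  have pw: "ennreal ((norm (f x - cell_avg \<epsilon> f x))^2)
     \<le> ennreal (1 / k) * (\<integral>\<^sup>+v. indicator B v * ennreal ((norm (f (x + v) - f x))^2) \<partial>lborel)" for x
  proof -
    have sf: "integrable lborel (\<lambda>y. indicator (cell \<epsilon> x) y *\<^sub>R f y)"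
    proof (rule Bochner_Integration.integrable_bound)
      show "integrable lborel (\<lambda>y. indicator (cell \<epsilon> x) y + (norm (f y))^2)"
        using f2 e by (intro Bochner_Integration.integrable_add)
         (auto simp: emeasure_cell integrable_indicator_iff)
      show "AE y in lborel. norm (indicator (cell \<epsilon> x) y *\<^sub>R f y) \<le> norm (indicator (cell \<epsilon> x) y + (norm (f y))^2)"
        by (auto simp: indicator_def norm_le_one_plus_square intro!: AE_I2)
    qed simp
    have sx: "integrable lborel (\<lambda>y. indicator (cell \<epsilon> x) y *\<^sub>R f x)"
      using e by (intro integrable_scaleR_left) (auto simp: emeasure_cell integrable_indicator_iff)
    have mc: "measure lborel (cell \<epsilon> x) = k"
      using e by (simp add: measure_def emeasure_cell k_def)
    have "(\<integral>y. indicator (cell \<epsilon> x) y *\<^sub>R f x \<partial>lborel) = k *\<^sub>R f x"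
      using e by (subst integral_scaleR_left) (auto simp: emeasure_cell mc integrable_indicator_iff)
    then have "f x - cell_avg \<epsilon> f x = (1 / k) *\<^sub>R (\<integral>y. indicator (cell \<epsilon> x) y *\<^sub>R (f x - f y) \<partial>lborel)"
      using sf sx k unfolding cell_avg_def k_def[symmetric]
      by (simp add: integral_completion scaleR_diff_right)
    then have "ennreal ((norm (f x - cell_avg \<epsilon> f x))^2)
      = ennreal ((1 / k)^2) * ennreal ((norm (\<integral>y. indicator (cell \<epsilon> x) y *\<^sub>R (f x - f y) \<partial>lborel))^2)"
      using k by (simp add: ennreal_mult[symmetric] power_mult_distrib power_divide)
    also have "\<dots> \<le> ennreal ((1 / k)^2) * (ennreal k * (\<integral>\<^sup>+y. indicator (cell \<epsilon> x) y * ennreal ((norm (f x - f y))^2) \<partial>lborel))"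
      using ennreal_norm_integral_square_le[of "\<lambda>y. f x - f y" lborel "cell \<epsilon> x"] e
      by (intro mult_left_mono) (auto simp: emeasure_cell k_def)
    also have "\<dots> = ennreal (1 / k) * (\<integral>\<^sup>+y. indicator (cell \<epsilon> x) y * ennreal ((norm (f x - f y))^2) \<partial>lborel)"
    proof -
      have "ennreal ((1 / k)^2) * ennreal k = ennreal (1 / k)"
        using k by (simp add: ennreal_mult[symmetric] power2_eq_square)
      then show ?thesis by (simp add: mult.assoc[symmetric])
    qed
    \<comment> \<open>Enlarging the cell to \<open>x + B\<close> makes the range of
      \<open>v = y - x\<close> independent of \<open>x\<close>, as the exchange of integrals
      requires.\<close>
    also have "\<dots> \<le> ennreal (1 / k) * (\<integral>\<^sup>+y. indicator B (y - x) * ennreal ((norm (f x - f y))^2) \<partial>lborel)"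
    proof (intro mult_left_mono nn_integral_mono mult_right_mono)
      fix y show "indicator (cell \<epsilon> x) y \<le> (indicator B (y - x) :: ennreal)"
        using cell_Linf[OF _ e, of y x] by (auto simp: indicator_def B_def mem_box_cart abs_le_iff algebra_simps)
    qed auto
    also have "(\<integral>\<^sup>+y. indicator B (y - x) * ennreal ((norm (f x - f y))^2) \<partial>lborel)
      = (\<integral>\<^sup>+v. indicator B v * ennreal ((norm (f (x + v) - f x))^2) \<partial>lborel)"
      using nn_integral_lborel_translation[where c=x and F="\<lambda>y. indicator B (y - x) * ennreal ((norm (f x - f y))^2)"]
      by (simp add: add.commute norm_minus_commute)
    finally show ?thesis .
  qed
  have "nn_L2 lborel (\<lambda>x. f x - cell_avg \<epsilon> f x)
     \<le> (\<integral>\<^sup>+x. ennreal (1 / k) * (\<integral>\<^sup>+v. indicator B v * ennreal ((norm (f (x + v) - f x))^2) \<partial>lborel) \<partial>lborel)"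
    by (intro nn_integral_mono pw)
  also have "\<dots> = ennreal (1 / k) * (\<integral>\<^sup>+x. (\<integral>\<^sup>+v. indicator B v * ennreal ((norm (f (x + v) - f x))^2) \<partial>lborel) \<partial>lborel)"
    by (rule nn_integral_cmult) measurable
  also have "(\<integral>\<^sup>+x. (\<integral>\<^sup>+v. indicator B v * ennreal ((norm (f (x + v) - f x))^2) \<partial>lborel) \<partial>lborel)
     = (\<integral>\<^sup>+v. (\<integral>\<^sup>+x. indicator B v * ennreal ((norm (f (x + v) - f x))^2) \<partial>lborel) \<partial>lborel)"
    by (rule lborel_pair.Fubini') measurable
  also have "\<dots> = (\<integral>\<^sup>+v. indicator B v * nn_L2 lborel (\<lambda>x. f (x + v) - f x) \<partial>lborel)"
    by (intro nn_integral_cong nn_integral_cmult) measurable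
  also have "\<dots> \<le> (\<integral>\<^sup>+v. ennreal C * indicator B v \<partial>lborel)"
  proof (rule nn_integral_mono)
    fix v :: "real^'n"
    show "indicator B v * nn_L2 lborel (\<lambda>x. f (x + v) - f x) \<le> ennreal C * indicator B v"
    proof (cases "v \<in> B")
      case True
      then have "\<bar>v $ i\<bar> \<le> \<epsilon>" for i by (auto simp: B_def mem_box_cart abs_le_iff) (metis minus_le_iff)
      then have "nn_L2 lborel (\<lambda>x. f (x + v) - f x) \<le> ennreal C"
        unfolding C_def by (intro translation_estimate assms)
      then show ?thesis using True by simp
    qed simp
  qed
  also have "\<dots> = ennreal C * ennreal (2 ^ CARD('n) * k)"
    by (subst nn_integral_cmult_indicator) (auto simp: eB)
  also have "ennreal (1 / k) * (ennreal C * ennreal (2 ^ CARD('n) * k)) = ennreal (2 ^ CARD('n) * C)"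
    using k C0 by (simp add: ennreal_mult[symmetric])
  also have "2 ^ CARD('n) * C = 4 ^ CARD('n) * \<epsilon>^2 * (\<Sum>i\<in>UNIV. sq_int lborel (g i))"
  proof -
    have "(4::real) ^ CARD('n) = 2 ^ CARD('n) * 2 ^ CARD('n)" by (subst power_mult_distrib[symmetric]) simp
    then show ?thesis by (simp add: C_def mult_ac)
  qed
  finally show ?thesis by (simp add: mult_left_mono)
qed

definition square_integrable :: "(real^'n::finite \<Rightarrow> 'b::real_normed_vector) \<Rightarrow> bool" where
  "square_integrable f \<longleftrightarrow> f \<in> borel_measurable lebesgue \<and> integrable lebesgue (\<lambda>x. (norm (f x))^2)"

lemma cell_avg_cong_AE:
  assumes "AE x in lebesgue. f x = f' x" "f \<in> borel_measurable lebesgue" "f' \<in> borel_measurable lebesgue"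
  shows "cell_avg \<epsilon> f = cell_avg \<epsilon> f'"
proof -
  have "(\<lambda>y. indicator (cell \<epsilon> x) y *\<^sub>R h y) \<in> borel_measurable lebesgue"
    if "h \<in> borel_measurable lebesgue" for h :: "real^'a \<Rightarrow> complex" and x
    using that by (intro borel_measurable_scaleR borel_measurable_indicator) auto
  then show ?thesis unfolding cell_avg_def using assms
    by (intro ext arg_cong2[where f=scaleR] refl integral_cong_AE) auto
qed

lemma Poincare:
  fixes f :: "real^'n::finite \<Rightarrow> complex"
  assumes f: "square_integrable f" and g: "\<And>i. square_integrable (g i)"
    and wp: "\<And>i. has_weak_partial i f (g i)" and e: "\<epsilon> > 0"
  shows "nn_L2 lebesgue (\<lambda>x. f x - cell_avg \<epsilon> f x)
     \<le> ennreal (4 ^ CARD('n) * \<epsilon>^2 * (\<Sum>i\<in>UNIV. sq_int lebesgue (g i)))"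
proof -
  have "\<exists>h'. h' \<in> borel_measurable borel \<and> (AE x in lebesgue. h x = h' x) \<and> integrable lborel (\<lambda>x. (norm (h' x))^2)
    \<and> (sq_int lborel h') = sq_int lebesgue h"
    if "square_integrable h" for h :: "real^'n \<Rightarrow> complex"
  proof -
    have hm: "h \<in> borel_measurable lebesgue" and h2: "integrable lebesgue (\<lambda>x. (norm (h x))^2)"
      using that by (auto simp: square_integrable_def)
    obtain h' where h' [measurable]: "h' \<in> borel_measurable borel" and ae: "AE x in lebesgue. h x = h' x"
      using complex_borel_representative[OF hm] .
    have m: "(\<lambda>x. (norm (h' x))^2) \<in> borel_measurable lebesgue"
      by (rule lborel_measurable_imp_lebesgue) measurable
    have "integrable lebesgue (\<lambda>x. (norm (h' x))^2)"
      using h2 by (rule integrable_cong_AE_imp) (use m ae in auto)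
    then have i: "integrable lborel (\<lambda>x. (norm (h' x))^2)" by (subst (asm) integrable_completion) measurable
    have "sq_int lebesgue h = sq_int lebesgue h'"
      using m hm ae by (intro integral_cong_AE) auto
    also have "\<dots> = sq_int lborel h'" by (rule integral_completion) measurable
    finally have I: "sq_int lebesgue h = sq_int lborel h'" .
    show ?thesis by (intro exI[of _ h'] conjI h' ae i I[symmetric])
  qed
  note rep = this
  obtain f' where f' [measurable]: "f' \<in> borel_measurable borel" "AE x in lebesgue. f x = f' x"
      "integrable lborel (\<lambda>x. (norm (f' x))^2)"
    using rep[OF f] by auto
  have "\<forall>i. \<exists>h'. h' \<in> borel_measurable borel \<and> (AE x in lebesgue. g i x = h' x) \<and> integrable lborel (\<lambda>x. (norm (h' x))^2)
    \<and> (sq_int lborel h') = sq_int lebesgue (g i)"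
    using rep[OF g] by blast
  then obtain g' where g': "\<And>i. g' i \<in> borel_measurable borel" "\<And>i. AE x in lebesgue. g i x = g' i x"
      "\<And>i. integrable lborel (\<lambda>x. (norm (g' i x))^2)"
      "\<And>i. (sq_int lborel (g' i)) = sq_int lebesgue (g i)"
    by metis
  have wp': "has_weak_partial i f' (g' i)" for i
    using has_weak_partial_cong_AE[OF wp f'(2) g'(2)] f'(1) g'(1) lborel_measurable_imp_lebesgue by blast
  have avg: "cell_avg \<epsilon> f = cell_avg \<epsilon> f'"
    using f f' lborel_measurable_imp_lebesgue[OF f'(1)] by (intro cell_avg_cong_AE) (auto simp: square_integrable_def)
  have "nn_L2 lebesgue (\<lambda>x. f x - cell_avg \<epsilon> f x)
    = nn_L2 lebesgue (\<lambda>x. f' x - cell_avg \<epsilon> f' x)"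
    unfolding avg by (rule nn_integral_cong_AE) (use f'(2) in auto)
  also have "\<dots> = nn_L2 lborel (\<lambda>x. f' x - cell_avg \<epsilon> f' x)"
    by (rule nn_integral_completion)
  also have "\<dots> \<le> ennreal (4 ^ CARD('n) * \<epsilon>^2 * (\<Sum>i\<in>UNIV. sq_int lborel (g' i)))"
    by (rule Poincare_borel[OF f'(1,3) g'(1,3) wp' e])
  finally show ?thesis by (simp add: g'(4))
qed

subsection \<open>Subcritical Sobolev embedding\<close>

lemma cell_avg_measurable_lebesgue:
  fixes f :: "real^'n::finite \<Rightarrow> complex"
  assumes "f \<in> borel_measurable lebesgue"
  shows "cell_avg \<epsilon> f \<in> borel_measurable lebesgue"
proof -
  obtain f' where f': "f' \<in> borel_measurable borel" "AE x in lebesgue. f x = f' x"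
    using complex_borel_representative[OF assms] .
  have "cell_avg \<epsilon> f = cell_avg \<epsilon> f'"
    using cell_avg_cong_AE[OF f'(2) assms lborel_measurable_imp_lebesgue[OF f'(1)]] .
  then show ?thesis using lborel_measurable_imp_lebesgue[OF cell_avg_measurable[OF f'(1)]] by simp
qed

text \<open>The pointwise hypothesis has free constants because two choices occur:
  \<open>l = t / 2\<close> with a general \<open>q\<close> for superlevel sets, and
  \<open>l = c = 1\<close> with \<open>q = 2\<close> for the uniform bound on averages in the
  compactness proof.\<close>

lemma norm_cell_avg_le:
  fixes f :: "real^'n::finite \<Rightarrow> complex"
  assumes f: "f \<in> borel_measurable lebesgue" and e: "\<epsilon> > 0" and pos: "l \<ge> 0" "c \<ge> 0" "A \<ge> 0"
    and pw: "\<And>x. norm (f x) \<le> l + c * norm (f x) powr q"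
    and A: "(\<integral>\<^sup>+x. ennreal (norm (f x) powr q) \<partial>lebesgue) \<le> ennreal A"
  shows "norm (cell_avg \<epsilon> f x) \<le> l + c * A / \<epsilon> ^ CARD('n)"
proof -
  define k where "k = \<epsilon> ^ CARD('n)"
  have k: "k > 0" using e by (simp add: k_def)
  have cell: "cell \<epsilon> x \<in> sets lebesgue" using cell_sets by simp
  have "ennreal (norm (\<integral>y. indicator (cell \<epsilon> x) y *\<^sub>R f y \<partial>lebesgue))
     \<le> (\<integral>\<^sup>+y. ennreal (norm (indicator (cell \<epsilon> x) y *\<^sub>R f y)) \<partial>lebesgue)"
    by (rule ennreal_norm_integral_le)
  also have "\<dots> \<le> (\<integral>\<^sup>+y. ennreal l * indicator (cell \<epsilon> x) y + ennreal c * ennreal (norm (f y) powr q) \<partial>lebesgue)"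
  proof (rule nn_integral_mono)
    fix y
    have "ennreal (norm (f y)) \<le> ennreal l + ennreal c * ennreal (norm (f y) powr q)"
      using pw[of y] pos by (simp add: ennreal_mult[symmetric] ennreal_plus[symmetric] ennreal_leI del: ennreal_plus)
    then show "ennreal (norm (indicator (cell \<epsilon> x) y *\<^sub>R f y))
      \<le> ennreal l * indicator (cell \<epsilon> x) y + ennreal c * ennreal (norm (f y) powr q)"
      by (auto simp: indicator_def)
  qed
  also have "\<dots> = (\<integral>\<^sup>+y. ennreal l * indicator (cell \<epsilon> x) y \<partial>lebesgue)
       + (\<integral>\<^sup>+y. ennreal c * ennreal (norm (f y) powr q) \<partial>lebesgue)"
  proof (rule nn_integral_add)
    show "(\<lambda>y. ennreal l * indicator (cell \<epsilon> x) y) \<in> borel_measurable lebesgue"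
      using cell by measurable
    show "(\<lambda>y. ennreal c * ennreal (norm (f y) powr q)) \<in> borel_measurable lebesgue"
      using f by measurable
  qed
  also have "(\<integral>\<^sup>+y. ennreal l * indicator (cell \<epsilon> x) y \<partial>lebesgue) = ennreal l * ennreal k"
    using cell e by (subst nn_integral_cmult_indicator) (auto simp: emeasure_cell k_def)
  also have "(\<integral>\<^sup>+y. ennreal c * ennreal (norm (f y) powr q) \<partial>lebesgue)
     = ennreal c * (\<integral>\<^sup>+y. ennreal (norm (f y) powr q) \<partial>lebesgue)"
    using f by (intro nn_integral_cmult) auto
  also have "ennreal l * ennreal k + ennreal c * (\<integral>\<^sup>+y. ennreal (norm (f y) powr q) \<partial>lebesgue)
     \<le> ennreal l * ennreal k + ennreal c * ennreal A"
    by (intro add_left_mono mult_left_mono A) auto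
  also have "\<dots> = ennreal (l * k + c * A)"
    using pos k by (simp add: ennreal_mult ennreal_plus)
  finally have "norm (\<integral>y. indicator (cell \<epsilon> x) y *\<^sub>R f y \<partial>lebesgue) \<le> l * k + c * A"
    using pos k by (subst (asm) ennreal_le_iff) auto
  then have "norm (\<integral>y. indicator (cell \<epsilon> x) y *\<^sub>R f y \<partial>lebesgue) / k \<le> (l * k + c * A) / k"
    using k by (simp add: divide_right_mono)
  also have "\<dots> = l + c * A / k" using k by (simp add: field_simps)
  also have "norm (\<integral>y. indicator (cell \<epsilon> x) y *\<^sub>R f y \<partial>lebesgue) / k = norm (cell_avg \<epsilon> f x)"
    using k unfolding cell_avg_def k_def[symmetric] by simp
  finally show ?thesis unfolding k_def .
qed

lemma superlevel_set_bound:
  fixes f :: "real^'n::finite \<Rightarrow> complex"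
  assumes f: "f \<in> borel_measurable lebesgue" and q: "q \<ge> 1"
    and A: "(\<integral>\<^sup>+x. ennreal (norm (f x) powr q) \<partial>lebesgue) \<le> ennreal A" "A > 0"
    and P: "\<And>\<epsilon>. \<epsilon> > 0 \<Longrightarrow> (nn_L2 lebesgue (\<lambda>x. f x - cell_avg \<epsilon> f x)) \<le> ennreal (C * \<epsilon>^2)" "C \<ge> 0"
    and t: "t > 0"
  shows "emeasure lebesgue {x. norm (f x) > 2 * t}
    \<le> ennreal (C * ((t / 2) powr (- q) * A) powr (2 / CARD('n)) / t^2)"
proof -
  define d where "d = real CARD('n)"
  have d: "d > 0" by (simp add: d_def)
  \<comment> \<open>By Chebyshev \<open>b\<close> bounds the measure of the set where
    \<open>|f| > t / 2\<close>. The mesh is chosen so that one cell has volume \<open>b\<close>;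
    then the part of \<open>f\<close> above \<open>t / 2\<close> adds at most \<open>t / 2\<close>
    to any average.\<close>
  define b where "b = (t / 2) powr (- q) * A"
  have b: "b > 0" using t A by (simp add: b_def)
  define \<epsilon> where "\<epsilon> = b powr (1 / d)"
  have e: "\<epsilon> > 0" using b by (simp add: \<epsilon>_def)
  have ed: "\<epsilon> ^ CARD('n) = b"
    using b d unfolding \<epsilon>_def by (simp add: powr_power d_def)
  have e2: "\<epsilon>^2 = b powr (2 / d)"
    using b unfolding \<epsilon>_def by (simp add: powr_power)
  have avg: "norm (cell_avg \<epsilon> f x) \<le> t" for x
  proof -
    \<comment> \<open>Above \<open>t / 2\<close> one writes \<open>|f|\<close> as its power
      \<open>1 - q\<close> times its power \<open>q\<close>; the exponent \<open>1 - q\<close> is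
      not positive, so the first factor is largest at \<open>t / 2\<close>.\<close>
    have "norm (f x) \<le> t / 2 + (t / 2) powr (1 - q) * norm (f x) powr q" for x
    proof (cases "norm (f x) \<le> t / 2")
      case True
      then show ?thesis by (simp add: add_increasing2)
    next
      case False
      then have "norm (f x) = norm (f x) powr (1 - q) * norm (f x) powr q"
        using t by (simp add: powr_add[symmetric])
      also have "\<dots> \<le> (t / 2) powr (1 - q) * norm (f x) powr q"
        using False t q by (intro mult_right_mono powr_mono2') auto
      finally show ?thesis using t by linarith
    qed
    then have "norm (cell_avg \<epsilon> f x) \<le> t / 2 + (t / 2) powr (1 - q) * A / \<epsilon> ^ CARD('n)"
      using t A by (intro norm_cell_avg_le[OF f e]) auto
    also have "(t / 2) powr (1 - q) * A / \<epsilon> ^ CARD('n) = t / 2"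
      using t A unfolding ed b_def by (simp add: powr_diff powr_minus field_simps)
    finally show ?thesis by simp
  qed
  have m: "(\<lambda>x. ennreal ((norm (f x - cell_avg \<epsilon> f x))^2)) \<in> borel_measurable lebesgue"
    using f cell_avg_measurable_lebesgue[OF f] by measurable
  have "emeasure lebesgue {x. norm (f x) > 2 * t}
      \<le> emeasure lebesgue {x\<in>UNIV. 1 \<le> ennreal (1 / t^2) * ennreal ((norm (f x - cell_avg \<epsilon> f x))^2)}"
  proof (rule emeasure_mono)
    show "{x. norm (f x) > 2 * t} \<subseteq> {x\<in>UNIV. 1 \<le> ennreal (1 / t^2) * ennreal ((norm (f x - cell_avg \<epsilon> f x))^2)}"
    proof (rule subsetI)
      fix x assume "x \<in> {x. norm (f x) > 2 * t}"
      then have x: "norm (f x) > 2 * t" by simp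
      have "norm (f x) \<le> norm (f x - cell_avg \<epsilon> f x) + norm (cell_avg \<epsilon> f x)"
        using norm_triangle_ineq[of "f x - cell_avg \<epsilon> f x" "cell_avg \<epsilon> f x"] by simp
      with x avg[of x] have "t \<le> norm (f x - cell_avg \<epsilon> f x)" by linarith
      then have "t^2 \<le> (norm (f x - cell_avg \<epsilon> f x))^2" using t by (intro power_mono) auto
      then have "1 \<le> 1 / t^2 * (norm (f x - cell_avg \<epsilon> f x))^2" using t by (simp add: field_simps)
      then have "ennreal 1 \<le> ennreal (1 / t^2 * (norm (f x - cell_avg \<epsilon> f x))^2)" by (rule ennreal_leI)
      also have "\<dots> = ennreal (1 / t^2) * ennreal ((norm (f x - cell_avg \<epsilon> f x))^2)"
        by (rule ennreal_mult) auto
      finally show "x \<in> {x\<in>UNIV. 1 \<le> ennreal (1 / t^2) * ennreal ((norm (f x - cell_avg \<epsilon> f x))^2)}"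
        by (simp only: ennreal_1 mem_Collect_eq UNIV_I simp_thms)
    qed
    have "(\<lambda>x. ennreal (1 / t^2) * ennreal ((norm (f x - cell_avg \<epsilon> f x))^2)) \<in> borel_measurable lebesgue"
      using m by measurable
    then have "{x\<in>space lebesgue. 1 \<le> ennreal (1 / t^2) * ennreal ((norm (f x - cell_avg \<epsilon> f x))^2)} \<in> sets lebesgue"
      by measurable
    then show "{x\<in>UNIV. 1 \<le> ennreal (1 / t^2) * ennreal ((norm (f x - cell_avg \<epsilon> f x))^2)} \<in> sets lebesgue"
      by simp
  qed
  also have "\<dots> \<le> ennreal (1 / t^2) * (\<integral>\<^sup>+x. ennreal ((norm (f x - cell_avg \<epsilon> f x))^2) * indicator UNIV x \<partial>lebesgue)"
    using m by (intro nn_integral_Markov_inequality) auto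
  also have "\<dots> \<le> ennreal (1 / t^2) * ennreal (C * \<epsilon>^2)"
    using P(1)[OF e] by (intro mult_left_mono) auto
  also have "\<dots> = ennreal (C * b powr (2 / d) / t^2)"
    using P(2) t by (simp add: ennreal_mult[symmetric] e2)
  finally show ?thesis unfolding b_def d_def .
qed

text \<open>Where \<open>|f| \<le> 1\<close> the square dominates, as \<open>r \<ge> 2\<close>.
  Elsewhere \<open>|f|\<close> lies between consecutive powers \<open>2 ^ k\<close> and
  \<open>2 ^ (k + 1)\<close>, so its power is at most \<open>c k\<close> and \<open>x\<close> lies
  in \<open>L k\<close>. The measures of the \<open>L k\<close> decay fast enough that the sum over
  \<open>k\<close> is a geometric series with ratio \<open>2 powr (r - s) < 1\<close>.\<close>

lemma nn_integral_powr_dyadic: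
  fixes f :: "real^'n::finite \<Rightarrow> complex"
  assumes f: "f \<in> borel_measurable lebesgue" and f2: "nn_L2 lebesgue f < \<infinity>"
    and K: "\<And>k. emeasure lebesgue {x. norm (f x) > 2 ^ k} \<le> ennreal (K * (2 powr - s) ^ k)" "K \<ge> 0"
    and r: "2 \<le> r" "r < s"
  shows "(\<integral>\<^sup>+x. ennreal (norm (f x) powr r) \<partial>lebesgue) < \<infinity>"
proof -
  define L where "L k = {x. norm (f x) > 2 ^ k}" for k :: nat
  have L: "L k \<in> sets lebesgue" for k
  proof -
    have "{x \<in> space lebesgue. norm (f x) > 2 ^ k} \<in> sets lebesgue" using f by measurable
    then show ?thesis by (simp add: L_def)
  qed
  define c where "c k = 2 powr r * (2 powr r) ^ k" for k :: nat
  have c0: "c k \<ge> 0" for k by (simp add: c_def)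
  have pw: "ennreal (norm (f x) powr r) \<le> ennreal ((norm (f x))^2) + (\<Sum>k. ennreal (c k) * indicator (L k) x)" for x
  proof (cases "norm (f x) \<le> 1")
    case True
    have "norm (f x) powr r \<le> norm (f x) powr 2"
    proof (cases "f x = 0")
      case False
      then show ?thesis
        using True r powr_mono_both'[of 2 r "norm (f x)" "norm (f x)"] by auto
    qed simp
    also have "\<dots> = (norm (f x))^2" by simp
    finally show ?thesis by (intro add_increasing2) (auto intro: ennreal_leI)
  next
    case False
    obtain n where "norm (f x) < 2 ^ n" using real_arch_pow[of 2 "norm (f x)"] by auto
    then have ex: "\<exists>n. norm (f x) \<le> 2 ^ n" by (auto intro: less_imp_le)
    \<comment> \<open>The least such exponent is positive because \<open>|f x| > 1\<close>, and its
      predecessor is the level that \<open>f x\<close> exceeds.\<close>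
    define m where "m = (LEAST n. norm (f x) \<le> 2 ^ n)"
    have m: "norm (f x) \<le> 2 ^ m" unfolding m_def by (rule LeastI_ex[OF ex])
    have "m \<noteq> 0" using m False by (cases m) auto
    then obtain k where k: "m = Suc k" by (cases m) auto
    have "\<not> norm (f x) \<le> 2 ^ k"
      using not_less_Least[of k "\<lambda>n. norm (f x) \<le> 2 ^ n"] k m_def by auto
    then have xk: "x \<in> L k" by (simp add: L_def)
    have "norm (f x) powr r \<le> (2 ^ m) powr r" using m r by (intro powr_mono2) auto
    also have "\<dots> = c k"
    proof -
      have "((2::real) ^ k) powr r = (2 powr r) ^ k"
        by (simp add: powr_power powr_realpow[symmetric] powr_powr mult.commute)
      then show ?thesis by (simp add: c_def k powr_mult)
    qed
    finally have "ennreal (norm (f x) powr r) \<le> ennreal (c k)" by (rule ennreal_leI)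
    also have "\<dots> = (\<Sum>k\<in>{k}. ennreal (c k) * indicator (L k) x)" using xk by simp
    also have "\<dots> \<le> (\<Sum>k. ennreal (c k) * indicator (L k) x)" by (intro sum_le_suminf) auto
    finally show ?thesis by (intro add_increasing) auto
  qed
  have "(\<integral>\<^sup>+x. ennreal (norm (f x) powr r) \<partial>lebesgue)
     \<le> (\<integral>\<^sup>+x. ennreal ((norm (f x))^2) + (\<Sum>k. ennreal (c k) * indicator (L k) x) \<partial>lebesgue)"
    by (intro nn_integral_mono pw)
  also have "\<dots> = nn_L2 lebesgue f + (\<integral>\<^sup>+x. (\<Sum>k. ennreal (c k) * indicator (L k) x) \<partial>lebesgue)"
    using f L by (intro nn_integral_add) auto
  also have "(\<integral>\<^sup>+x. (\<Sum>k. ennreal (c k) * indicator (L k) x) \<partial>lebesgue) = (\<Sum>k. ennreal (c k) * emeasure lebesgue (L k))"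
    using L by (subst nn_integral_suminf) (auto simp: nn_integral_cmult_indicator)
  also have "(\<Sum>k. ennreal (c k) * emeasure lebesgue (L k)) \<le> (\<Sum>k. ennreal (2 powr r * K * (2 powr (r - s)) ^ k))"
  proof (intro suminf_le summableI)
    fix k
    have "ennreal (c k) * emeasure lebesgue (L k) \<le> ennreal (c k) * ennreal (K * (2 powr - s) ^ k)"
      unfolding L_def by (intro mult_left_mono K) auto
    also have "\<dots> = ennreal (2 powr r * K * (2 powr (r - s)) ^ k)"
    proof -
      have "(2 powr (r - s)) ^ k = (2 powr r) ^ k * (2 powr - s) ^ k"
        by (simp add: power_mult_distrib[symmetric] powr_add[symmetric])
      then show ?thesis using K(2) c0 by (simp add: ennreal_mult[symmetric] c_def mult_ac)
    qed
    finally show "ennreal (c k) * emeasure lebesgue (L k) \<le> ennreal (2 powr r * K * (2 powr (r - s)) ^ k)" .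
  qed
  also have "(\<Sum>k. ennreal (2 powr r * K * (2 powr (r - s)) ^ k)) < \<infinity>"
  proof -
    have "2 powr (r - s) < 2 powr (0::real)" using r by (intro powr_less_mono) auto
    then have "summable (\<lambda>k. 2 powr r * K * (2 powr (r - s)) ^ k)"
      by (intro summable_mult summable_geometric) auto
    then have "(\<Sum>k. ennreal (2 powr r * K * (2 powr (r - s)) ^ k)) \<noteq> top"
      using K(2) by (intro ennreal_suminf_neq_top) auto
    then show ?thesis by (simp add: less_top)
  qed
  finally show ?thesis using f2 by (simp add: add_left_mono less_top)
qed

lemma Sobolev_improvement:
  fixes f :: "real^'n::finite \<Rightarrow> complex"
  assumes f: "f \<in> borel_measurable lebesgue" and f2: "nn_L2 lebesgue f < \<infinity>"
    and P: "\<And>\<epsilon>. \<epsilon> > 0 \<Longrightarrow> (nn_L2 lebesgue (\<lambda>x. f x - cell_avg \<epsilon> f x)) \<le> ennreal (C * \<epsilon>^2)" "C \<ge> 0"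
    and q: "q \<ge> 1" "(\<integral>\<^sup>+x. ennreal (norm (f x) powr q) \<partial>lebesgue) < \<infinity>"
    and r: "2 \<le> r" "r < 2 + 2 * q / CARD('n)"
  shows "(\<integral>\<^sup>+x. ennreal (norm (f x) powr r) \<partial>lebesgue) < \<infinity>"
proof -
  define d where "d = real CARD('n)"
  have d: "d > 0" by (simp add: d_def)
  \<comment> \<open>The summand \<open>1\<close> keeps \<open>A\<close> positive even if
    \<open>f\<close> vanishes almost everywhere; the mesh in \<open>superlevel_set_bound\<close> is
    a power of \<open>A\<close>.\<close>
  define A where "A = enn2real (\<integral>\<^sup>+x. ennreal (norm (f x) powr q) \<partial>lebesgue) + 1"
  have A: "(\<integral>\<^sup>+x. ennreal (norm (f x) powr q) \<partial>lebesgue) \<le> ennreal A" "A > 0"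
  proof -
    have "(\<integral>\<^sup>+x. ennreal (norm (f x) powr q) \<partial>lebesgue)
        = ennreal (enn2real (\<integral>\<^sup>+x. ennreal (norm (f x) powr q) \<partial>lebesgue))"
      using q(2) by simp
    also have "\<dots> \<le> ennreal A" by (rule ennreal_leI) (simp add: A_def)
    finally show "(\<integral>\<^sup>+x. ennreal (norm (f x) powr q) \<partial>lebesgue) \<le> ennreal A" .
    show "A > 0" unfolding A_def by (simp add: add_nonneg_pos)
  qed
  \<comment> \<open>Both fours stem from the choice \<open>t = 2 ^ k / 2\<close>, made because the
    superlevel bound concerns \<open>2 * t\<close>: the first comes from \<open>1 / t^2\<close>, the
    second from \<open>(t / 2) powr (- q)\<close>.\<close>
  define K where "K = 4 * C * (4 powr q * A) powr (2 / d)"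
  have bound: "emeasure lebesgue {x. norm (f x) > 2 ^ k} \<le> ennreal (K * (2 powr - (2 + 2 * q / d)) ^ k)" for k :: nat
  proof -
    have t: "(2 ^ k / 2 :: real) > 0" by simp
    have 2: "(2::real) ^ k = 2 powr k" by (simp add: powr_realpow)
    have "emeasure lebesgue {x. norm (f x) > 2 * (2 ^ k / 2)}
      \<le> ennreal (C * ((2 ^ k / 2 / 2) powr (- q) * A) powr (2 / CARD('n)) / (2 ^ k / 2)^2)"
      by (rule superlevel_set_bound[OF f q(1) A P t])
    also have "C * ((2 ^ k / 2 / 2) powr (- q) * A) powr (2 / CARD('n)) / (2 ^ k / 2)^2
       = K * (2 powr - (2 + 2 * q / d)) ^ k"
    proof -
      have "(2 ^ k / 2 / 2) powr (- q) = 4 powr q * 2 powr (- (q * k))"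
        by (simp add: 2 powr_divide powr_powr powr_minus field_simps)
      then have 1: "((2 ^ k / 2 / 2) powr (- q) * A) powr (2 / d)
          = (4 powr q * A) powr (2 / d) * 2 powr (- (q * k) * (2 / d))"
        using A(2) by (simp add: powr_mult powr_powr mult_ac)
      have 3: "1 / ((2::real) ^ k / 2)^2 = 4 * 2 powr (- 2 * k)"
      proof -
        have "2 powr (- 2 * real k) = 1 / 2 powr real (2 * k)"
          by (simp add: powr_minus_divide[symmetric])
        also have "\<dots> = 1 / ((2::real) ^ k)^2"
          by (subst powr_realpow) (simp_all add: power_even_eq)
        finally show ?thesis by (simp add: power_divide)
      qed
      have 4: "2 powr (- (q * k) * (2 / d)) * 2 powr (- 2 * k) = (2 powr - (2 + 2 * q / d)) ^ k"
      proof -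
        have "2 powr (- (q * k) * (2 / d)) * 2 powr (- 2 * k) = 2 powr (- (q * k) * (2 / d) + (- 2 * k))"
          by (rule powr_add[symmetric])
        also have "- (q * k) * (2 / d) + (- 2 * k) = real k * - (2 + 2 * q / d)"
          by (simp add: algebra_simps)
        also have "2 powr (real k * - (2 + 2 * q / d)) = (2 powr - (2 + 2 * q / d)) ^ k"
          by (rule powr_power[symmetric]) simp
        finally show ?thesis .
      qed
      have "C * ((2 ^ k / 2 / 2) powr (- q) * A) powr (2 / CARD('n)) / (2 ^ k / 2)^2
        = C * ((2 ^ k / 2 / 2) powr (- q) * A) powr (2 / d) * (1 / (2 ^ k / 2)^2)"
        unfolding d_def by simp
      also have "\<dots> = C * ((4 powr q * A) powr (2 / d) * 2 powr (- (q * k) * (2 / d))) * (4 * 2 powr (- 2 * k))"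
        by (simp only: 1 3)
      also have "\<dots> = 4 * C * (4 powr q * A) powr (2 / d) * (2 powr (- (q * k) * (2 / d)) * 2 powr (- 2 * k))"
        by (simp only: mult_ac)
      finally show ?thesis by (simp only: 4 K_def)
    qed
    finally show ?thesis by simp
  qed
  show ?thesis
    by (rule nn_integral_powr_dyadic[OF f f2 bound]) (use P(2) r in \<open>auto simp: K_def d_def\<close>)
qed

text \<open>Each application of the previous lemma gains at least \<open>m\<close> in the exponent, as long as the
  exponent stays in the subcritical range.\<close>
lemma Sobolev_subcritical:
  fixes f :: "real^'n::finite \<Rightarrow> complex"
  assumes f: "f \<in> borel_measurable lebesgue" and f2: "nn_L2 lebesgue f < \<infinity>"
    and P: "\<And>\<epsilon>. \<epsilon> > 0 \<Longrightarrow> (nn_L2 lebesgue (\<lambda>x. f x - cell_avg \<epsilon> f x)) \<le> ennreal (C * \<epsilon>^2)" "C \<ge> 0"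
    and T: "2 \<le> T" "T < 2 + 2 * T / CARD('n)"
  shows "(\<integral>\<^sup>+x. ennreal (norm (f x) powr T) \<partial>lebesgue) < \<infinity>"
proof -
  define d where "d = real CARD('n)"
  have d: "d > 0" by (simp add: d_def)
  \<comment> \<open>The admissible gain \<open>2 + 2 * q / d - q\<close> is affine in
    \<open>q\<close>, so on \<open>{2..T}\<close> it is at least the smaller of its values at
    \<open>2\<close> and at \<open>T\<close>. Half of that leaves the inequality of
    \<open>Sobolev_improvement\<close> strict.\<close>
  define m where "m = min (4 / d) (2 + 2 * T / d - T) / 2"
  have m: "m > 0" using T d by (simp add: m_def d_def[symmetric])
  have m': "q + m < 2 + 2 * q / d" if q: "2 \<le> q" "q \<le> T" for q
  proof -
    have "min (4 / d) (2 + 2 * T / d - T) \<le> 2 + q * (2 / d - 1)"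
    proof (cases "2 / d - 1 \<ge> 0")
      case True
      then have "2 * (2 / d - 1) \<le> q * (2 / d - 1)" using q by (intro mult_right_mono) auto
      then show ?thesis by (simp add: algebra_simps)
    next
      case False
      then have "T * (2 / d - 1) \<le> q * (2 / d - 1)" using q by (intro mult_right_mono_neg) auto
      then show ?thesis by (simp add: algebra_simps)
    qed
    moreover have "min (4 / d) (2 + 2 * T / d - T) = 2 * m" by (simp add: m_def)
    moreover have "2 + q * (2 / d - 1) = 2 + 2 * q / d - q" by (simp add: algebra_simps)
    ultimately show ?thesis using m by linarith
  qed
  have "(\<integral>\<^sup>+x. ennreal (norm (f x) powr (min T (2 + real n * m))) \<partial>lebesgue) < \<infinity>" for n
  proof (induction n)
    case 0
    then show ?case using f2 T(1) by (simp add: min_def)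
  next
    case (Suc n)
    let ?q = "min T (2 + real n * m)"
    have q: "2 \<le> ?q" "?q \<le> T" using T m by auto
    have eq: "min T (2 + real (Suc n) * m) = min T (?q + m)"
      using m by (auto simp: min_def algebra_simps)
    show ?case unfolding eq
    proof (rule Sobolev_improvement[OF f f2 P, where q="?q"])
      show "1 \<le> ?q" using q by linarith
      show "(\<integral>\<^sup>+x. ennreal (norm (f x) powr ?q) \<partial>lebesgue) < \<infinity>" by (rule Suc)
      show "2 \<le> min T (?q + m)" by (intro min.boundedI) (use T q m in linarith)+
      show "min T (?q + m) < 2 + 2 * ?q / CARD('n)" using m'[OF q] by (simp add: d_def)
    qed
  qed
  moreover obtain n where "T < real n * m" using reals_Archimedean3[OF m] by blast
  then have "min T (2 + real n * m) = T" by simp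
  ultimately show ?thesis by metis
qed

subsection \<open>Compactness and completeness in square mean\<close>

text \<open>Tychonoff's theorem takes the place of the diagonal argument. As the index type is
  countable, the product is first countable, so its compact sets are sequentially compact.\<close>

lemma diagonal_convergent_subsequence:
  fixes a :: "nat \<Rightarrow> 'i::countable \<Rightarrow> complex"
  assumes "\<And>n i. norm (a n i) \<le> B i"
  obtains r where "strict_mono (r :: nat \<Rightarrow> nat)" "\<And>i. convergent (\<lambda>n. a (r n) i)"
proof -
  have "compactin (product_topology (\<lambda>i. euclidean) UNIV) (PiE UNIV (\<lambda>i. cball (0::complex) (B i)))"
    by (simp add: compactin_PiE)
  then have "compact (PiE UNIV (\<lambda>i. cball (0::complex) (B i)))"
    by (simp add: euclidean_product_topology)
  moreover have "a n \<in> PiE UNIV (\<lambda>i. cball (0::complex) (B i))" for n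
    using assms by (auto simp: PiE_UNIV_domain)
  ultimately obtain l r where r: "strict_mono (r :: nat \<Rightarrow> nat)" "(a \<circ> r) \<longlonglongrightarrow> l"
    by (meson compact_imp_seq_compact seq_compactE)
  have "convergent (\<lambda>n. a (r n) i)" for i
  proof -
    have "continuous_on UNIV (\<lambda>f :: 'i \<Rightarrow> complex. f i)" by (rule continuous_on_product_coordinates)
    from continuous_on_tendsto_compose[OF this r(2)] have "(\<lambda>n. (a \<circ> r) n i) \<longlonglongrightarrow> l i"
      by simp
    then show ?thesis by (auto simp: convergent_def)
  qed
  then show ?thesis using r(1) that by blast
qed

text \<open>With values in \<open>ennreal\<close> the squared distance makes sense before
  integrability of the limit is known, and Fatou's lemma applies to it directly.\<close>

definition L2_dist2 ::
    "(real^'n::finite \<Rightarrow> 'b::real_normed_vector) \<Rightarrow> (real^'n \<Rightarrow> 'b) \<Rightarrow> ennreal" where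
  "L2_dist2 f g = nn_L2 lebesgue (\<lambda>x. f x - g x)"

definition L2_Cauchy :: "(nat \<Rightarrow> real^'n::finite \<Rightarrow> 'b::real_normed_vector) \<Rightarrow> bool" where
  "L2_Cauchy F \<longleftrightarrow> (\<forall>\<eta>>0. \<exists>N. \<forall>m\<ge>N. \<forall>n\<ge>N. L2_dist2 (F m) (F n) \<le> ennreal \<eta>)"

lemma nn_integral_Fatou_le:
  fixes u :: "nat \<Rightarrow> 'a \<Rightarrow> ennreal"
  assumes "\<And>n. u n \<in> borel_measurable M" and "AE x in M. (\<lambda>n. u n x) \<longlonglongrightarrow> v x"
    and "\<And>n. (\<integral>\<^sup>+x. u n x \<partial>M) \<le> B"
  shows "(\<integral>\<^sup>+x. v x \<partial>M) \<le> B"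
proof -
  have "(\<integral>\<^sup>+x. v x \<partial>M) = (\<integral>\<^sup>+x. liminf (\<lambda>n. u n x) \<partial>M)"
    using assms(2) by (intro nn_integral_cong_AE, eventually_elim) (simp add: lim_imp_Liminf)
  also have "\<dots> \<le> liminf (\<lambda>n. \<integral>\<^sup>+x. u n x \<partial>M)" by (rule nn_integral_liminf[OF assms(1)])
  also have "\<dots> \<le> liminf (\<lambda>n. B)" by (intro Liminf_mono always_eventually allI assms(3))
  finally show ?thesis by (simp add: Liminf_const)
qed

lemma L2_complete:
  fixes F :: "nat \<Rightarrow> real^'n::finite \<Rightarrow> 'b::{banach, second_countable_topology}"
  assumes F: "\<And>n. square_integrable (F n)" and C: "L2_Cauchy F"
  obtains f r where "strict_mono (r :: nat \<Rightarrow> nat)" "square_integrable f"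
    "AE x in lebesgue. (\<lambda>n. F (r n) x) \<longlonglongrightarrow> f x" "(\<lambda>n. L2_dist2 (F n) f) \<longlonglongrightarrow> 0"
proof -
  have Fm [measurable]: "F n \<in> borel_measurable lebesgue" for n
    using F by (simp add: square_integrable_def)
  have "\<forall>k. \<exists>N. \<forall>m\<ge>N. \<forall>n\<ge>N. L2_dist2 (F m) (F n) \<le> ennreal ((1/4) ^ k)"
    using C by (auto simp: L2_Cauchy_def)
  then obtain N where N: "\<And>k m n. m \<ge> N k \<Longrightarrow> n \<ge> N k \<Longrightarrow> L2_dist2 (F m) (F n) \<le> ennreal ((1/4) ^ k)"
    by metis
  \<comment> \<open>Summing the \<open>N j\<close> ensures \<open>N k \<le> r k\<close>, and the
    summand \<open>k\<close> makes \<open>r\<close> strictly increasing.\<close>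
  define r where "r k = (\<Sum>j\<le>k. N j) + k" for k
  have rS: "r (Suc k) = r k + N (Suc k) + 1" for k by (simp add: r_def)
  have r: "strict_mono r" by (rule strict_mono_Suc_iff[THEN iffD2]) (simp add: rS)
  have rN: "N k \<le> r k" for k using member_le_sum[of k "{..k}" N] by (simp add: r_def)
  define d where "d k x = F (r (Suc k)) x - F (r k) x" for k x
  have dk: "nn_L2 lebesgue (d k) \<le> ennreal ((1/4) ^ k)" for k
    using N[of k "r (Suc k)" "r k"] rN[of k] rS[of k] by (simp add: L2_dist2_def d_def)
  \<comment> \<open>The increments have squared norms of at most \<open>(1/4) ^ k\<close>, so the
    weights \<open>2 ^ k\<close> leave a convergent series. Wherever the weighted sum is finite,
    \<open>norm (d k x)\<close> is at most a constant times \<open>sqrt (1/2) ^ k\<close>, and the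
    telescoping series converges.\<close>
  have "(\<integral>\<^sup>+x. (\<Sum>k. ennreal (2 ^ k) * ennreal ((norm (d k x))^2)) \<partial>lebesgue)
     = (\<Sum>k. ennreal (2 ^ k) * nn_L2 lebesgue (d k))"
    unfolding d_def by (subst nn_integral_suminf) (auto simp: nn_integral_cmult)
  also have "\<dots> \<le> (\<Sum>k. ennreal ((1/2) ^ k))"
  proof (intro suminf_le summableI)
    fix k
    have "ennreal (2 ^ k) * nn_L2 lebesgue (d k) \<le> ennreal (2 ^ k) * ennreal ((1/4) ^ k)"
      by (intro mult_left_mono dk) auto
    also have "\<dots> = ennreal ((1/2) ^ k)"
      by (subst ennreal_mult[symmetric]) (auto simp: power_mult_distrib[symmetric])
    finally show "ennreal (2 ^ k) * nn_L2 lebesgue (d k) \<le> ennreal ((1/2) ^ k)" .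
  qed
  also have "\<dots> < \<infinity>" unfolding infinity_ennreal_def less_top[symmetric]
    by (intro ennreal_suminf_neq_top) auto
  finally have fin: "(\<integral>\<^sup>+x. (\<Sum>k. ennreal (2 ^ k) * ennreal ((norm (d k x))^2)) \<partial>lebesgue) \<noteq> \<infinity>"
    by simp
  have "(\<lambda>x. \<Sum>k. ennreal (2 ^ k) * ennreal ((norm (d k x))^2)) \<in> borel_measurable lebesgue"
    unfolding d_def by measurable
  from nn_integral_PInf_AE[OF this fin]
  have "AE x in lebesgue. (\<Sum>k. ennreal (2 ^ k) * ennreal ((norm (d k x))^2)) \<noteq> \<infinity>" .
  then have conv: "AE x in lebesgue. convergent (\<lambda>k. F (r k) x)"
  proof eventually_elim
    case (elim x)
    define S where "S = enn2real (\<Sum>k. ennreal (2 ^ k) * ennreal ((norm (d k x))^2))"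
    have S: "(\<Sum>k. ennreal (2 ^ k) * ennreal ((norm (d k x))^2)) = ennreal S"
      using elim by (simp add: S_def less_top)
    have bd: "norm (d k x) \<le> sqrt S * (sqrt (1/2)) ^ k" for k
    proof -
      have "ennreal (2 ^ k) * ennreal ((norm (d k x))^2) \<le> ennreal S"
        using sum_le_suminf[of "\<lambda>k. ennreal (2 ^ k) * ennreal ((norm (d k x))^2)" "{k}"] S by simp
      then have "2 ^ k * (norm (d k x))^2 \<le> S"
        by (subst (asm) ennreal_mult[symmetric]) (auto simp: S_def)
      then have "(norm (d k x))^2 \<le> S * (1/2) ^ k"
        by (simp add: field_simps power_divide)
      then have "sqrt ((norm (d k x))^2) \<le> sqrt (S * (1/2) ^ k)" by (rule real_sqrt_le_mono)
      then show ?thesis by (simp add: real_sqrt_mult real_sqrt_power)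
    qed
    have sm: "summable (\<lambda>k. sqrt S * (sqrt (1/2)) ^ k)"
      by (intro summable_mult summable_geometric) (simp add: real_sqrt_divide)
    have "summable (\<lambda>k. d k x)"
      by (rule summable_comparison_test'[OF sm, of 0]) (rule bd)
    then have "convergent (\<lambda>n. \<Sum>k<n. d k x)" by (simp add: summable_iff_convergent)
    then have "convergent (\<lambda>n. F (r n) x - F (r 0) x)"
      unfolding d_def by (simp add: sum_lessThan_telescope[of "\<lambda>k. F (r k) x"])
    then have "convergent (\<lambda>n. (F (r n) x - F (r 0) x) + F (r 0) x)"
      by (intro convergent_add convergent_const)
    then show ?case by simp
  qed
  define f where "f x = lim (\<lambda>k. F (r k) x)" for x
  have fm [measurable]: "f \<in> borel_measurable lebesgue"
    unfolding f_def by measurable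
  have lim: "AE x in lebesgue. (\<lambda>n. F (r n) x) \<longlonglongrightarrow> f x"
    using conv by eventually_elim (simp add: f_def convergent_LIMSEQ_iff)
  have dist: "\<exists>N. \<forall>n\<ge>N. L2_dist2 (F n) f \<le> ennreal \<eta>" if "\<eta> > 0" for \<eta>
  proof -
    obtain N where N: "\<And>m n. m \<ge> N \<Longrightarrow> n \<ge> N \<Longrightarrow> L2_dist2 (F m) (F n) \<le> ennreal \<eta>"
      using C \<open>\<eta> > 0\<close> unfolding L2_Cauchy_def by blast
    have rN: "N \<le> r (k + N)" for k using strict_mono_imp_increasing[OF r, of "k + N"] by linarith
    \<comment> \<open>Fatou's lemma lets one index of the Cauchy bound go to infinity along the
      subsequence.\<close>
    have "L2_dist2 (F n) f \<le> ennreal \<eta>" if n: "n \<ge> N" for n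
      unfolding L2_dist2_def
    proof (rule nn_integral_Fatou_le[where u="\<lambda>k x. ennreal ((norm (F n x - F (r (k + N)) x))^2)"])
      show "AE x in lebesgue. (\<lambda>k. ennreal ((norm (F n x - F (r (k + N)) x))^2)) \<longlonglongrightarrow> ennreal ((norm (F n x - f x))^2)"
        using lim by eventually_elim (intro tendsto_intros; rule LIMSEQ_ignore_initial_segment)
      show "nn_L2 lebesgue (\<lambda>x. F n x - F (r (k + N)) x) \<le> ennreal \<eta>" for k
        using N[OF n rN, of k] by (simp add: L2_dist2_def)
    qed measurable
    then show ?thesis by blast
  qed
  have to0: "(\<lambda>n. L2_dist2 (F n) f) \<longlonglongrightarrow> 0"
  proof (rule order_tendstoI)
    fix a :: ennreal assume "0 < a"
    then obtain \<eta> where "\<eta> > 0" "ennreal \<eta> < a"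
      by (metis dense ennreal_cases ennreal_less_zero_iff infinity_ennreal_def less_top_ennreal not_less_iff_gr_or_eq order_less_trans top.extremum_strict)
    moreover obtain N where "\<forall>n\<ge>N. L2_dist2 (F n) f \<le> ennreal \<eta>" using dist[OF \<open>\<eta> > 0\<close>] by blast
    ultimately show "\<forall>\<^sub>F n in sequentially. L2_dist2 (F n) f < a"
      by (intro eventually_sequentiallyI[of N]) (auto intro: le_less_trans)
  qed auto
  have "square_integrable f"
  proof -
    obtain N where N: "\<forall>n\<ge>N. L2_dist2 (F n) f \<le> ennreal 1" using dist[of 1] by auto
    have i: "integrable lebesgue (\<lambda>x. (norm (F N x - f x))^2)"
      using N by (auto simp: integrable_iff_bounded L2_dist2_def intro: le_less_trans)
    have "integrable lebesgue (\<lambda>x. (norm (f x))^2)"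
    proof (rule Bochner_Integration.integrable_bound)
      show "integrable lebesgue (\<lambda>x. 2 * (norm (F N x - f x))^2 + 2 * (norm (F N x))^2)"
        using i F[of N] by (auto simp: square_integrable_def)
      have "(norm b)^2 \<le> 2 * (norm (a - b))^2 + 2 * (norm a)^2" for a b :: 'b
        using norm_add_square_le[of "b - a" a] by (simp add: norm_minus_commute)
      then show "AE x in lebesgue. norm ((norm (f x))^2) \<le> norm (2 * (norm (F N x - f x))^2 + 2 * (norm (F N x))^2)"
        by (intro AE_I2) simp
    qed measurable
    then show ?thesis using fm by (simp add: square_integrable_def)
  qed
  with that r lim to0 show ?thesis by blast
qed

text \<open>A criterion of Kolmogorov-Riesz type, with the uniform bound on deviations from cell
  averages in the role of equicontinuity in the mean. The subsequence must not depend on the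
  accuracy \<open>\<eta>\<close>, so it is extracted for the countably many cells of all meshes
  \<open>\<epsilon> k\<close> at once.\<close>

lemma L2_compactness:
  fixes F :: "nat \<Rightarrow> real^'n::finite \<Rightarrow> complex"
  assumes F: "\<And>n. square_integrable (F n)"
    and M: "\<And>n. nn_L2 lebesgue (F n) \<le> ennreal M" "M \<ge> 0"
    and P: "\<And>n \<epsilon>. \<epsilon> > 0 \<Longrightarrow>
      (nn_L2 lebesgue (\<lambda>x. F n x - cell_avg \<epsilon> (F n) x)) \<le> ennreal (C * \<epsilon>^2)" "C \<ge> 0"
    and tight: "\<And>\<eta>. \<eta> > 0 \<Longrightarrow>
      \<exists>R. \<forall>n. (\<integral>\<^sup>+x. indicator (- cball 0 R) x * ennreal ((norm (F n x))^2) \<partial>lebesgue) \<le> ennreal \<eta>"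
  obtains r where "strict_mono (r :: nat \<Rightarrow> nat)" "L2_Cauchy (\<lambda>n. F (r n))"
proof -
  have Fm [measurable]: "F n \<in> borel_measurable lebesgue" for n
    using F by (simp add: square_integrable_def)
  define \<epsilon> where "\<epsilon> k = 1 / (real k + 1)" for k
  have e: "\<epsilon> k > 0" for k by (simp add: \<epsilon>_def)
  define b where "b k = 1 + M / \<epsilon> k ^ CARD('n)" for k
  have avg_b: "norm (cell_avg (\<epsilon> k) (F n) x) \<le> b k" for k n x
  proof -
    have "norm z \<le> 1 + 1 * norm z powr 2" for z :: complex
      using norm_le_one_plus_square[of z] by simp
    then have "norm (cell_avg (\<epsilon> k) (F n) x) \<le> 1 + 1 * M / \<epsilon> k ^ CARD('n)"
      using M by (intro norm_cell_avg_le[where q=2] e Fm) auto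
    then show ?thesis by (simp add: b_def)
  qed
  define p where "p k c = (\<chi> i. \<epsilon> k * of_int (c i) :: real^'n)" for k and c :: "'n \<Rightarrow> int"
  obtain r where r: "strict_mono (r :: nat \<Rightarrow> nat)"
    and "\<And>i. convergent (\<lambda>n. cell_avg (\<epsilon> (fst i)) (F (r n)) (p (fst i) (snd i)))"
    using diagonal_convergent_subsequence[of "\<lambda>n i. cell_avg (\<epsilon> (fst i)) (F n) (p (fst i) (snd i))" "\<lambda>i. b (fst i)"] avg_b
    by metis
  then have conv_p: "convergent (\<lambda>n. cell_avg (\<epsilon> k) (F (r n)) (p k c))" for k c
    by (metis fst_conv snd_conv)
  have conv: "convergent (\<lambda>n. cell_avg (\<epsilon> k) (F (r n)) x)" for k x
  proof -
    \<comment> \<open>The average depends on \<open>x\<close> only through the lower corner of its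
      cell, so convergence at the countably many corners is convergence everywhere.\<close>
    have "cell (\<epsilon> k) x = cell (\<epsilon> k) (p k (\<lambda>i. \<lfloor>x $ i / \<epsilon> k\<rfloor>))"
      using e[of k] by (simp add: cell_def p_def)
    then have "cell_avg (\<epsilon> k) (F (r n)) x = cell_avg (\<epsilon> k) (F (r n)) (p k (\<lambda>i. \<lfloor>x $ i / \<epsilon> k\<rfloor>))" for n
      by (simp add: cell_avg_def)
    then show ?thesis using conv_p by simp
  qed
  have "L2_Cauchy (\<lambda>n. F (r n))"
    unfolding L2_Cauchy_def
  proof (intro allI impI)
    fix \<eta> :: real assume \<eta>: "\<eta> > 0"
    obtain R where R: "\<And>n. (\<integral>\<^sup>+x. indicator (- cball 0 R) x * ennreal ((norm (F n x))^2) \<partial>lebesgue) \<le> ennreal (\<eta> / 32)"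
      using tight[of "\<eta> / 32"] \<eta> by auto
    obtain k :: nat where k: "32 * C / \<eta> < real k" using reals_Archimedean2 by blast
    have Ck: "C * (\<epsilon> k)^2 \<le> \<eta> / 32"
    proof -
      have "(\<epsilon> k)^2 \<le> \<epsilon> k"
      proof -
        have "\<epsilon> k \<le> 1" by (simp add: \<epsilon>_def)
        then show ?thesis using e[of k] by (simp add: power2_eq_square mult_left_le)
      qed
      then have "C * (\<epsilon> k)^2 \<le> C * \<epsilon> k" using P(2) by (rule mult_left_mono)
      also have "\<dots> \<le> \<eta> / 32" using k \<eta> by (simp add: \<epsilon>_def field_simps)
      finally show ?thesis .
    qed
    define G where "G n x = cell_avg (\<epsilon> k) (F (r n)) x" for n x
    have Gm [measurable]: "G n \<in> borel_measurable lebesgue" for n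
      unfolding G_def by (rule cell_avg_measurable_lebesgue[OF Fm])
    define L where "L x = lim (\<lambda>n. G n x)" for x
    have Lm [measurable]: "L \<in> borel_measurable lebesgue" unfolding L_def by measurable
    have lim: "(\<lambda>n. G n x) \<longlonglongrightarrow> L x" for x
      using conv[of k x] unfolding L_def G_def by (simp add: convergent_LIMSEQ_iff)
    have Lb: "norm (L x) \<le> b k" for x
      by (rule LIMSEQ_le_const2[OF tendsto_norm[OF lim]]) (simp add: G_def avg_b)
    have cb [measurable]: "cball (0::real^'n) R \<in> sets lebesgue" "- cball (0::real^'n) R \<in> sets lebesgue" by auto
    define l where "l n = (\<integral>\<^sup>+x. indicator (cball 0 R) x * ennreal ((norm (G n x - L x))^2) \<partial>lebesgue)" for n
    have "l \<longlonglongrightarrow> (\<integral>\<^sup>+x. (0::ennreal) \<partial>(lebesgue :: (real^'n) measure))"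
      unfolding l_def
    proof (rule nn_integral_dominated_convergence)
      show "(\<integral>\<^sup>+x. ennreal ((2 * b k)^2) * indicator (cball (0::real^'n) R) x \<partial>lebesgue) < \<infinity>"
        using lmeasurable_compact[OF compact_cball, of "0::real^'n" R]
        by (subst nn_integral_cmult_indicator) (auto simp: ennreal_mult_less_top fmeasurable_def)
      show "AE x in lebesgue. indicator (cball 0 R) x * ennreal ((norm (G n x - L x))^2)
         \<le> ennreal ((2 * b k)^2) * indicator (cball 0 R) x" for n
      proof (rule AE_I2)
        fix x
        have "norm (G n x - L x) \<le> 2 * b k"
          using norm_triangle_ineq4[of "G n x" "L x"] Lb[of x] avg_b[of k "r n" x] unfolding G_def by linarith
        then have "(norm (G n x - L x))^2 \<le> (2 * b k)^2" by (intro power_mono) auto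
        then show "indicator (cball 0 R) x * ennreal ((norm (G n x - L x))^2)
         \<le> ennreal ((2 * b k)^2) * indicator (cball 0 R) x"
          by (auto simp: indicator_def intro: ennreal_leI)
      qed
      show "AE x in lebesgue. (\<lambda>n. indicator (cball 0 R) x * ennreal ((norm (G n x - L x))^2)) \<longlonglongrightarrow> 0"
      proof (rule AE_I2)
        fix x
        have "(\<lambda>n. ennreal ((norm (G n x - L x))^2)) \<longlonglongrightarrow> ennreal ((norm (L x - L x))^2)"
          by (intro tendsto_intros lim)
        then show "(\<lambda>n. indicator (cball 0 R) x * ennreal ((norm (G n x - L x))^2)) \<longlonglongrightarrow> 0"
          by (auto simp: indicator_def)
      qed
    qed measurable
    then have "l \<longlonglongrightarrow> 0" by simp
    then have "\<forall>\<^sub>F n in sequentially. l n < ennreal (\<eta> / 32)"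
      using \<eta> by (intro order_tendstoD(2)) auto
    then obtain N where N: "\<And>n. n \<ge> N \<Longrightarrow> l n \<le> ennreal (\<eta> / 32)"
      unfolding eventually_sequentially by (meson less_imp_le)
    define t where "t n = (\<integral>\<^sup>+x. indicator (- cball 0 R) x * ennreal ((norm (F (r n) x))^2) \<partial>lebesgue)" for n
    define q where "q n = nn_L2 lebesgue (\<lambda>x. F (r n) x - G n x)" for n
    \<comment> \<open>On the ball the difference of two members passes through both averages and
      their common limit, four terms in all, whence the coefficients \<open>4\<close>; outside the
      ball it is split in two, whence the \<open>2\<close>. With \<open>t n\<close>,
      \<open>q n\<close> and \<open>l n\<close> at most \<open>\<eta> / 32\<close> each,
      \<open>E n\<close> has integral at most \<open>10 * (\<eta> / 32)\<close>, which is below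
      \<open>\<eta> / 2\<close>.\<close>
    define E where "E n x = 2 * (indicator (- cball 0 R) x * ennreal ((norm (F (r n) x))^2))
       + (4 * ennreal ((norm (F (r n) x - G n x))^2)
       + 4 * (indicator (cball 0 R) x * ennreal ((norm (G n x - L x))^2)))" for n x
    have Em [measurable]: "E n \<in> borel_measurable lebesgue" for n unfolding E_def by measurable
    have intE: "(\<integral>\<^sup>+x. E n x \<partial>lebesgue) = 2 * t n + (4 * q n + 4 * l n)" for n
      unfolding E_def t_def q_def l_def
      by (subst nn_integral_add, measurable)+ (simp add: nn_integral_cmult)
    have E_le: "(\<integral>\<^sup>+x. E n x \<partial>lebesgue) \<le> ennreal (\<eta> / 2)" if "n \<ge> N" for n
    proof -
      have "t n \<le> ennreal (\<eta> / 32)" unfolding t_def by (rule R)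
      moreover have "q n \<le> ennreal (\<eta> / 32)"
        unfolding q_def G_def by (rule order_trans[OF P(1)[OF e] ennreal_leI[OF Ck]])
      ultimately have "(\<integral>\<^sup>+x. E n x \<partial>lebesgue) \<le> 2 * ennreal (\<eta> / 32) + (4 * ennreal (\<eta> / 32) + 4 * ennreal (\<eta> / 32))"
        unfolding intE using N[OF that] by (intro add_mono mult_left_mono) auto
      also have "\<dots> = (2 + (4 + 4)) * ennreal (\<eta> / 32)"
        by (simp only: distrib_right)
      also have "\<dots> = ennreal (10 * (\<eta> / 32))"
        by (subst ennreal_mult) (use \<eta> in auto)
      also have "\<dots> \<le> ennreal (\<eta> / 2)" using \<eta> by (intro ennreal_leI) simp
      finally show ?thesis .
    qed
    have pw: "ennreal ((norm (F (r m) x - F (r n) x))^2) \<le> E m x + E n x" for m n x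
    proof (cases "x \<in> cball 0 R")
      case True
      define a1 a2 a3 a4 where "a1 = norm (F (r m) x - G m x)" and "a2 = norm (G m x - L x)"
        and "a3 = norm (G n x - L x)" and "a4 = norm (F (r n) x - G n x)"
      have "norm (F (r m) x - F (r n) x) = norm ((F (r m) x - G m x) + (G m x - L x) + (- (G n x - L x)) + (- (F (r n) x - G n x)))"
        by simp
      also have "\<dots> \<le> a1 + a2 + a3 + a4"
        unfolding a1_def a2_def a3_def a4_def
        by (intro norm_triangle_le add_mono) (auto simp: norm_minus_commute)
      finally have "(norm (F (r m) x - F (r n) x))^2 \<le> (a1 + a2 + a3 + a4)^2"
        by (intro power_mono) auto
      also have "\<dots> \<le> (4 * a1^2 + 4 * a2^2) + (4 * a4^2 + 4 * a3^2)"
        using sum_squares_bound[of a1 a2] sum_squares_bound[of a1 a3] sum_squares_bound[of a1 a4]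
          sum_squares_bound[of a2 a3] sum_squares_bound[of a2 a4] sum_squares_bound[of a3 a4]
        by (simp add: power2_eq_square algebra_simps)
      finally have "ennreal ((norm (F (r m) x - F (r n) x))^2) \<le> ennreal ((4 * a1^2 + 4 * a2^2) + (4 * a4^2 + 4 * a3^2))"
        by (rule ennreal_leI)
      then show ?thesis using True
        by (simp add: E_def a1_def a2_def a3_def a4_def ennreal_plus ennreal_mult)
    next
      case False
      have "(norm (F (r m) x - F (r n) x))^2 \<le> 2 * (norm (F (r m) x))^2 + 2 * (norm (F (r n) x))^2"
        using norm_add_square_le[of "F (r m) x" "- F (r n) x"] by simp
      then have "ennreal ((norm (F (r m) x - F (r n) x))^2)
        \<le> ennreal (2 * (norm (F (r m) x))^2 + 2 * (norm (F (r n) x))^2)" by (rule ennreal_leI)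
      also have "\<dots> = 2 * ennreal ((norm (F (r m) x))^2) + 2 * ennreal ((norm (F (r n) x))^2)"
        by (simp add: ennreal_plus ennreal_mult)
      also have "\<dots> \<le> E m x + E n x"
        using False unfolding E_def by (intro add_mono add_increasing2) auto
      finally show ?thesis .
    qed
    have "L2_dist2 (F (r m)) (F (r n)) \<le> ennreal \<eta>" if "m \<ge> N" "n \<ge> N" for m n
    proof -
      have "L2_dist2 (F (r m)) (F (r n)) \<le> (\<integral>\<^sup>+x. E m x + E n x \<partial>lebesgue)"
        unfolding L2_dist2_def by (intro nn_integral_mono pw)
      also have "\<dots> = (\<integral>\<^sup>+x. E m x \<partial>lebesgue) + (\<integral>\<^sup>+x. E n x \<partial>lebesgue)"
        by (rule nn_integral_add) measurable
      also have "\<dots> \<le> ennreal (\<eta> / 2) + ennreal (\<eta> / 2)"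
        by (intro add_mono E_le that)
      also have "\<dots> = ennreal \<eta>" using \<eta> by (simp flip: ennreal_plus)
      finally show ?thesis .
    qed
    then show "\<exists>N. \<forall>m\<ge>N. \<forall>n\<ge>N. L2_dist2 (F (r m)) (F (r n)) \<le> ennreal \<eta>" by blast
  qed
  with r that show ?thesis by blast
qed

subsection \<open>The action functional\<close>

text \<open>Completeness of Lebesgue measure. It yields measurability of functions known only almost
  everywhere, such as chosen weak derivatives and densities containing \<open>V\<close>.\<close>

lemma lebesgue_measurable_cong_AE:
  fixes f g :: "'a::euclidean_space \<Rightarrow> 'b::topological_space"
  assumes f: "f \<in> borel_measurable lebesgue" and ae: "AE x in lebesgue. f x = g x"
  shows "g \<in> borel_measurable lebesgue"
proof (rule measurableI)
  fix B :: "'b set" assume B: "B \<in> sets borel"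
  have "AE x in lebesgue. x \<in> f -` B \<longleftrightarrow> x \<in> g -` B" using ae by eventually_elim auto
  moreover have "f -` B \<in> sets lebesgue" using measurable_sets[OF f B] by simp
  ultimately have "g -` B \<in> sets lebesgue" by (rule completion.in_sets_AE) simp
  then show "g -` B \<inter> space lebesgue \<in> sets lebesgue" by simp
qed simp

lemma Lp_space_2_iff: "f \<in> Lp_space 2 \<longleftrightarrow> square_integrable f"
  by (simp add: Lp_space_def square_integrable_def)

lemma square_integrable_cong_AE:
  fixes f g :: "real^'n::finite \<Rightarrow> complex"
  assumes "square_integrable f" "AE x in lebesgue. f x = g x"
  shows "square_integrable g"
proof -
  have g: "g \<in> borel_measurable lebesgue"
    using assms lebesgue_measurable_cong_AE by (auto simp: square_integrable_def)
  have "integrable lebesgue (\<lambda>x. (norm (f x))^2)" using assms by (simp add: square_integrable_def)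
  then have "integrable lebesgue (\<lambda>x. (norm (g x))^2)"
    by (rule integrable_cong_AE_imp) (use g assms(2) in auto)
  with g show ?thesis by (simp add: square_integrable_def)
qed

lemma square_integrable_lincomb:
  fixes f g :: "real^'n::finite \<Rightarrow> complex"
  assumes "square_integrable f" "square_integrable g"
  shows "square_integrable (\<lambda>x. a * f x + b * g x)"
proof -
  have [measurable]: "f \<in> borel_measurable lebesgue" "g \<in> borel_measurable lebesgue"
    using assms by (auto simp: square_integrable_def)
  have "integrable lebesgue (\<lambda>x. (norm (a * f x + b * g x))^2)"
  proof (rule Bochner_Integration.integrable_bound)
    show "integrable lebesgue (\<lambda>x. 2 * (norm a)^2 * (norm (f x))^2 + 2 * (norm b)^2 * (norm (g x))^2)"
      using assms by (auto simp: square_integrable_def)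
    show "AE x in lebesgue. norm ((norm (a * f x + b * g x))^2)
      \<le> norm (2 * (norm a)^2 * (norm (f x))^2 + 2 * (norm b)^2 * (norm (g x))^2)"
    proof (rule AE_I2)
      show "norm ((norm (a * f x + b * g x))^2)
        \<le> norm (2 * (norm a)^2 * (norm (f x))^2 + 2 * (norm b)^2 * (norm (g x))^2)" for x
        using norm_add_square_le[of "a * f x" "b * g x"] by (simp add: norm_mult power_mult_distrib mult.assoc)
    qed
  qed measurable
  then show ?thesis by (simp add: square_integrable_def)
qed

lemma H1_D:
  fixes \<phi> :: "real^'n::finite \<Rightarrow> complex"
  assumes "\<phi> \<in> H1_space"
  shows "square_integrable \<phi>" "has_weak_partial i \<phi> (weak_partial i \<phi>)" "square_integrable (weak_partial i \<phi>)"
proof -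
  show "square_integrable \<phi>" using assms by (simp add: H1_space_def Lp_space_2_iff)
  obtain g where g: "square_integrable g" "has_weak_partial i \<phi> g"
    using assms unfolding H1_space_def Lp_space_2_iff[symmetric] by blast
  show w: "has_weak_partial i \<phi> (weak_partial i \<phi>)" by (rule has_weak_partial_weak_partial[OF g(2)])
  show "square_integrable (weak_partial i \<phi>)"
    by (rule square_integrable_cong_AE[OF g(1) has_weak_partial_unique[OF g(2) w]])
qed

lemma H1_I:
  fixes \<phi> :: "real^'n::finite \<Rightarrow> complex"
  assumes "square_integrable \<phi>" "\<And>i. has_weak_partial i \<phi> (g i)" "\<And>i. square_integrable (g i)"
  shows "\<phi> \<in> H1_space" "AE x in lebesgue. weak_partial i \<phi> x = g i x"
proof -
  show H1: "\<phi> \<in> H1_space" using assms unfolding H1_space_def Lp_space_2_iff[symmetric] by blast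
  show "AE x in lebesgue. weak_partial i \<phi> x = g i x"
    by (rule has_weak_partial_unique[OF H1_D(2)[OF H1] assms(2)])
qed

lemma Lp_norm_2_square: "(Lp_norm 2 f)^2 = sq_int lebesgue f"
proof -
  have "(\<integral>x. norm (f x) powr 2 \<partial>lebesgue) = sq_int lebesgue f"
    by (intro Bochner_Integration.integral_cong) auto
  moreover have "sq_int lebesgue f \<ge> 0" by simp
  ultimately show ?thesis
    unfolding Lp_norm_def by (simp add: powr_half_sqrt)
qed

lemma Lp_norm_powr: "q > 0 \<Longrightarrow> Lp_norm q f powr q = (\<integral>x. norm (f x) powr q \<partial>lebesgue)"
  unfolding Lp_norm_def by (simp add: powr_powr)

lemma norm_weak_gradient_square: "(norm (weak_gradient f x))^2 = (\<Sum>i\<in>UNIV. (norm (weak_partial i f x))^2)"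
  by (simp add: weak_gradient_def norm_vec_def L2_set_def sum_nonneg)

text \<open>\<open>V\<close> is not assumed to be measurable, but measurability of \<open>V x * (norm (f x))^2\<close> makes it
  measurable where \<open>f\<close> does not vanish.\<close>
lemma integrable_potential_lincomb:
  fixes f g :: "real^'n::finite \<Rightarrow> complex"
  assumes V0: "\<And>x. V x \<ge> 0"
    and [measurable]: "f \<in> borel_measurable lebesgue" "g \<in> borel_measurable lebesgue"
    and f: "integrable lebesgue (\<lambda>x. V x * (norm (f x))^2)" and g: "integrable lebesgue (\<lambda>x. V x * (norm (g x))^2)"
  shows "integrable lebesgue (\<lambda>x. V x * (norm (a * f x + b * g x))^2)"
proof (rule Bochner_Integration.integrable_bound)
  show "integrable lebesgue (\<lambda>x. 2 * (norm a)^2 * (V x * (norm (f x))^2) + 2 * (norm b)^2 * (V x * (norm (g x))^2))"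
    using f g by auto
  have [measurable]: "(\<lambda>x. V x * (norm (f x))^2) \<in> borel_measurable lebesgue"
     "(\<lambda>x. V x * (norm (g x))^2) \<in> borel_measurable lebesgue"
    using f g by (auto intro: borel_measurable_integrable)
  have "(\<lambda>x. (if f x \<noteq> 0 then V x * (norm (f x))^2 / (norm (f x))^2 else V x * (norm (g x))^2 / (norm (g x))^2)
      * (norm (a * f x + b * g x))^2) \<in> borel_measurable lebesgue"
    by measurable
  also have "(\<lambda>x. (if f x \<noteq> 0 then V x * (norm (f x))^2 / (norm (f x))^2 else V x * (norm (g x))^2 / (norm (g x))^2)
      * (norm (a * f x + b * g x))^2) = (\<lambda>x. V x * (norm (a * f x + b * g x))^2)"
    by (auto simp: fun_eq_iff)
  finally show "(\<lambda>x. V x * (norm (a * f x + b * g x))^2) \<in> borel_measurable lebesgue" .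
  show "AE x in lebesgue. norm (V x * (norm (a * f x + b * g x))^2)
      \<le> norm (2 * (norm a)^2 * (V x * (norm (f x))^2) + 2 * (norm b)^2 * (V x * (norm (g x))^2))"
  proof (rule AE_I2)
    fix x
    have "V x * (norm (a * f x + b * g x))^2 \<le> V x * (2 * (norm (a * f x))^2 + 2 * (norm (b * g x))^2)"
      by (rule mult_left_mono[OF norm_add_square_le V0])
    then show "norm (V x * (norm (a * f x + b * g x))^2)
      \<le> norm (2 * (norm a)^2 * (V x * (norm (f x))^2) + 2 * (norm b)^2 * (V x * (norm (g x))^2))"
      using V0[of x] by (simp add: norm_mult power_mult_distrib algebra_simps)
  qed
qed

lemma X_space_lincomb:
  fixes \<phi> \<psi> :: "real^'n::finite \<Rightarrow> complex"
  assumes V0: "\<And>x. V x \<ge> 0" and \<phi>: "\<phi> \<in> X_space V" and \<psi>: "\<psi> \<in> X_space V"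
  shows "(\<lambda>x. a * \<phi> x + b * \<psi> x) \<in> X_space V"
    and "AE x in lebesgue. weak_partial i (\<lambda>x. a * \<phi> x + b * \<psi> x) x = a * weak_partial i \<phi> x + b * weak_partial i \<psi> x"
proof -
  have h: "\<phi> \<in> H1_space" "\<psi> \<in> H1_space" using \<phi> \<psi> by (auto simp: X_space_def)
  note s = square_integrable_lincomb[OF H1_D(1)[OF h(1)] H1_D(1)[OF h(2)], of a b]
    has_weak_partial_linear[OF H1_D(2)[OF h(1)] H1_D(2)[OF h(2)], of _ a b]
    square_integrable_lincomb[OF H1_D(3)[OF h(1)] H1_D(3)[OF h(2)], of a _ b]
  show "AE x in lebesgue. weak_partial i (\<lambda>x. a * \<phi> x + b * \<psi> x) x = a * weak_partial i \<phi> x + b * weak_partial i \<psi> x"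
    by (rule H1_I(2)[OF s(1)]) (rule s)+
  have "(\<lambda>x. a * \<phi> x + b * \<psi> x) \<in> H1_space" by (rule H1_I(1)[OF s(1)]) (rule s)+
  moreover have "(\<lambda>x. a * \<phi> x + b * \<psi> x) \<in> L2V_space V"
    using \<phi> \<psi> H1_D(1)[OF h(1)] H1_D(1)[OF h(2)] V0
    by (auto simp: X_space_def L2V_space_def square_integrable_def intro!: integrable_potential_lincomb)
  ultimately show "(\<lambda>x. a * \<phi> x + b * \<psi> x) \<in> X_space V" by (simp add: X_space_def)
qed

text \<open>Convexity is invoked on the positive half-line; if one argument is \<open>0\<close>, the
  claim reduces to \<open>(1 / 2) powr q \<le> 1 / 2\<close>.\<close>

lemma midpoint_powr_le:
  fixes s t q :: real
  assumes "s \<ge> 0" "t \<ge> 0" "q \<ge> 1"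
  shows "((s + t) / 2) powr q \<le> 1 / 2 * s powr q + 1 / 2 * t powr q"
proof -
  have half: "(u / 2) powr q \<le> 1 / 2 * u powr q" if "u \<ge> 0" for u
  proof -
    have "(1 / 2) powr q \<le> (1 / 2 :: real) powr 1"
      using assms by (intro powr_mono') auto
    then have "u powr q * (1 / 2) powr q \<le> u powr q * (1 / 2)"
      by (intro mult_left_mono) auto
    moreover have "(u / 2) powr q = u powr q * (1 / 2) powr q"
      by (simp add: powr_mult[symmetric])
    ultimately show ?thesis by simp
  qed
  consider "s = 0" | "t = 0" | "s > 0" "t > 0" using assms by linarith
  then show ?thesis
  proof cases
    case 3
    then show ?thesis
      using convex_onD[OF powr_convex[OF assms(3)], of "1 / 2" s t] by (simp add: add_divide_distrib)
  qed (use half[of s] half[of t] assms in auto)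
qed

section \<open>Pointwise densities of the action\<close>

lemma cmod_midpoint_square:
  "(cmod ((y + z) / 2))^2 = 1 / 2 * (cmod y)^2 + 1 / 2 * (cmod z)^2 - 1 / 4 * (cmod (y - z))^2"
proof -
  have "(cmod (y + z))^2 + (cmod (y - z))^2 = 2 * (cmod y)^2 + 2 * (cmod z)^2"
    unfolding cmod_power2 by (simp add: power2_eq_square algebra_simps)
  then show ?thesis by (simp add: norm_divide power_divide)
qed

text \<open>The density of the angular momentum with the value and the gradient as free variables.
  It is sesquilinear in \<open>a\<close> and \<open>v\<close>, so its real part obeys the same
  parallelogram identity and quadratic scaling as the other terms of \<open>quad\<close>.\<close>

definition rot_form :: "(nat \<Rightarrow> 'n::finite) \<Rightarrow> real^'n \<Rightarrow> complex \<Rightarrow> ('n \<Rightarrow> complex) \<Rightarrow> complex" where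
  "rot_form e x a v = cnj a * (if CARD('n) \<ge> 2
     then \<i> * (of_real (x $ e 2) * v (e 1) - of_real (x $ e 1) * v (e 2)) else 0)"

lemma rot_form_angular_momentum:
  "cnj (\<phi> x) * angular_momentum e \<phi> x = rot_form e x (\<phi> x) (grad \<phi> x)"
  by (simp add: rot_form_def angular_momentum_def)

text \<open>The value of \<open>\<theta>\<close> will be \<open>\<bar>\<Omega>\<bar> / min \<gamma>\<^sub>1 \<gamma>\<^sub>2\<close> for the rotating harmonic trap and \<open>0\<close> otherwise.\<close>
locale action_functional =
  fixes e :: "nat \<Rightarrow> 'n::finite" and V :: "real^'n \<Rightarrow> real" and \<beta> p \<Omega> \<omega> \<theta> :: real
  assumes beta: "\<beta> > 0" and p_gt: "p > 1"
    and subcritical: "p + 1 < 2 + 2 * (p + 1) / CARD('n)"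
    and V_nonneg: "\<And>x. V x \<ge> 0" and V_at_top: "filterlim V at_top at_infinity"
    and theta: "0 \<le> \<theta>" "\<theta> < 1"
    and rot_bound: "\<And>x a v. \<bar>\<Omega>\<bar> * cmod (rot_form e x a v)
      \<le> \<theta> * (1 / 2 * (\<Sum>i\<in>UNIV. (cmod (v i))^2) + V x * (cmod a)^2)"
begin

definition quad :: "real^'n \<Rightarrow> complex \<Rightarrow> ('n \<Rightarrow> complex) \<Rightarrow> real" where
  "quad x a v = 1 / 2 * (\<Sum>i\<in>UNIV. (cmod (v i))^2) + V x * (cmod a)^2 - \<Omega> * Re (rot_form e x a v)"

definition energy :: "real^'n \<Rightarrow> complex \<Rightarrow> ('n \<Rightarrow> complex) \<Rightarrow> real" where
  "energy x a v = quad x a v + 2 * \<beta> / (p + 1) * cmod a powr (p + 1) + \<omega> * (cmod a)^2"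

abbreviation S :: "(real^'n \<Rightarrow> complex) \<Rightarrow> real" where
  "S \<equiv> action e V \<beta> p \<Omega> \<omega>"

lemma rot_abs_le: "\<bar>\<Omega> * Re (rot_form e x a v)\<bar>
    \<le> \<theta> * (1 / 2 * (\<Sum>i\<in>UNIV. (cmod (v i))^2) + V x * (cmod a)^2)"
  using rot_bound[of x a v] mult_left_mono[OF abs_Re_le_cmod[of "rot_form e x a v"], of "\<bar>\<Omega>\<bar>"]
  by (simp add: abs_mult)

lemma quad_ge: "(1 - \<theta>) * (1 / 2 * (\<Sum>i\<in>UNIV. (cmod (v i))^2) + V x * (cmod a)^2) \<le> quad x a v"
  using rot_abs_le[of x a v] unfolding quad_def left_diff_distrib mult_1 by linarith

lemma quad_parallelogram:
  "quad x ((a + b) / 2) (\<lambda>i. (v i + w i) / 2)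
    = 1 / 2 * quad x a v + 1 / 2 * quad x b w - 1 / 4 * quad x (a - b) (\<lambda>i. v i - w i)"
proof -
  have n: "(cmod ((y + z) / 2))^2 = 1 / 2 * (cmod y)^2 + 1 / 2 * (cmod z)^2 - 1 / 4 * (cmod (y - z))^2" for y z
    by (rule cmod_midpoint_square)
  have r: "rot_form e x ((a + b) / 2) (\<lambda>i. (v i + w i) / 2)
     = (1 / 2 * rot_form e x a v + 1 / 2 * rot_form e x b w) - 1 / 4 * rot_form e x (a - b) (\<lambda>i. v i - w i)"
    by (simp add: rot_form_def field_simps)
  have "\<Omega> * Re (rot_form e x ((a + b) / 2) (\<lambda>i. (v i + w i) / 2))
     = 1 / 2 * (\<Omega> * Re (rot_form e x a v)) + 1 / 2 * (\<Omega> * Re (rot_form e x b w))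
       - 1 / 4 * (\<Omega> * Re (rot_form e x (a - b) (\<lambda>i. v i - w i)))"
    unfolding r by (simp add: algebra_simps)
  moreover have "(\<Sum>i\<in>UNIV. (cmod ((v i + w i) / 2))^2) = 1 / 2 * (\<Sum>i\<in>UNIV. (cmod (v i))^2)
      + 1 / 2 * (\<Sum>i\<in>UNIV. (cmod (w i))^2) - 1 / 4 * (\<Sum>i\<in>UNIV. (cmod (v i - w i))^2)"
    unfolding n by (simp only: sum.distrib sum_subtractf sum_distrib_left)
  moreover have "V x * (cmod ((a + b) / 2))^2 = 1 / 2 * (V x * (cmod a)^2)
      + 1 / 2 * (V x * (cmod b)^2) - 1 / 4 * (V x * (cmod (a - b))^2)"
    unfolding n by (simp add: algebra_simps)
  ultimately show ?thesis
    unfolding quad_def right_diff_distrib distrib_left by linarith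
qed

text \<open>As \<beta> > 0, the power term is convex and only helps. The term with
  \<open>\<omega>\<close> may have the wrong sign, but its defect is a multiple of
  \<open>(cmod (a - b))^2\<close>, which compactness in square mean makes small after
  integration.\<close>

lemma energy_midpoint_le:
  "energy x ((a + b) / 2) (\<lambda>i. (v i + w i) / 2)
    \<le> 1 / 2 * energy x a v + 1 / 2 * energy x b w - 1 / 4 * quad x (a - b) (\<lambda>i. v i - w i)
      - \<omega> / 4 * (cmod (a - b))^2"
proof -
  have n: "(cmod ((a + b) / 2))^2 = 1 / 2 * (cmod a)^2 + 1 / 2 * (cmod b)^2 - 1 / 4 * (cmod (a - b))^2"
    by (rule cmod_midpoint_square)
  have "cmod ((a + b) / 2) powr (p + 1) \<le> ((cmod a + cmod b) / 2) powr (p + 1)"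
    using p_gt norm_triangle_ineq[of a b] by (intro powr_mono2) (auto simp: norm_divide)
  also have "\<dots> \<le> 1 / 2 * cmod a powr (p + 1) + 1 / 2 * cmod b powr (p + 1)"
    using p_gt by (intro midpoint_powr_le) auto
  finally have le: "cmod ((a + b) / 2) powr (p + 1) \<le> 1 / 2 * cmod a powr (p + 1) + 1 / 2 * cmod b powr (p + 1)" .
  define \<kappa> where "\<kappa> = 2 * \<beta> / (p + 1)"
  have "\<kappa> \<ge> 0" using beta p_gt by (simp add: \<kappa>_def)
  then have "\<kappa> * cmod ((a + b) / 2) powr (p + 1) \<le> \<kappa> * (1 / 2 * cmod a powr (p + 1) + 1 / 2 * cmod b powr (p + 1))"
    by (rule mult_left_mono[OF le])
  then show ?thesis unfolding energy_def quad_parallelogram n \<kappa>_def[symmetric] by (simp add: algebra_simps)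
qed

text \<open>Coercivity for every sign of \<open>\<omega>\<close>. With
  \<open>l = \<bar>\<omega>\<bar> + 1\<close> there remains a full \<open>(cmod a)^2\<close> once
  \<open>l * (cmod a)^2\<close> is absorbed: outside a ball by half of the potential term, inside by
  the power term up to a constant. The correction \<open>I\<close> is this constant on the ball and
  \<open>0\<close> outside, hence integrable.\<close>

lemma energy_lower_bound:
  obtains I where "integrable lebesgue I" "\<And>x a v.
     (1 - \<theta>) / 2 * (\<Sum>i\<in>UNIV. (cmod (v i))^2) + (1 - \<theta>) / 2 * (V x * (cmod a)^2) + (cmod a)^2
      \<le> energy x a v + I x"
proof -
  define l where "l = \<bar>\<omega>\<bar> + 1"
  define \<kappa> where "\<kappa> = 2 * \<beta> / (p + 1)"
  have \<kappa>: "\<kappa> > 0" using beta p_gt by (simp add: \<kappa>_def)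
  have l: "l > 0" by (simp add: l_def add_nonneg_pos)
  have "\<forall>\<^sub>F x in at_infinity. 2 * l / (1 - \<theta>) \<le> V x"
    using V_at_top by (simp add: filterlim_at_top)
  then obtain R where R: "\<And>x. R \<le> norm x \<Longrightarrow> 2 * l / (1 - \<theta>) \<le> V x"
    by (auto simp: eventually_at_infinity)
  \<comment> \<open>The point where \<open>\<kappa> * s powr (p - 1) = l\<close>: beyond
    \<open>s\<close> the power term exceeds \<open>l * t^2\<close>, below it \<open>l * t^2\<close>
    is at most \<open>l * s^2\<close>.\<close>
  define s where "s = (l / \<kappa>) powr (1 / (p - 1))"
  have s: "s \<ge> 0" by (simp add: s_def)
  have local: "- (l * s^2) \<le> \<kappa> * t powr (p + 1) - l * t^2" if t: "t \<ge> 0" for t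
  proof (cases "t \<le> s")
    case True
    then have "l * t^2 \<le> l * s^2" using l t by (intro mult_left_mono power_mono) auto
    moreover have "0 \<le> \<kappa> * t powr (p + 1)" using \<kappa> by simp
    ultimately show ?thesis by linarith
  next
    case False
    have "l / \<kappa> = s powr (p - 1)" using l \<kappa> p_gt by (simp add: s_def powr_powr)
    also have "\<dots> \<le> t powr (p - 1)" using False s p_gt by (intro powr_mono2) auto
    finally have "l * t^2 \<le> \<kappa> * (t powr (p - 1) * t^2)"
      using \<kappa> by (simp add: pos_divide_le_eq mult_right_mono mult.commute[of \<kappa>] mult.assoc[symmetric])
    also have "t powr (p - 1) * t^2 = t powr (p + 1)"
    proof -
      have "t > 0" using False s by linarith
      then have "t^2 = t powr 2" by simp
      then show ?thesis by (simp add: powr_add[symmetric] add.commute)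
    qed
    finally have "l * t^2 \<le> \<kappa> * t powr (p + 1)" .
    moreover have "0 \<le> l * s^2" using l by simp
    ultimately show ?thesis by linarith
  qed
  have "(1 - \<theta>) / 2 * (\<Sum>i\<in>UNIV. (cmod (v i))^2) + (1 - \<theta>) / 2 * (V x * (cmod a)^2) + (cmod a)^2
      \<le> energy x a v + l * s^2 * indicator (cball 0 R) x" for x a v
  proof -
    have w: "- (l * (cmod a)^2) + (cmod a)^2 \<le> \<omega> * (cmod a)^2"
    proof -
      have "(- l + 1) * (cmod a)^2 \<le> \<omega> * (cmod a)^2"
        by (intro mult_right_mono) (auto simp: l_def)
      then show ?thesis by (simp add: algebra_simps)
    qed
    have q: "(1 - \<theta>) / 2 * (\<Sum>i\<in>UNIV. (cmod (v i))^2) + (1 - \<theta>) * (V x * (cmod a)^2) \<le> quad x a v"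
      using quad_ge[of v x a] by (simp add: distrib_left)
    have half: "(1 - \<theta>) * (V x * (cmod a)^2) = (1 - \<theta>) / 2 * (V x * (cmod a)^2) + (1 - \<theta>) / 2 * (V x * (cmod a)^2)"
      by simp
    have V: "0 \<le> (1 - \<theta>) / 2 * (V x * (cmod a)^2)"
      using theta V_nonneg[of x] by (intro mult_nonneg_nonneg) auto
    have "- (l * s^2 * indicator (cball 0 R) x) \<le> (1 - \<theta>) / 2 * (V x * (cmod a)^2) + \<kappa> * cmod a powr (p + 1) - l * (cmod a)^2"
    proof (cases "x \<in> cball 0 R")
      case True
      then show ?thesis using local[of "cmod a"] V by simp
    next
      case False
      then have "2 * l / (1 - \<theta>) \<le> V x" by (intro R) auto
      then have "l \<le> (1 - \<theta>) / 2 * V x" using theta by (simp add: field_simps)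
      then have "l * (cmod a)^2 \<le> (1 - \<theta>) / 2 * V x * (cmod a)^2" by (intro mult_right_mono) auto
      moreover have "0 \<le> \<kappa> * cmod a powr (p + 1)" using \<kappa> by simp
      ultimately show ?thesis using False by (simp add: mult.assoc)
    qed
    then show ?thesis using q w half unfolding energy_def \<kappa>_def[symmetric] by linarith
  qed
  moreover have "integrable lebesgue (\<lambda>x. l * s^2 * indicator (cball (0::real^'n) R) x)"
    using lmeasurable_compact[OF compact_cball, of "0::real^'n" R]
    by (intro integrable_mult_right) (auto simp: integrable_on_indicator fmeasurable_def)
  ultimately show ?thesis using that by blast
qed

text \<open>The last claim is the Sobolev embedding, with the constant supplied by
  \<open>Poincare\<close>. It is here that the upper bound on \<open>p\<close> enters and makes the
  power term of the action finite on all of \<open>X_space V\<close>.\<close>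

lemma X_D:
  assumes "\<phi> \<in> X_space V"
  shows "square_integrable \<phi>" "has_weak_partial i \<phi> (weak_partial i \<phi>)" "square_integrable (weak_partial i \<phi>)"
    "integrable lebesgue (\<lambda>x. V x * (cmod (\<phi> x))^2)" "integrable lebesgue (\<lambda>x. cmod (\<phi> x) powr (p + 1))"
proof -
  have h: "\<phi> \<in> H1_space" using assms by (auto simp: X_space_def)
  show sq: "square_integrable \<phi>" "has_weak_partial i \<phi> (weak_partial i \<phi>)" "square_integrable (weak_partial i \<phi>)" for i
    using H1_D[OF h] by blast+
  show "integrable lebesgue (\<lambda>x. V x * (cmod (\<phi> x))^2)"
    using assms by (simp add: X_space_def L2V_space_def)
  have m: "\<phi> \<in> borel_measurable lebesgue" using sq by (simp add: square_integrable_def)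
  define C where "C = 4 ^ CARD('n) * (\<Sum>i\<in>UNIV. sq_int lebesgue (weak_partial i \<phi>))"
  have "(\<integral>\<^sup>+x. ennreal (norm (\<phi> x) powr (p + 1)) \<partial>lebesgue) < \<infinity>"
  proof (rule Sobolev_subcritical[OF m, where C=C])
    show "nn_L2 lebesgue \<phi> < \<infinity>"
      using sq(1) by (simp add: square_integrable_def integrable_iff_bounded)
    show "nn_L2 lebesgue (\<lambda>x. \<phi> x - cell_avg \<epsilon> \<phi> x) \<le> ennreal (C * \<epsilon>^2)" if "\<epsilon> > 0" for \<epsilon>
      using Poincare[OF sq(1) sq(3) sq(2) that] by (simp add: C_def mult_ac)
    show "0 \<le> C" by (auto simp: C_def intro!: mult_nonneg_nonneg sum_nonneg)
    show "2 \<le> p + 1" using p_gt by simp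
    show "p + 1 < 2 + 2 * (p + 1) / CARD('n)" by (rule subcritical)
  qed
  then show "integrable lebesgue (\<lambda>x. cmod (\<phi> x) powr (p + 1))"
    using m by (simp add: integrable_iff_bounded)
qed

lemma quad_integrable:
  assumes f: "square_integrable f" and g: "\<And>i. square_integrable (g i)"
    and Vf: "integrable lebesgue (\<lambda>x. V x * (cmod (f x))^2)"
  shows "integrable lebesgue (\<lambda>x. \<Omega> * Re (rot_form e x (f x) (\<lambda>i. g i x)))"
    "integrable lebesgue (\<lambda>x. \<Omega> * rot_form e x (f x) (\<lambda>i. g i x))"
    "integrable lebesgue (\<lambda>x. quad x (f x) (\<lambda>i. g i x))"
proof -
  have m: "f \<in> borel_measurable lebesgue" "g i \<in> borel_measurable lebesgue" for i
    using f g by (auto simp: square_integrable_def)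
  note [measurable] = m(1) m(2)[of "e 1"] m(2)[of "e 2"]
  have x: "(\<lambda>x::real^'n. x $ i) \<in> borel_measurable lebesgue" for i
    by (rule lborel_measurable_imp_lebesgue) measurable
  have [measurable]: "cnj \<in> borel_measurable borel"
    by (intro borel_measurable_continuous_onI continuous_intros)
  note [measurable] = x[of "e 1"] x[of "e 2"]
  have g2: "integrable lebesgue (\<lambda>x. (cmod (g i x))^2)" for i using g by (auto simp: square_integrable_def)
  \<comment> \<open>The coefficients of the rotation term grow with \<open>x\<close>;
    \<open>rot_bound\<close> dominates it by this integrable combination of gradient and
    potential.\<close>
  have b: "integrable lebesgue (\<lambda>x. \<theta> * (1 / 2 * (\<Sum>i\<in>UNIV. (cmod (g i x))^2) + V x * (cmod (f x))^2))"
    using g2 Vf by auto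
  have rm: "(\<lambda>x. rot_form e x (f x) (\<lambda>i. g i x)) \<in> borel_measurable lebesgue"
  proof (cases "CARD('n) \<ge> 2")
    case True
    show ?thesis unfolding rot_form_def if_P[OF True] by measurable
  qed (simp add: rot_form_def)
  show "integrable lebesgue (\<lambda>x. \<Omega> * rot_form e x (f x) (\<lambda>i. g i x))"
  proof (rule Bochner_Integration.integrable_bound[OF b])
    show "(\<lambda>x. \<Omega> * rot_form e x (f x) (\<lambda>i. g i x)) \<in> borel_measurable lebesgue" using rm by measurable
    show "AE x in lebesgue. norm (\<Omega> * rot_form e x (f x) (\<lambda>i. g i x))
       \<le> norm (\<theta> * (1 / 2 * (\<Sum>i\<in>UNIV. (cmod (g i x))^2) + V x * (cmod (f x))^2))"
    proof (rule AE_I2)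
      fix x
      show "norm (\<Omega> * rot_form e x (f x) (\<lambda>i. g i x))
        \<le> norm (\<theta> * (1 / 2 * (\<Sum>i\<in>UNIV. (cmod (g i x))^2) + V x * (cmod (f x))^2))"
        using order_trans[OF rot_bound[of x "f x" "\<lambda>i. g i x"] abs_ge_self]
        by (simp only: norm_mult norm_of_real real_norm_def)
    qed
  qed
  show r: "integrable lebesgue (\<lambda>x. \<Omega> * Re (rot_form e x (f x) (\<lambda>i. g i x)))"
  proof (rule Bochner_Integration.integrable_bound[OF b])
    show "(\<lambda>x. \<Omega> * Re (rot_form e x (f x) (\<lambda>i. g i x))) \<in> borel_measurable lebesgue" using rm by measurable
    show "AE x in lebesgue. norm (\<Omega> * Re (rot_form e x (f x) (\<lambda>i. g i x)))
       \<le> norm (\<theta> * (1 / 2 * (\<Sum>i\<in>UNIV. (cmod (g i x))^2) + V x * (cmod (f x))^2))"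
      unfolding real_norm_def by (intro AE_I2 order_trans[OF rot_abs_le abs_ge_self])
  qed
  show "integrable lebesgue (\<lambda>x. quad x (f x) (\<lambda>i. g i x))"
    unfolding quad_def using g2 Vf r by (intro Bochner_Integration.integrable_diff Bochner_Integration.integrable_add) auto
qed

lemma energy_integrable:
  assumes "\<phi> \<in> X_space V"
  shows "integrable lebesgue (\<lambda>x. energy x (\<phi> x) (grad \<phi> x))"
    "integrable lebesgue (\<lambda>x. quad x (\<phi> x) (grad \<phi> x))"
proof -
  note X = X_D[OF assms]
  show q: "integrable lebesgue (\<lambda>x. quad x (\<phi> x) (grad \<phi> x))"
    by (rule quad_integrable(3)[OF X(1,3,4)])
  have "integrable lebesgue (\<lambda>x. (cmod (\<phi> x))^2)" using X(1) by (simp add: square_integrable_def)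
  then show "integrable lebesgue (\<lambda>x. energy x (\<phi> x) (grad \<phi> x))"
    unfolding energy_def using q X(5) by auto
qed

lemma quadratic_part_eq:
  assumes "\<phi> \<in> X_space V"
  shows "1 / 2 * (Lp_norm 2 (weak_gradient \<phi>))^2 + (\<integral>x. V x * (cmod (\<phi> x))^2 \<partial>lebesgue) + L_rot e \<Omega> \<phi>
    = (\<integral>x. quad x (\<phi> x) (grad \<phi> x) \<partial>lebesgue)"
proof -
  note X = X_D[OF assms]
  have g2: "integrable lebesgue (\<lambda>x. (cmod (weak_partial i \<phi> x))^2)" for i
    using X(3) by (auto simp: square_integrable_def)
  \<comment> \<open>\<open>\<Omega>\<close> is taken inside the integral before the real part: for
    \<Omega> = 0 the rotation density alone is not controlled, whereas its product with
    \<open>\<Omega>\<close> is always integrable.\<close>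
  have "L_rot e \<Omega> \<phi> = - Re (of_real \<Omega> * (\<integral>x. rot_form e x (\<phi> x) (grad \<phi> x) \<partial>lebesgue))"
    by (simp add: L_rot_def rot_form_angular_momentum)
  also have "\<dots> = - Re (\<integral>x. of_real \<Omega> * rot_form e x (\<phi> x) (grad \<phi> x) \<partial>lebesgue)"
    by simp
  also have "\<dots> = - (\<integral>x. Re (of_real \<Omega> * rot_form e x (\<phi> x) (grad \<phi> x)) \<partial>lebesgue)"
    using quad_integrable(2)[OF X(1,3,4)] by (subst integral_Re) auto
  finally have L: "L_rot e \<Omega> \<phi> = - (\<integral>x. \<Omega> * Re (rot_form e x (\<phi> x) (grad \<phi> x)) \<partial>lebesgue)"
    by simp
  show ?thesis
    unfolding L Lp_norm_2_square norm_weak_gradient_square quad_def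
    using g2 X(4) quad_integrable(1)[OF X(1,3,4)] by simp
qed

lemma action_eq:
  assumes "\<phi> \<in> X_space V"
  shows "S \<phi> = (\<integral>x. energy x (\<phi> x) (grad \<phi> x) \<partial>lebesgue)"
    "S \<phi> = (\<integral>x. quad x (\<phi> x) (grad \<phi> x) \<partial>lebesgue)
       + 2 * \<beta> / (p + 1) * (\<integral>x. cmod (\<phi> x) powr (p + 1) \<partial>lebesgue) + \<omega> * sq_int lebesgue \<phi>"
    "nehari e V \<beta> p \<Omega> \<omega> \<phi> = (\<integral>x. quad x (\<phi> x) (grad \<phi> x) \<partial>lebesgue)
       + \<beta> * (\<integral>x. cmod (\<phi> x) powr (p + 1) \<partial>lebesgue) + \<omega> * sq_int lebesgue \<phi>"
proof -
  note X = X_D[OF assms]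
  have i: "integrable lebesgue (\<lambda>x. (cmod (\<phi> x))^2)" using X(1) by (simp add: square_integrable_def)
  show S: "S \<phi> = (\<integral>x. quad x (\<phi> x) (grad \<phi> x) \<partial>lebesgue)
       + 2 * \<beta> / (p + 1) * (\<integral>x. cmod (\<phi> x) powr (p + 1) \<partial>lebesgue) + \<omega> * sq_int lebesgue \<phi>"
    using quadratic_part_eq[OF assms] p_gt unfolding action_def
    by (simp add: Lp_norm_powr Lp_norm_2_square)
  show "nehari e V \<beta> p \<Omega> \<omega> \<phi> = (\<integral>x. quad x (\<phi> x) (grad \<phi> x) \<partial>lebesgue)
       + \<beta> * (\<integral>x. cmod (\<phi> x) powr (p + 1) \<partial>lebesgue) + \<omega> * sq_int lebesgue \<phi>"
    using quadratic_part_eq[OF assms] p_gt unfolding nehari_def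
    by (simp add: Lp_norm_powr Lp_norm_2_square)
  show "S \<phi> = (\<integral>x. energy x (\<phi> x) (grad \<phi> x) \<partial>lebesgue)"
    unfolding S energy_def using X(5) i energy_integrable(2)[OF assms] by simp
qed

text \<open>The weak partials of sums and multiples are the expected ones only almost everywhere,
  being choices. This lemma substitutes the explicit gradient in the functionals.\<close>

lemma energy_integral_cong:
  assumes "\<phi> \<in> X_space V" "\<And>i. AE x in lebesgue. weak_partial i \<phi> x = g i x"
  shows "(\<integral>x. energy x (\<phi> x) (grad \<phi> x) \<partial>lebesgue) = (\<integral>x. energy x (\<phi> x) (\<lambda>i. g i x) \<partial>lebesgue)"
    "(\<integral>x. quad x (\<phi> x) (grad \<phi> x) \<partial>lebesgue) = (\<integral>x. quad x (\<phi> x) (\<lambda>i. g i x) \<partial>lebesgue)"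
    "integrable lebesgue (\<lambda>x. energy x (\<phi> x) (\<lambda>i. g i x))"
    "integrable lebesgue (\<lambda>x. quad x (\<phi> x) (\<lambda>i. g i x))"
proof -
  have "AE x in lebesgue. \<forall>i. weak_partial i \<phi> x = g i x"
    using assms(2) by (simp add: AE_all_countable)
  then have q: "AE x in lebesgue. quad x (\<phi> x) (grad \<phi> x) = quad x (\<phi> x) (\<lambda>i. g i x)"
    and E: "AE x in lebesgue. energy x (\<phi> x) (grad \<phi> x) = energy x (\<phi> x) (\<lambda>i. g i x)"
    by (eventually_elim, simp)+
  note i = energy_integrable[OF assms(1)]
  note m = i[THEN borel_measurable_integrable]
  note m' = lebesgue_measurable_cong_AE[OF m(1) E] lebesgue_measurable_cong_AE[OF m(2) q]
  show "(\<integral>x. energy x (\<phi> x) (grad \<phi> x) \<partial>lebesgue) = (\<integral>x. energy x (\<phi> x) (\<lambda>i. g i x) \<partial>lebesgue)"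
    by (rule integral_cong_AE[OF m(1) m'(1) E])
  show "(\<integral>x. quad x (\<phi> x) (grad \<phi> x) \<partial>lebesgue) = (\<integral>x. quad x (\<phi> x) (\<lambda>i. g i x) \<partial>lebesgue)"
    by (rule integral_cong_AE[OF m(2) m'(2) q])
  show "integrable lebesgue (\<lambda>x. energy x (\<phi> x) (\<lambda>i. g i x))"
    by (rule integrable_cong_AE_imp[OF i(1) m'(1) E])
  show "integrable lebesgue (\<lambda>x. quad x (\<phi> x) (\<lambda>i. g i x))"
    by (rule integrable_cong_AE_imp[OF i(2) m'(2) q])
qed

subsection \<open>Existence of a minimizer\<close>

text \<open>By the parallelogram identity, two almost minimizers are close in the norm of \<open>quad\<close> as soon
  as they are close in \<open>L^2\<close>.\<close>
lemma gradient_diff_le: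
  assumes \<phi>: "\<phi> \<in> X_space V" and \<psi>: "\<psi> \<in> X_space V" and m: "\<And>\<rho>. \<rho> \<in> X_space V \<Longrightarrow> m \<le> S \<rho>"
  shows "(1 - \<theta>) / 2 * (\<Sum>i\<in>UNIV. sq_int lebesgue (\<lambda>x. weak_partial i \<phi> x - weak_partial i \<psi> x))
    \<le> 2 * (S \<phi> + S \<psi> - 2 * m) + \<bar>\<omega>\<bar> * sq_int lebesgue (\<lambda>x. \<phi> x - \<psi> x)"
proof -
  let ?D = "sq_int lebesgue (\<lambda>x. \<phi> x - \<psi> x)"
  define \<mu> where "\<mu> = (\<lambda>x. (\<phi> x + \<psi> x) / 2)"
  define \<delta> where "\<delta> = (\<lambda>x. \<phi> x - \<psi> x)"
  have \<mu>: "\<mu> \<in> X_space V" "\<And>i. AE x in lebesgue. weak_partial i \<mu> x = (weak_partial i \<phi> x + weak_partial i \<psi> x) / 2"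
    using X_space_lincomb[OF V_nonneg \<phi> \<psi>, where a="1 / 2" and b="1 / 2"] by (simp_all add: \<mu>_def add_divide_distrib)
  have \<delta>: "\<delta> \<in> X_space V" "\<And>i. AE x in lebesgue. weak_partial i \<delta> x = weak_partial i \<phi> x - weak_partial i \<psi> x"
    using X_space_lincomb[OF V_nonneg \<phi> \<psi>, where a=1 and b="- 1"] by (simp_all add: \<delta>_def)
  note E\<mu> = energy_integral_cong[OF \<mu>] and E\<delta> = energy_integral_cong[OF \<delta>]
  have d2: "integrable lebesgue (\<lambda>x. (cmod (\<phi> x - \<psi> x))^2)"
    using X_D(1)[OF \<delta>(1)] by (simp add: square_integrable_def \<delta>_def)
  note E = energy_integrable(1)[OF \<phi>] energy_integrable(1)[OF \<psi>]
  have "m \<le> S \<mu>" by (rule m[OF \<mu>(1)])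
  also have "S \<mu> = (\<integral>x. energy x ((\<phi> x + \<psi> x) / 2) (\<lambda>i. (weak_partial i \<phi> x + weak_partial i \<psi> x) / 2) \<partial>lebesgue)"
    using action_eq(1)[OF \<mu>(1)] E\<mu>(1) by (simp add: \<mu>_def)
  also have "\<dots> \<le> (\<integral>x. 1 / 2 * energy x (\<phi> x) (grad \<phi> x) + 1 / 2 * energy x (\<psi> x) (grad \<psi> x)
      - 1 / 4 * quad x (\<phi> x - \<psi> x) (\<lambda>i. weak_partial i \<phi> x - weak_partial i \<psi> x) - \<omega> / 4 * (cmod (\<phi> x - \<psi> x))^2 \<partial>lebesgue)"
  proof (rule integral_mono)
    show "integrable lebesgue (\<lambda>x. energy x ((\<phi> x + \<psi> x) / 2) (\<lambda>i. (weak_partial i \<phi> x + weak_partial i \<psi> x) / 2))"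
      using E\<mu>(3) by (simp add: \<mu>_def)
    show "integrable lebesgue (\<lambda>x. 1 / 2 * energy x (\<phi> x) (grad \<phi> x) + 1 / 2 * energy x (\<psi> x) (grad \<psi> x)
      - 1 / 4 * quad x (\<phi> x - \<psi> x) (\<lambda>i. weak_partial i \<phi> x - weak_partial i \<psi> x) - \<omega> / 4 * (cmod (\<phi> x - \<psi> x))^2)"
      using E E\<delta>(4) d2 unfolding \<delta>_def
      by (intro Bochner_Integration.integrable_diff Bochner_Integration.integrable_add integrable_mult_right) auto
  qed (rule energy_midpoint_le)
  also have "\<dots> = 1 / 2 * S \<phi> + 1 / 2 * S \<psi>
     - 1 / 4 * (\<integral>x. quad x (\<phi> x - \<psi> x) (\<lambda>i. weak_partial i \<phi> x - weak_partial i \<psi> x) \<partial>lebesgue) - \<omega> / 4 * ?D"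
    unfolding action_eq(1)[OF \<phi>] action_eq(1)[OF \<psi>] using E E\<delta>(4) d2 unfolding \<delta>_def by simp
  finally have "(\<integral>x. quad x (\<phi> x - \<psi> x) (\<lambda>i. weak_partial i \<phi> x - weak_partial i \<psi> x) \<partial>lebesgue)
     \<le> 2 * (S \<phi> + S \<psi> - 2 * m) - \<omega> * ?D" by (simp add: field_simps)
  moreover have "- \<omega> * ?D \<le> \<bar>\<omega>\<bar> * ?D" by (intro mult_right_mono) auto
  moreover have "(1 - \<theta>) / 2 * (\<Sum>i\<in>UNIV. sq_int lebesgue (\<lambda>x. weak_partial i \<phi> x - weak_partial i \<psi> x))
     \<le> (\<integral>x. quad x (\<phi> x - \<psi> x) (\<lambda>i. weak_partial i \<phi> x - weak_partial i \<psi> x) \<partial>lebesgue)"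
  proof -
    have g2: "integrable lebesgue (\<lambda>x. (cmod (weak_partial i \<phi> x - weak_partial i \<psi> x))^2)" for i
      using square_integrable_lincomb[OF X_D(3)[OF \<phi>] X_D(3)[OF \<psi>], where a=1 and b="- 1"]
      by (simp add: square_integrable_def)
    have "(1 - \<theta>) / 2 * (\<Sum>i\<in>UNIV. sq_int lebesgue (\<lambda>x. weak_partial i \<phi> x - weak_partial i \<psi> x))
      = (\<integral>x. (1 - \<theta>) / 2 * (\<Sum>i\<in>UNIV. (cmod (weak_partial i \<phi> x - weak_partial i \<psi> x))^2) \<partial>lebesgue)"
      using g2 by simp
    also have "\<dots> \<le> (\<integral>x. quad x (\<phi> x - \<psi> x) (\<lambda>i. weak_partial i \<phi> x - weak_partial i \<psi> x) \<partial>lebesgue)"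
    proof (rule integral_mono)
      show "integrable lebesgue (\<lambda>x. (1 - \<theta>) / 2 * (\<Sum>i\<in>UNIV. (cmod (weak_partial i \<phi> x - weak_partial i \<psi> x))^2))"
        using g2 by auto
      show "integrable lebesgue (\<lambda>x. quad x (\<phi> x - \<psi> x) (\<lambda>i. weak_partial i \<phi> x - weak_partial i \<psi> x))"
        using E\<delta>(4) by (simp add: \<delta>_def)
      fix x
      have "0 \<le> (1 - \<theta>) * (V x * (cmod (\<phi> x - \<psi> x))^2)"
        using theta V_nonneg[of x] by (intro mult_nonneg_nonneg) auto
      then show "(1 - \<theta>) / 2 * (\<Sum>i\<in>UNIV. (cmod (weak_partial i \<phi> x - weak_partial i \<psi> x))^2)
        \<le> quad x (\<phi> x - \<psi> x) (\<lambda>i. weak_partial i \<phi> x - weak_partial i \<psi> x)"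
        using quad_ge[of "\<lambda>i. weak_partial i \<phi> x - weak_partial i \<psi> x" x "\<phi> x - \<psi> x"]
        unfolding distrib_left by simp
    qed
    finally show ?thesis .
  qed
  ultimately show ?thesis by linarith
qed

lemma minimizing_sequence_bounds:
  obtains K where "\<And>\<phi>. \<phi> \<in> X_space V \<Longrightarrow>
     (1 - \<theta>) / 2 * (\<Sum>i\<in>UNIV. sq_int lebesgue (weak_partial i \<phi>))
      + (1 - \<theta>) / 2 * (\<integral>x. V x * (cmod (\<phi> x))^2 \<partial>lebesgue) + sq_int lebesgue \<phi> \<le> S \<phi> + K"
proof -
  obtain I where I: "integrable lebesgue I" and low: "\<And>x a v.
     (1 - \<theta>) / 2 * (\<Sum>i\<in>UNIV. (cmod (v i))^2) + (1 - \<theta>) / 2 * (V x * (cmod a)^2) + (cmod a)^2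
      \<le> energy x a v + I x" by (rule energy_lower_bound) (rule that)
  show ?thesis
  proof (rule that)
    fix \<phi> assume \<phi>: "\<phi> \<in> X_space V"
    note X = X_D[OF \<phi>]
    have i: "integrable lebesgue (\<lambda>x. (cmod (weak_partial i \<phi> x))^2)" "integrable lebesgue (\<lambda>x. (cmod (\<phi> x))^2)" for i
      using X(1,3) by (auto simp: square_integrable_def)
    have "(1 - \<theta>) / 2 * (\<Sum>i\<in>UNIV. sq_int lebesgue (weak_partial i \<phi>))
      + (1 - \<theta>) / 2 * (\<integral>x. V x * (cmod (\<phi> x))^2 \<partial>lebesgue) + sq_int lebesgue \<phi>
      = (\<integral>x. (1 - \<theta>) / 2 * (\<Sum>i\<in>UNIV. (cmod (weak_partial i \<phi> x))^2)
          + (1 - \<theta>) / 2 * (V x * (cmod (\<phi> x))^2) + (cmod (\<phi> x))^2 \<partial>lebesgue)"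
      using i X(4) by simp
    also have "\<dots> \<le> (\<integral>x. energy x (\<phi> x) (grad \<phi> x) + I x \<partial>lebesgue)"
      using i X(4) I energy_integrable(1)[OF \<phi>] low by (intro integral_mono) auto
    also have "\<dots> = S \<phi> + (\<integral>x. I x \<partial>lebesgue)"
      unfolding action_eq(1)[OF \<phi>] using I energy_integrable(1)[OF \<phi>] by simp
    finally show "(1 - \<theta>) / 2 * (\<Sum>i\<in>UNIV. sq_int lebesgue (weak_partial i \<phi>))
      + (1 - \<theta>) / 2 * (\<integral>x. V x * (cmod (\<phi> x))^2 \<partial>lebesgue) + sq_int lebesgue \<phi> \<le> S \<phi> + (\<integral>x. I x \<partial>lebesgue)" .
  qed
qed

lemma bounded_imp_L2_Cauchy_subseq:
  assumes F: "\<And>n. F n \<in> X_space V" and "B \<ge> 0"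
    and g: "\<And>n. (\<Sum>i\<in>UNIV. sq_int lebesgue (weak_partial i (F n))) \<le> B"
    and VF: "\<And>n. (\<integral>x. V x * (cmod (F n x))^2 \<partial>lebesgue) \<le> B"
    and F2: "\<And>n. sq_int lebesgue (F n) \<le> B"
  obtains r where "strict_mono (r :: nat \<Rightarrow> nat)" "L2_Cauchy (\<lambda>n. F (r n))"
proof (rule L2_compactness[where F=F and M=B and C="4 ^ CARD('n) * B"])
  note X = X_D[OF F]
  show "square_integrable (F n)" for n by (rule X(1))
  show "nn_L2 lebesgue (F n) \<le> ennreal B" for n
    using X(1)[of n] F2[of n] by (subst nn_integral_eq_integral) (auto simp: square_integrable_def ennreal_leI)
  show "B \<ge> 0" "4 ^ CARD('n) * B \<ge> 0" using \<open>B \<ge> 0\<close> by auto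
  show "nn_L2 lebesgue (\<lambda>x. F n x - cell_avg \<epsilon> (F n) x) \<le> ennreal (4 ^ CARD('n) * B * \<epsilon>^2)"
    if "\<epsilon> > 0" for n \<epsilon>
  proof (rule order_trans[OF Poincare[OF X(1) X(3) X(2) that] ennreal_leI])
    have "4 ^ CARD('n) * \<epsilon>^2 * (\<Sum>i\<in>UNIV. sq_int lebesgue (weak_partial i (F n))) \<le> 4 ^ CARD('n) * \<epsilon>^2 * B"
      by (intro mult_left_mono g) auto
    then show "4 ^ CARD('n) * \<epsilon>^2 * (\<Sum>i\<in>UNIV. sq_int lebesgue (weak_partial i (F n))) \<le> 4 ^ CARD('n) * B * \<epsilon>^2"
      by (simp add: mult_ac)
  qed
  show "\<exists>R. \<forall>n. (\<integral>\<^sup>+x. indicator (- cball 0 R) x * ennreal ((cmod (F n x))^2) \<partial>lebesgue) \<le> ennreal \<eta>"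
    if \<eta>: "\<eta> > 0" for \<eta>
  proof -
    \<comment> \<open>Where \<open>V \<ge> b\<close> the mass is at most \<open>B / b\<close>, which
      is at most \<open>\<eta>\<close>. The summand \<open>1\<close> keeps \<open>b\<close> positive
      when \<open>B = 0\<close>.\<close>
    define b where "b = B / \<eta> + 1"
    have b: "b > 0" using \<eta> \<open>B \<ge> 0\<close> by (simp add: b_def add_nonneg_pos)
    have "\<forall>\<^sub>F x in at_infinity. b \<le> V x"
      using V_at_top by (simp add: filterlim_at_top)
    then obtain R where R: "\<And>x. R \<le> norm x \<Longrightarrow> b \<le> V x" by (auto simp: eventually_at_infinity)
    have "(\<integral>\<^sup>+x. indicator (- cball 0 R) x * ennreal ((cmod (F n x))^2) \<partial>lebesgue) \<le> ennreal \<eta>" for n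
    proof -
      have "(\<integral>\<^sup>+x. indicator (- cball 0 R) x * ennreal ((cmod (F n x))^2) \<partial>lebesgue)
        \<le> (\<integral>\<^sup>+x. ennreal (1 / b * (V x * (cmod (F n x))^2)) \<partial>lebesgue)"
      proof (rule nn_integral_mono)
        fix x
        show "indicator (- cball 0 R) x * ennreal ((cmod (F n x))^2) \<le> ennreal (1 / b * (V x * (cmod (F n x))^2))"
        proof (cases "x \<in> cball 0 R")
          case False
          then have "1 \<le> 1 / b * V x" using R[of x] b by (simp add: field_simps)
          then have "1 * (cmod (F n x))^2 \<le> 1 / b * V x * (cmod (F n x))^2" by (intro mult_right_mono) auto
          then show ?thesis using False by (auto simp: mult.assoc intro: ennreal_leI)
        qed simp
      qed
      also have "\<dots> = ennreal (\<integral>x. 1 / b * (V x * (cmod (F n x))^2) \<partial>lebesgue)"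
        using X(4)[of n] b V_nonneg by (intro nn_integral_eq_integral integrable_mult_right) auto
      also have "(\<integral>x. 1 / b * (V x * (cmod (F n x))^2) \<partial>lebesgue) = 1 / b * (\<integral>x. V x * (cmod (F n x))^2 \<partial>lebesgue)"
        by simp
      also have "ennreal (1 / b * (\<integral>x. V x * (cmod (F n x))^2 \<partial>lebesgue)) \<le> ennreal (1 / b * B)"
        using b VF[of n] by (intro ennreal_leI mult_left_mono) auto
      also have "\<dots> \<le> ennreal \<eta>"
        using b \<eta> by (intro ennreal_leI) (simp add: b_def field_simps)
      finally show ?thesis .
    qed
    then show ?thesis by blast
  qed
qed (use that in blast)

lemma energy_tendsto:
  assumes "a \<longlonglongrightarrow> a0" "\<And>i. (\<lambda>n. v n i) \<longlonglongrightarrow> v0 i"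
  shows "(\<lambda>n. energy x (a n) (v n)) \<longlonglongrightarrow> energy x a0 v0"
proof -
  have r: "(\<lambda>n. rot_form e x (a n) (v n)) \<longlonglongrightarrow> rot_form e x a0 v0"
    unfolding rot_form_def by (cases "CARD('n) \<ge> 2") (auto intro!: tendsto_intros assms)
  have pw: "(\<lambda>n. cmod (a n) powr (p + 1)) \<longlonglongrightarrow> cmod a0 powr (p + 1)"
    using p_gt by (intro tendsto_powr2 tendsto_intros assms) auto
  show ?thesis
    unfolding energy_def quad_def
    by (intro tendsto_add tendsto_diff tendsto_mult tendsto_const tendsto_sum tendsto_power tendsto_norm
        tendsto_Re assms r pw)
qed

text \<open>Completeness is used for the pair of a function and its gradient, so that one subsequence
  converges almost everywhere for all components at once.\<close>
definition with_grad :: "(real^'n \<Rightarrow> complex) \<Rightarrow> real^'n \<Rightarrow> complex \<times> (complex^'n)" where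
  "with_grad \<phi> x = (\<phi> x, weak_gradient \<phi> x)"

lemma norm_with_grad_diff: "(norm (with_grad \<phi> x - with_grad \<psi> x))^2 = (cmod (\<phi> x - \<psi> x))^2
     + (\<Sum>i\<in>UNIV. (cmod (weak_partial i \<phi> x - weak_partial i \<psi> x))^2)"
  by (simp add: with_grad_def weak_gradient_def norm_Pair norm_vec_def L2_set_def sum_nonneg)

lemma with_grad_component_le: "norm (fst z) \<le> norm z" "norm (snd z $ i) \<le> norm z"
  for z :: "complex \<times> (complex^'n)"
  using norm_fst_le[of "fst z" "snd z"] norm_snd_le[of "snd z" "fst z"]
    Finite_Cartesian_Product.norm_nth_le[of "snd z" i] by auto

lemma square_integrable_with_grad:
  assumes "\<phi> \<in> X_space V"
  shows "square_integrable (with_grad \<phi>)"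
proof -
  note X = X_D[OF assms]
  have m: "\<phi> \<in> borel_measurable lebesgue" "weak_partial i \<phi> \<in> borel_measurable lebesgue" for i
    using X(1,3) by (auto simp: square_integrable_def)
  have "weak_gradient \<phi> \<in> borel_measurable lebesgue"
  proof (rule borel_measurable_euclidean_space[THEN iffD2], rule ballI)
    fix b :: "complex^'n" assume "b \<in> Basis"
    then obtain i u where b: "b = axis i u" by (auto simp: Basis_vec_def)
    have "(\<lambda>x. weak_partial i \<phi> x \<bullet> u) \<in> borel_measurable lebesgue" using m by measurable
    then show "(\<lambda>x. weak_gradient \<phi> x \<bullet> b) \<in> borel_measurable lebesgue"
      by (simp add: b inner_axis weak_gradient_def)
  qed
  then have "with_grad \<phi> \<in> borel_measurable lebesgue"
    unfolding with_grad_def using m by (intro borel_measurable_Pair) auto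
  moreover have "(norm (with_grad \<phi> x))^2 = (cmod (\<phi> x))^2 + (\<Sum>i\<in>UNIV. (cmod (weak_partial i \<phi> x))^2)" for x
    by (simp add: with_grad_def weak_gradient_def norm_Pair norm_vec_def L2_set_def sum_nonneg)
  ultimately show ?thesis using X(1,3) by (auto simp: square_integrable_def)
qed

lemma minimizing_sequence_Cauchy:
  assumes F: "\<And>n. F n \<in> X_space V" and m: "\<And>\<phi>. \<phi> \<in> X_space V \<Longrightarrow> m \<le> S \<phi>"
    and SF: "\<And>n. S (F n) \<le> m + 1 / (real n + 1)" and C: "L2_Cauchy F"
  shows "L2_Cauchy (\<lambda>n. with_grad (F n))"
  unfolding L2_Cauchy_def
proof (intro allI impI)
  fix \<eta> :: real assume \<eta>: "\<eta> > 0"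
  define c where "c = (1 - \<theta>) / 2"
  have c: "c > 0" using theta by (simp add: c_def)
  \<comment> \<open>Below, \<open>D\<close> and \<open>T\<close> are the squared distances of the
    functions and of their gradients. The excesses \<open>c * \<eta> / 8\<close> of both actions
    give \<open>T \<le> \<eta> / 2 + \<bar>\<omega>\<bar> / c * D\<close>, so \<open>D + T\<close>
    is at most \<open>\<eta> / 2 + q * D\<close>, and \<open>q * D \<le> \<eta> / 2\<close>
    suffices.\<close>
  define q where "q = 1 + \<bar>\<omega>\<bar> / c"
  have q: "q > 0" using c by (simp add: q_def add_pos_nonneg)
  obtain N1 where N1: "\<And>k n. k \<ge> N1 \<Longrightarrow> n \<ge> N1 \<Longrightarrow> L2_dist2 (F k) (F n) \<le> ennreal (\<eta> / (2 * q))"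
    using C \<eta> q unfolding L2_Cauchy_def by (meson divide_pos_pos mult_pos_pos zero_less_numeral)
  obtain N2 :: nat where N2: "8 / (c * \<eta>) < real N2" using reals_Archimedean2 by blast
  have small: "S (F j) - m \<le> c * \<eta> / 8" if "j \<ge> N2" for j
  proof -
    have "8 / (c * \<eta>) < real j + 1" using N2 that by linarith
    then have "1 / (real j + 1) \<le> c * \<eta> / 8" using c \<eta> by (simp add: field_simps)
    then show ?thesis using SF[of j] by linarith
  qed
  have "L2_dist2 (with_grad (F k)) (with_grad (F n)) \<le> ennreal \<eta>" if kn: "k \<ge> max N1 N2" "n \<ge> max N1 N2" for k n
  proof -
    note X = X_D[OF F]
    have d: "integrable lebesgue (\<lambda>x. (cmod (F k x - F n x))^2)"
       "integrable lebesgue (\<lambda>x. (cmod (weak_partial i (F k) x - weak_partial i (F n) x))^2)" for i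
      using square_integrable_lincomb[OF X(1)[of k] X(1)[of n], where a=1 and b="- 1"]
         square_integrable_lincomb[OF X(3)[of _ k] X(3)[of _ n], where a=1 and b="- 1"]
      by (simp_all add: square_integrable_def)
    define D where "D = sq_int lebesgue (\<lambda>x. F k x - F n x)"
    define T where "T = (\<Sum>i\<in>UNIV. sq_int lebesgue (\<lambda>x. weak_partial i (F k) x - weak_partial i (F n) x))"
    have "ennreal D \<le> ennreal (\<eta> / (2 * q))"
      using N1[of k n] kn d(1) by (simp add: L2_dist2_def D_def nn_integral_eq_integral)
    then have "D \<le> \<eta> / (2 * q)" using \<eta> q by (subst (asm) ennreal_le_iff) auto
    then have "q * D \<le> \<eta> / 2" using q by (simp add: field_simps)
    moreover have "q * D = D + \<bar>\<omega>\<bar> / c * D" by (simp add: q_def distrib_right)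
    moreover have "c * T \<le> 2 * (S (F k) + S (F n) - 2 * m) + \<bar>\<omega>\<bar> * D"
      unfolding T_def D_def c_def by (rule gradient_diff_le[OF F F m])
    then have "c * T \<le> c * \<eta> / 2 + \<bar>\<omega>\<bar> * D" using small[of k] small[of n] kn by simp
    then have "T \<le> \<eta> / 2 + \<bar>\<omega>\<bar> / c * D" using c by (simp add: field_simps)
    ultimately have DT: "D + T \<le> \<eta>" by linarith
    have "L2_dist2 (with_grad (F k)) (with_grad (F n)) = ennreal (\<integral>x. (cmod (F k x - F n x))^2
        + (\<Sum>i\<in>UNIV. (cmod (weak_partial i (F k) x - weak_partial i (F n) x))^2) \<partial>lebesgue)"
      unfolding L2_dist2_def norm_with_grad_diff using d
      by (intro nn_integral_eq_integral) (auto intro!: add_nonneg_nonneg sum_nonneg)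
    also have "\<dots> = ennreal (D + T)" using d by (simp add: D_def T_def)
    finally show ?thesis using DT by (simp add: ennreal_leI)
  qed
  then show "\<exists>N. \<forall>m\<ge>N. \<forall>n\<ge>N. L2_dist2 (with_grad (F m)) (with_grad (F n)) \<le> ennreal \<eta>" by blast
qed

lemma X_space_limit:
  assumes F: "\<And>n. F n \<in> X_space V" and C: "L2_Cauchy (\<lambda>n. with_grad (F n))"
    and B: "\<And>n. (\<integral>x. V x * (cmod (F n x))^2 \<partial>lebesgue) \<le> B"
  obtains \<phi> r where "strict_mono (r :: nat \<Rightarrow> nat)" "\<phi> \<in> X_space V"
    "AE x in lebesgue. (\<lambda>n. F (r n) x) \<longlonglongrightarrow> \<phi> x \<and> (\<forall>i. (\<lambda>n. weak_partial i (F (r n)) x) \<longlonglongrightarrow> weak_partial i \<phi> x)"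
proof -
  note X = X_D[OF F]
  obtain L r where r: "strict_mono (r :: nat \<Rightarrow> nat)" and L: "square_integrable L"
    and ae: "AE x in lebesgue. (\<lambda>n. with_grad (F (r n)) x) \<longlonglongrightarrow> L x"
    and to0: "(\<lambda>n. L2_dist2 (with_grad (F n)) L) \<longlonglongrightarrow> 0"
    by (rule L2_complete[OF square_integrable_with_grad[OF F] C])
  define \<phi> where "\<phi> x = fst (L x)" for x
  define g where "g i x = snd (L x) $ i" for i x
  have proj: "square_integrable (\<lambda>x. P (L x))"
    if P: "continuous_on UNIV P" "\<And>z. norm (P z) \<le> norm z" for P :: "complex \<times> (complex^'n) \<Rightarrow> complex"
  proof -
    have Pm: "(\<lambda>x. P (L x)) \<in> borel_measurable lebesgue"
      using L by (auto simp: square_integrable_def intro: measurable_compose borel_measurable_continuous_onI[OF P(1)])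
    have "integrable lebesgue (\<lambda>x. (norm (L x))^2)" using L by (simp add: square_integrable_def)
    then have "integrable lebesgue (\<lambda>x. (norm (P (L x)))^2)"
    proof (rule Bochner_Integration.integrable_bound)
      show "(\<lambda>x. (norm (P (L x)))^2) \<in> borel_measurable lebesgue" using Pm by measurable
    qed (auto simp: P(2) intro!: AE_I2 power_mono)
    then show ?thesis using Pm by (simp add: square_integrable_def)
  qed
  have \<phi>g: "square_integrable \<phi>" "square_integrable (g i)" for i
    unfolding \<phi>_def g_def by (intro proj with_grad_component_le continuous_intros)+
  have lim0: "(\<lambda>n. sq_int lebesgue (h n)) \<longlonglongrightarrow> 0"
    if i: "\<And>n. integrable lebesgue (\<lambda>x. (norm (h n x))^2)" and le: "\<And>n x. norm (h n x) \<le> norm (with_grad (F n) x - L x)"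
    for h :: "nat \<Rightarrow> real^'n \<Rightarrow> complex"
  proof -
    have "ennreal (sq_int lebesgue (h n)) \<le> L2_dist2 (with_grad (F n)) L" for n
      unfolding nn_integral_eq_integral[OF i, simplified, symmetric] L2_dist2_def
      by (intro nn_integral_mono ennreal_leI power_mono le) auto
    then have "(\<lambda>n. ennreal (sq_int lebesgue (h n))) \<longlonglongrightarrow> 0"
      by (intro tendsto_sandwich[OF _ _ tendsto_const to0]) auto
    then show ?thesis by (subst (asm) tendsto_ennreal_iff[of _ _ 0, simplified]) auto
  qed
  have wp: "has_weak_partial i \<phi> (g i)" for i
  proof (rule has_weak_partial_L2_limit[of i F "\<lambda>n. weak_partial i (F n)"])
    show "has_weak_partial i (F n) (weak_partial i (F n))" for n by (rule X(2))
    show "\<phi> \<in> borel_measurable lebesgue" "g i \<in> borel_measurable lebesgue"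
      "integrable lebesgue (\<lambda>x. (cmod (\<phi> x))^2)" "integrable lebesgue (\<lambda>x. (cmod (g i x))^2)"
      using \<phi>g by (auto simp: square_integrable_def)
    show 1: "integrable lebesgue (\<lambda>x. (cmod (F n x - \<phi> x))^2)" for n
      using square_integrable_lincomb[OF X(1)[of n] \<phi>g(1), where a=1 and b="- 1"] by (simp add: square_integrable_def)
    show 2: "integrable lebesgue (\<lambda>x. (cmod (weak_partial i (F n) x - g i x))^2)" for n
      using square_integrable_lincomb[OF X(3)[of _ n] \<phi>g(2), where a=1 and b="- 1"] by (simp add: square_integrable_def)
    show "(\<lambda>n. sq_int lebesgue (\<lambda>x. F n x - \<phi> x)) \<longlonglongrightarrow> 0"
      using with_grad_component_le(1)[of "with_grad (F _) _ - L _"]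
      by (intro lim0 1) (simp add: with_grad_def \<phi>_def)
    show "(\<lambda>n. sq_int lebesgue (\<lambda>x. weak_partial i (F n) x - g i x)) \<longlonglongrightarrow> 0"
      using with_grad_component_le(2)[where i=i and z="with_grad (F _) _ - L _"]
      by (intro lim0 2) (simp add: with_grad_def weak_gradient_def g_def)
  qed
  have conv: "AE x in lebesgue. (\<lambda>n. F (r n) x) \<longlonglongrightarrow> \<phi> x \<and> (\<forall>i. (\<lambda>n. weak_partial i (F (r n)) x) \<longlonglongrightarrow> g i x)"
    using ae
  proof eventually_elim
    case (elim x)
    have "(\<lambda>n. fst (with_grad (F (r n)) x)) \<longlonglongrightarrow> \<phi> x" unfolding \<phi>_def by (intro tendsto_intros elim)
    moreover have "(\<lambda>n. snd (with_grad (F (r n)) x) $ i) \<longlonglongrightarrow> g i x" for i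
      unfolding g_def by (intro tendsto_intros elim)
    ultimately show ?case by (simp add: with_grad_def weak_gradient_def)
  qed
  \<comment> \<open>As \<open>V\<close> may fail to be measurable,
    \<open>V x * (cmod (\<phi> x))^2\<close> is measurable only by being an almost everywhere limit
    of the integrable functions \<open>W n\<close>. Fatou's lemma then bounds its integral by
    \<open>B\<close>.\<close>
  define W where "W n x = V x * (cmod (F (r n) x))^2" for n x
  have Wi: "integrable lebesgue (W n)" for n unfolding W_def by (rule X(4))
  have Wm [measurable]: "W n \<in> borel_measurable lebesgue" for n by (rule borel_measurable_integrable[OF Wi])
  have Wl: "AE x in lebesgue. (\<lambda>n. W n x) \<longlonglongrightarrow> V x * (cmod (\<phi> x))^2"
    using conv by eventually_elim (auto simp: W_def intro!: tendsto_intros)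
  have "(\<lambda>x. lim (\<lambda>n. W n x)) \<in> borel_measurable lebesgue" by measurable
  moreover have "AE x in lebesgue. lim (\<lambda>n. W n x) = V x * (cmod (\<phi> x))^2"
    using Wl by eventually_elim (rule limI)
  ultimately have m: "(\<lambda>x. V x * (cmod (\<phi> x))^2) \<in> borel_measurable lebesgue"
    by (rule lebesgue_measurable_cong_AE)
  have "(\<integral>\<^sup>+x. ennreal (V x * (cmod (\<phi> x))^2) \<partial>lebesgue) \<le> ennreal B"
  proof (rule nn_integral_Fatou_le[where u="\<lambda>n x. ennreal (W n x)"])
    show "AE x in lebesgue. (\<lambda>n. ennreal (W n x)) \<longlonglongrightarrow> ennreal (V x * (cmod (\<phi> x))^2)"
      using Wl by eventually_elim (rule tendsto_ennrealI)
    show "(\<integral>\<^sup>+x. ennreal (W n x) \<partial>lebesgue) \<le> ennreal B" for n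
      using B[of "r n"] nn_integral_eq_integral[OF Wi[of n]] by (simp add: W_def[abs_def] V_nonneg ennreal_leI)
  qed measurable
  then have "integrable lebesgue (\<lambda>x. V x * (cmod (\<phi> x))^2)"
    using m V_nonneg unfolding integrable_iff_bounded by (auto intro: le_less_trans)
  then have "\<phi> \<in> X_space V"
    using H1_I(1)[OF \<phi>g(1) wp \<phi>g(2)] by (simp add: X_space_def L2V_space_def)
  moreover have "AE x in lebesgue. \<forall>i. weak_partial i \<phi> x = g i x"
    using H1_I(2)[OF \<phi>g(1) wp \<phi>g(2)] by (simp add: AE_all_countable)
  then have "AE x in lebesgue. (\<lambda>n. F (r n) x) \<longlonglongrightarrow> \<phi> x \<and> (\<forall>i. (\<lambda>n. weak_partial i (F (r n)) x) \<longlonglongrightarrow> weak_partial i \<phi> x)"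
    using conv by eventually_elim simp
  ultimately show ?thesis using that r by blast
qed

text \<open>The density may be negative, so Fatou's lemma is applied to \<open>energy + I\<close>,
  which \<open>energy_lower_bound\<close> makes nonnegative; the integral of \<open>I\<close>
  cancels in the end.\<close>

lemma action_lower_semicontinuous:
  assumes F: "\<And>n. F n \<in> X_space V" and \<phi>: "\<phi> \<in> X_space V"
    and conv: "AE x in lebesgue. (\<lambda>n. F n x) \<longlonglongrightarrow> \<phi> x \<and> (\<forall>i. (\<lambda>n. weak_partial i (F n) x) \<longlonglongrightarrow> weak_partial i \<phi> x)"
    and le: "\<And>n. S (F n) \<le> B"
  shows "S \<phi> \<le> B"
proof -
  obtain I where I: "integrable lebesgue I" and low: "\<And>x a v.
     (1 - \<theta>) / 2 * (\<Sum>i\<in>UNIV. (cmod (v i))^2) + (1 - \<theta>) / 2 * (V x * (cmod a)^2) + (cmod a)^2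
      \<le> energy x a v + I x" by (rule energy_lower_bound) (rule that)
  have E0: "0 \<le> energy x a v + I x" for x a v
  proof (rule order_trans[OF _ low])
    show "0 \<le> (1 - \<theta>) / 2 * (\<Sum>i\<in>UNIV. (cmod (v i))^2) + (1 - \<theta>) / 2 * (V x * (cmod a)^2) + (cmod a)^2"
      using theta V_nonneg[of x] by (intro add_nonneg_nonneg mult_nonneg_nonneg sum_nonneg) auto
  qed
  have int: "integrable lebesgue (\<lambda>x. energy x (\<psi> x) (grad \<psi> x) + I x)"
    "(\<integral>\<^sup>+x. ennreal (energy x (\<psi> x) (grad \<psi> x) + I x) \<partial>lebesgue) = ennreal (S \<psi> + (\<integral>x. I x \<partial>lebesgue))"
    "0 \<le> S \<psi> + (\<integral>x. I x \<partial>lebesgue)" if "\<psi> \<in> X_space V" for \<psi>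
  proof -
    have S: "S \<psi> + (\<integral>x. I x \<partial>lebesgue) = (\<integral>x. energy x (\<psi> x) (grad \<psi> x) + I x \<partial>lebesgue)"
      unfolding action_eq(1)[OF that] using energy_integrable(1)[OF that] I by simp
    show i: "integrable lebesgue (\<lambda>x. energy x (\<psi> x) (grad \<psi> x) + I x)"
      using energy_integrable(1)[OF that] I by simp
    show "(\<integral>\<^sup>+x. ennreal (energy x (\<psi> x) (grad \<psi> x) + I x) \<partial>lebesgue) = ennreal (S \<psi> + (\<integral>x. I x \<partial>lebesgue))"
      unfolding S using E0 by (intro nn_integral_eq_integral i) auto
    show "0 \<le> S \<psi> + (\<integral>x. I x \<partial>lebesgue)"
      unfolding S by (intro Bochner_Integration.integral_nonneg E0)
  qed
  have "ennreal (S \<phi> + (\<integral>x. I x \<partial>lebesgue)) \<le> ennreal (B + (\<integral>x. I x \<partial>lebesgue))"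
    unfolding int(2)[OF \<phi>, symmetric]
  proof (rule nn_integral_Fatou_le[where u="\<lambda>n x. ennreal (energy x (F n x) (grad (F n) x) + I x)"])
    show "(\<lambda>x. ennreal (energy x (F n x) (grad (F n) x) + I x)) \<in> borel_measurable lebesgue" for n
      using borel_measurable_integrable[OF int(1)[OF F]] by measurable
    show "AE x in lebesgue. (\<lambda>n. ennreal (energy x (F n x) (grad (F n) x) + I x))
      \<longlonglongrightarrow> ennreal (energy x (\<phi> x) (grad \<phi> x) + I x)"
      using conv by eventually_elim (intro tendsto_ennrealI tendsto_add tendsto_const energy_tendsto; simp)
    show "(\<integral>\<^sup>+x. ennreal (energy x (F n x) (grad (F n) x) + I x) \<partial>lebesgue) \<le> ennreal (B + (\<integral>x. I x \<partial>lebesgue))" for n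
      unfolding int(2)[OF F] using le by (intro ennreal_leI) simp
  qed
  moreover have "0 \<le> B + (\<integral>x. I x \<partial>lebesgue)" using int(3)[OF F[of 0]] le[of 0] by linarith
  ultimately show ?thesis by (subst (asm) ennreal_le_iff) auto
qed

lemma minimizer_exists:
  assumes ne: "X_space V \<noteq> {}"
  obtains \<phi> where "\<phi> \<in> X_space V" "\<And>\<psi>. \<psi> \<in> X_space V \<Longrightarrow> S \<phi> \<le> S \<psi>"
proof -
  define c where "c = (1 - \<theta>) / 2"
  have c: "c > 0" using theta by (simp add: c_def)
  obtain K where low: "\<And>\<phi>. \<phi> \<in> X_space V \<Longrightarrow>
     c * (\<Sum>i\<in>UNIV. sq_int lebesgue (weak_partial i \<phi>))
      + c * (\<integral>x. V x * (cmod (\<phi> x))^2 \<partial>lebesgue) + sq_int lebesgue \<phi> \<le> S \<phi> + K"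
    unfolding c_def using minimizing_sequence_bounds by blast
  have nonneg: "0 \<le> sq_int lebesgue \<phi>" "0 \<le> c * (\<integral>x. V x * (cmod (\<phi> x))^2 \<partial>lebesgue)"
    "0 \<le> c * (\<Sum>i\<in>UNIV. sq_int lebesgue (weak_partial i \<phi>))" for \<phi> :: "real^'n \<Rightarrow> complex"
    using V_nonneg c by (auto intro!: mult_nonneg_nonneg sum_nonneg)
  have lowS: "- K \<le> S \<phi>" if "\<phi> \<in> X_space V" for \<phi>
    using low[OF that] nonneg[of \<phi>] by linarith
  define m where "m = Inf (S ` X_space V)"
  have m: "m \<le> S \<phi>" if "\<phi> \<in> X_space V" for \<phi>
    unfolding m_def using that lowS by (intro cInf_lower) (auto intro!: bdd_belowI)
  have "\<exists>\<phi>\<in>X_space V. S \<phi> < m + 1 / (real n + 1)" for n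
  proof -
    have "Inf (S ` X_space V) < m + 1 / (real n + 1)" by (simp add: m_def add_pos_pos)
    then show ?thesis using ne by (auto dest!: cInf_lessD[rotated])
  qed
  then obtain F0 where F0: "\<And>n. F0 n \<in> X_space V" "\<And>n. S (F0 n) < m + 1 / (real n + 1)" by metis
  \<comment> \<open>The gradient and potential terms carry the factor \<open>c\<close> in
    \<open>low\<close>, the square norm the factor \<open>1\<close>; the maximum bounds all three at
    once.\<close>
  define B where "B = max 1 (1 / c) * (m + 1 + K)"
  have S1: "S (F0 n) \<le> m + 1" for n
  proof -
    have "1 / (real n + 1) \<le> 1" by simp
    then show ?thesis using F0(2)[of n] by linarith
  qed
  have mK: "0 \<le> m + 1 + K" using lowS[OF F0(1)[of 0]] S1[of 0] by linarith
  have bnd: "(\<Sum>i\<in>UNIV. sq_int lebesgue (weak_partial i (F0 n))) \<le> B"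
      "(\<integral>x. V x * (cmod (F0 n x))^2 \<partial>lebesgue) \<le> B" "sq_int lebesgue (F0 n) \<le> B" for n
  proof -
    have B: "y \<le> B" if "c * y \<le> m + 1 + K" for y
    proof -
      have "y \<le> 1 / c * (m + 1 + K)" using that c by (simp add: field_simps)
      also have "\<dots> \<le> B" unfolding B_def using mK by (intro mult_right_mono) auto
      finally show ?thesis .
    qed
    note l = low[OF F0(1)[of n]] S1[of n] nonneg[of "F0 n"]
    show "(\<Sum>i\<in>UNIV. sq_int lebesgue (weak_partial i (F0 n))) \<le> B"
      "(\<integral>x. V x * (cmod (F0 n x))^2 \<partial>lebesgue) \<le> B"
      by (rule B, use l in linarith)+
    have "m + 1 + K \<le> B" unfolding B_def using mult_right_mono[of 1 "max 1 (1 / c)", OF _ mK] by simp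
    then show "sq_int lebesgue (F0 n) \<le> B" using l by linarith
  qed
  have "B \<ge> 0" using bnd(3)[of 0] nonneg(1)[of "F0 0"] by linarith
  then obtain r0 where r0: "strict_mono (r0 :: nat \<Rightarrow> nat)" and C0: "L2_Cauchy (\<lambda>n. F0 (r0 n))"
    by (rule bounded_imp_L2_Cauchy_subseq[OF F0(1) _ bnd])
  define F where "F n = F0 (r0 n)" for n
  have F: "F n \<in> X_space V" for n by (simp add: F_def F0)
  have inv: "1 / (real (s n) + 1) \<le> 1 / (real n + 1)" if "strict_mono s" for s :: "nat \<Rightarrow> nat" and n
    using strict_mono_imp_increasing[OF that, of n] by (intro divide_left_mono) auto
  have SF: "S (F n) \<le> m + 1 / (real n + 1)" for n
    using F0(2)[of "r0 n"] inv[OF r0, of n] by (simp add: F_def)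
  have "L2_Cauchy (\<lambda>n. with_grad (F n))"
    by (rule minimizing_sequence_Cauchy[OF F m SF]) (use C0 in \<open>simp_all add: F_def[abs_def]\<close>)
  then obtain \<phi> r where r: "strict_mono (r :: nat \<Rightarrow> nat)" and \<phi>: "\<phi> \<in> X_space V"
    and conv: "AE x in lebesgue. (\<lambda>n. F (r n) x) \<longlonglongrightarrow> \<phi> x \<and> (\<forall>i. (\<lambda>n. weak_partial i (F (r n)) x) \<longlonglongrightarrow> weak_partial i \<phi> x)"
    by (rule X_space_limit[OF F]) (use bnd(2) in \<open>simp_all add: F_def\<close>)
  \<comment> \<open>Semicontinuity is stated for a uniform bound, so it is applied to the tail from
    index \<open>N\<close> on, where the actions stay below this value; then \<open>N\<close> tends
    to infinity.\<close>
  have "S \<phi> \<le> m + 1 / (real N + 1)" for N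
  proof (rule action_lower_semicontinuous[where F="\<lambda>n. F (r (n + N))", OF F \<phi>])
    show "AE x in lebesgue. (\<lambda>n. F (r (n + N)) x) \<longlonglongrightarrow> \<phi> x
        \<and> (\<forall>i. (\<lambda>n. weak_partial i (F (r (n + N))) x) \<longlonglongrightarrow> weak_partial i \<phi> x)"
      using conv by eventually_elim (auto intro: LIMSEQ_ignore_initial_segment)
    fix n
    have "1 / (real (n + N) + 1) \<le> 1 / (real N + 1)" by (intro divide_left_mono) auto
    then show "S (F (r (n + N))) \<le> m + 1 / (real N + 1)"
      using SF[of "r (n + N)"] inv[OF r, of "n + N"] by linarith
  qed
  moreover have "(\<lambda>N. m + 1 / (real N + 1)) \<longlonglongrightarrow> m + 0"
    using LIMSEQ_inverse_real_of_nat by (intro tendsto_add tendsto_const) (simp add: inverse_eq_divide add.commute)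
  ultimately have "S \<phi> \<le> m" by (intro LIMSEQ_le_const[of "\<lambda>N. m + 1 / (real N + 1)"]) auto
  then show ?thesis using that \<phi> m order_trans by blast
qed

subsection \<open>The Nehari manifold\<close>

lemma action_scaling:
  assumes "\<phi> \<in> X_space V" and t: "t > 0"
  shows "(\<lambda>x. of_real t * \<phi> x) \<in> X_space V"
    and "S (\<lambda>x. of_real t * \<phi> x) = t^2 * ((\<integral>x. quad x (\<phi> x) (grad \<phi> x) \<partial>lebesgue)
        + \<omega> * sq_int lebesgue \<phi>)
      + t powr (p + 1) * (2 * \<beta> / (p + 1) * (\<integral>x. cmod (\<phi> x) powr (p + 1) \<partial>lebesgue))"
proof -
  let ?\<psi> = "\<lambda>x. of_real t * \<phi> x"
  have \<psi>: "?\<psi> \<in> X_space V"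
    and w: "AE x in lebesgue. weak_partial i ?\<psi> x = of_real t * weak_partial i \<phi> x" for i
    using X_space_lincomb[OF V_nonneg assms(1) assms(1), where a="of_real t" and b=0] by simp_all
  show "?\<psi> \<in> X_space V" by (rule \<psi>)
  have q: "quad x (of_real t * a) (\<lambda>i. of_real t * v i) = t^2 * quad x a v" for x a v
  proof -
    have "rot_form e x (of_real t * a) (\<lambda>i. of_real t * v i) = of_real (t^2) * rot_form e x a v"
      by (simp add: rot_form_def power2_eq_square algebra_simps)
    then have "Re (rot_form e x (of_real t * a) (\<lambda>i. of_real t * v i)) = t^2 * Re (rot_form e x a v)"
      by (simp del: of_real_power)
    then show ?thesis
      by (simp add: quad_def norm_mult power_mult_distrib sum_distrib_left[symmetric] algebra_simps)
  qed
  have "S ?\<psi> = (\<integral>x. t^2 * quad x (\<phi> x) (grad \<phi> x) \<partial>lebesgue)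
     + 2 * \<beta> / (p + 1) * (\<integral>x. t powr (p + 1) * cmod (\<phi> x) powr (p + 1) \<partial>lebesgue)
     + \<omega> * (\<integral>x. t^2 * (cmod (\<phi> x))^2 \<partial>lebesgue)"
    using t unfolding action_eq(2)[OF \<psi>] energy_integral_cong(2)[OF \<psi> w] q
    by (simp add: norm_mult power_mult_distrib powr_mult)
  then show "S ?\<psi> = t^2 * ((\<integral>x. quad x (\<phi> x) (grad \<phi> x) \<partial>lebesgue)
        + \<omega> * sq_int lebesgue \<phi>)
      + t powr (p + 1) * (2 * \<beta> / (p + 1) * (\<integral>x. cmod (\<phi> x) powr (p + 1) \<partial>lebesgue))"
    by (simp add: algebra_simps)
qed

text \<open>The derivative of \<open>t \<mapsto> S (t \<phi>)\<close> at \<open>t = 1\<close> is twice the Nehari functional.\<close>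
lemma nehari_minimizer:
  assumes \<phi>: "\<phi> \<in> X_space V" and min: "\<And>\<psi>. \<psi> \<in> X_space V \<Longrightarrow> S \<phi> \<le> S \<psi>"
  shows "nehari e V \<beta> p \<Omega> \<omega> \<phi> = 0"
proof -
  define A where "A = (\<integral>x. quad x (\<phi> x) (grad \<phi> x) \<partial>lebesgue) + \<omega> * sq_int lebesgue \<phi>"
  define N where "N = (\<integral>x. cmod (\<phi> x) powr (p + 1) \<partial>lebesgue)"
  define h where "h t = t^2 * A + t powr (p + 1) * (2 * \<beta> / (p + 1) * N)" for t
  have h: "S (\<lambda>x. of_real t * \<phi> x) = h t" if "t > 0" for t
    using action_scaling(2)[OF \<phi> that] by (simp add: h_def A_def N_def)
  have h1: "S \<phi> = h 1" using h[of 1] by simp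
  have "(h has_real_derivative (2 * A + (p + 1) * (2 * \<beta> / (p + 1) * N))) (at 1)"
    unfolding h_def by (auto intro!: derivative_eq_intros)
  \<comment> \<open>The radius \<open>1\<close> keeps \<open>y\<close> positive, where the scaling
    formula holds.\<close>
  moreover have "\<forall>y. \<bar>1 - y\<bar> < 1 \<longrightarrow> h 1 \<le> h y"
  proof (intro allI impI)
    fix y :: real assume "\<bar>1 - y\<bar> < 1"
    then have "y > 0" by linarith
    then show "h 1 \<le> h y" using min[OF action_scaling(1)[OF \<phi>]] h h1 by metis
  qed
  ultimately have "2 * A + (p + 1) * (2 * \<beta> / (p + 1) * N) = 0"
    by (intro DERIV_local_min[of h _ 1 1]) auto
  then have "A + \<beta> * N = 0" using p_gt by simp
  then show ?thesis unfolding action_eq(3)[OF \<phi>] A_def N_def by simp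
qed

text \<open>Since \<open>p + 1 > 2\<close>, the negative quadratic part outweighs the power term on
  small multiples of \<open>u\<close>.\<close>

lemma negative_action:
  assumes u: "u \<in> X_space V"
    and neg: "(\<integral>x. quad x (u x) (grad u x) \<partial>lebesgue) + \<omega> * sq_int lebesgue u < 0"
  obtains \<psi> where "\<psi> \<in> X_space V" "S \<psi> < 0"
proof -
  define A where "A = (\<integral>x. quad x (u x) (grad u x) \<partial>lebesgue) + \<omega> * sq_int lebesgue u"
  define N where "N = 2 * \<beta> / (p + 1) * (\<integral>x. cmod (u x) powr (p + 1) \<partial>lebesgue)"
  have N: "N \<ge> 0" unfolding N_def using beta p_gt by (intro mult_nonneg_nonneg) auto
  \<comment> \<open>\<open>y\<close> is the value wanted for \<open>t powr (p - 1)\<close>: it makes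
    the power term at most half of \<open>- A\<close>. Using \<open>N + 1\<close> avoids a division
    by zero when \<open>N = 0\<close>.\<close>
  define y where "y = - A / (2 * (N + 1))"
  define t where "t = y powr (1 / (p - 1))"
  have pos: "y > 0" using neg N unfolding A_def[symmetric] y_def by (intro divide_pos_pos) auto
  have t: "t > 0" using pos by (simp add: t_def)
  have tp: "t powr (p - 1) = y" using pos p_gt by (simp add: t_def powr_powr)
  have "t powr (p + 1) = t^2 * t powr (p - 1)"
  proof -
    have "t^2 = t powr 2" using t by simp
    then show ?thesis by (simp add: powr_add[symmetric] add.commute)
  qed
  then have "S (\<lambda>x. of_real t * u x) = t^2 * (A + t powr (p - 1) * N)"
    using action_scaling(2)[OF u t] by (simp add: A_def N_def algebra_simps)
  also have "\<dots> < 0"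
  proof -
    have "t powr (p - 1) * N \<le> t powr (p - 1) * (N + 1)" by (intro mult_left_mono) auto
    also have "\<dots> = - A / 2" unfolding tp y_def using N by (simp add: field_simps)
    finally have "A + t powr (p - 1) * N < 0" using neg unfolding A_def[symmetric] by linarith
    then show ?thesis using t by (simp add: mult_pos_neg)
  qed
  finally show ?thesis using that action_scaling(1)[OF u t] by blast
qed

text \<open>At the value \<open>0\<close> the density reduces to half the squared gradient, which is
  nonnegative for any choice of the weak partials. Hence a function with negative action is nonzero
  in the sense required by the manifold.\<close>

lemma action_nonneg_if_zero:
  assumes \<phi>: "\<phi> \<in> X_space V" and z: "AE x in lebesgue. \<phi> x = 0"
  shows "0 \<le> S \<phi>"
  unfolding action_eq(1)[OF \<phi>]
proof (rule integral_nonneg_AE, use z in eventually_elim)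
  case (elim x)
  then show ?case by (simp add: energy_def quad_def rot_form_def sum_nonneg)
qed

lemma ground_state_exists:
  assumes u: "u \<in> X_space V"
    and neg: "(\<integral>x. quad x (u x) (grad u x) \<partial>lebesgue) + \<omega> * sq_int lebesgue u < 0"
  shows "\<exists>\<phi>\<^sub>g \<in> X_space V.
      ereal (S \<phi>\<^sub>g) = (INF \<phi> \<in> X_space V. ereal (S \<phi>))
    \<and> (INF \<phi> \<in> X_space V. ereal (S \<phi>)) = (INF \<phi> \<in> nehari_manifold e V \<beta> p \<Omega> \<omega>. ereal (S \<phi>))"
proof -
  obtain \<phi> where \<phi>: "\<phi> \<in> X_space V" and min: "\<And>\<psi>. \<psi> \<in> X_space V \<Longrightarrow> S \<phi> \<le> S \<psi>"
    using minimizer_exists u by blast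
  obtain \<psi> where "\<psi> \<in> X_space V" "S \<psi> < 0" by (rule negative_action[OF u neg])
  then have "S \<phi> < 0" using min[of \<psi>] by linarith
  then have "\<not> (AE x in lebesgue. \<phi> x = 0)" using action_nonneg_if_zero[OF \<phi>] by auto
  then have M: "\<phi> \<in> nehari_manifold e V \<beta> p \<Omega> \<omega>"
    using \<phi> nehari_minimizer[OF \<phi> min] by (simp add: nehari_manifold_def)
  have sub: "nehari_manifold e V \<beta> p \<Omega> \<omega> \<subseteq> X_space V" by (auto simp: nehari_manifold_def)
  \<comment> \<open>A minimizer over the whole space attains the infimum over every subset that
    contains it; this serves both for the whole space and for the Nehari manifold.\<close>
  have "(INF \<phi> \<in> A. ereal (S \<phi>)) = ereal (S \<phi>)" if "\<phi> \<in> A" "A \<subseteq> X_space V" for A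
    using that min by (intro antisym INF_lower INF_greatest) auto
  from this[OF \<phi>] this[OF M sub] show ?thesis using \<phi> by (intro bexI[of _ \<phi>]) auto
qed

end

section \<open>The two cases of the potential\<close>

lemma subcritical_exponent:
  fixes d :: nat and p :: real
  assumes "d \<ge> 1" "1 < p" "d \<ge> 3 \<longrightarrow> p < (real d + 2) / (real d - 2)"
  shows "p + 1 < 2 + 2 * (p + 1) / real d"
proof -
  \<comment> \<open>The claim says that the exponent \<open>T = p + 1\<close> lies below its own
    improved value \<open>2 + 2 * T / d\<close>. In dimensions one and two this holds for every such
    \<open>p\<close>; from three on it is equivalent to the bound on \<open>p\<close>.\<close>
  consider "d = 1" | "d = 2" | "d \<ge> 3" using assms(1) by linarith
  then show ?thesis
  proof cases
    case 3
    then have "p * (real d - 2) < real d + 2" using assms(3) by (simp add: field_simps)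
    then have "(p + 1) * real d < 2 * real d + 2 * (p + 1)" by (simp add: algebra_simps)
    then have "p + 1 < (2 * real d + 2 * (p + 1)) / real d" using 3 by (simp add: pos_less_divide_eq)
    also have "\<dots> = 2 + 2 * (p + 1) / real d" using 3 by (simp add: add_divide_distrib)
    finally show ?thesis .
  qed (use assms in \<open>auto simp: field_simps\<close>)
qed

lemma action_functional_confining:
  fixes V :: "real^'n::finite \<Rightarrow> real"
  assumes "\<beta> > 0" "p > 1" "CARD('n) \<ge> 3 \<longrightarrow> p < (real CARD('n) + 2) / (real CARD('n) - 2)"
    and "\<And>x. V x \<ge> 0" "filterlim V at_top at_infinity"
  shows "action_functional e V \<beta> p 0 0"
  using assms subcritical_exponent[of "CARD('n)" p] by unfold_locales (auto simp: Suc_le_eq)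

text \<open>Young's inequality with \<open>g = min (\<gamma> 1) (\<gamma> 2)\<close>: each product
  such as \<open>v1 * (g * x2 * s)\<close> is at most half the sum of the squares, that is, gradient
  plus a part of the potential. Replacing \<open>g\<close> by \<open>\<bar>\<Omega>\<bar>\<close>
  gains exactly the factor \<open>\<theta> = \<bar>\<Omega>\<bar> / g\<close>.\<close>

lemma action_functional_harmonic:
  fixes V :: "real^'n::finite \<Rightarrow> real"
  assumes coords: "bij_betw e {1..CARD('n)} UNIV"
    and "\<beta> > 0" "p > 1" "CARD('n) \<ge> 3 \<longrightarrow> p < (real CARD('n) + 2) / (real CARD('n) - 2)"
    and d: "CARD('n) \<ge> 2" and \<gamma>: "\<And>j. j \<in> {1..CARD('n)} \<Longrightarrow> \<gamma> j > 0"
    and V: "\<And>x. V x = 1 / 2 * (\<Sum>j=1..CARD('n). (\<gamma> j)^2 * (x $ e j)^2)"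
    and \<Omega>: "\<bar>\<Omega>\<bar> < min (\<gamma> 1) (\<gamma> 2)"
  shows "action_functional e V \<beta> p \<Omega> (\<bar>\<Omega>\<bar> / min (\<gamma> 1) (\<gamma> 2))"
proof
  let ?d = "CARD('n)"
  define g where "g = min (\<gamma> 1) (\<gamma> 2)"
  have g: "g > 0" using \<gamma>[of 1] \<gamma>[of 2] d by (simp add: g_def)
  show "\<beta> > 0" "p > 1" by fact+
  show "p + 1 < 2 + 2 * (p + 1) / real ?d"
    using assms by (intro subcritical_exponent) auto
  show V0: "V x \<ge> 0" for x unfolding V by (auto intro!: sum_nonneg)
  show "0 \<le> \<bar>\<Omega>\<bar> / min (\<gamma> 1) (\<gamma> 2)" "\<bar>\<Omega>\<bar> / min (\<gamma> 1) (\<gamma> 2) < 1"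
    using g \<Omega> unfolding g_def[symmetric] by auto
  show "filterlim V at_top at_infinity"
  proof -
    \<comment> \<open>With the smallest squared frequency \<open>k\<close>, the potential is at
      least \<open>1 / 2 * k * (norm x)^2\<close>; all frequencies enter here, the rotation bound
      uses the first two.\<close>
    define k where "k = Min ((\<lambda>j. (\<gamma> j)^2) ` {1..?d})"
    have fin: "finite ((\<lambda>j. (\<gamma> j)^2) ` {1..?d})" "(\<lambda>j. (\<gamma> j)^2) ` {1..?d} \<noteq> {}" using d by auto
    have "k \<in> (\<lambda>j. (\<gamma> j)^2) ` {1..?d}" unfolding k_def by (rule Min_in[OF fin])
    then obtain j where "j \<in> {1..?d}" "k = (\<gamma> j)^2" by blast
    then have k: "k > 0" using \<gamma>[of j] by simp
    have "1 / 2 * k * (norm x)^2 \<le> V x" for x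
    proof -
      have "(norm x)^2 = (\<Sum>i\<in>UNIV. (x $ i)^2)" by (simp add: norm_vec_def L2_set_def sum_nonneg)
      also have "\<dots> = (\<Sum>j=1..?d. (x $ e j)^2)"
        by (rule sum.reindex_bij_betw[OF coords, symmetric])
      finally have "k * (norm x)^2 = (\<Sum>j=1..?d. k * (x $ e j)^2)" by (simp add: sum_distrib_left)
      also have "\<dots> \<le> (\<Sum>j=1..?d. (\<gamma> j)^2 * (x $ e j)^2)"
        unfolding k_def by (intro sum_mono mult_right_mono Min_le[OF fin(1)]) auto
      finally show ?thesis unfolding V by simp
    qed
    moreover have "filterlim (\<lambda>x::real^'n. 1 / 2 * k * (norm x)^2) at_top at_infinity"
      using k by (intro filterlim_tendsto_pos_mult_at_top[OF tendsto_const] filterlim_pow_at_top filterlim_norm_at_top) auto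
    ultimately show ?thesis by (intro filterlim_at_top_mono[where g=V]) auto
  qed
  fix x :: "real^'n" and a and v :: "'n \<Rightarrow> complex"
  define \<theta> where "\<theta> = \<bar>\<Omega>\<bar> / g"
  have \<theta>: "\<theta> \<ge> 0" "\<bar>\<Omega>\<bar> = \<theta> * g" using g by (auto simp: \<theta>_def)
  have e12: "e 1 \<noteq> e 2"
  proof
    assume "e 1 = e 2"
    then have "(1::nat) = 2" by (rule inj_onD[OF bij_betw_imp_inj_on[OF coords]]) (use d in auto)
    then show False by simp
  qed
  define s where "s = cmod a"
  define x1 x2 v1 v2 where "x1 = \<bar>x $ e 1\<bar>" and "x2 = \<bar>x $ e 2\<bar>" and "v1 = cmod (v (e 1))" and "v2 = cmod (v (e 2))"
  have grad: "v1^2 + v2^2 \<le> (\<Sum>i\<in>UNIV. (cmod (v i))^2)"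
  proof -
    have "v1^2 + v2^2 = (\<Sum>i\<in>{e 1, e 2}. (cmod (v i))^2)" using e12 by (simp add: v1_def v2_def)
    also have "\<dots> \<le> (\<Sum>i\<in>UNIV. (cmod (v i))^2)" by (intro sum_mono2) auto
    finally show ?thesis .
  qed
  have pot: "1 / 2 * (g^2 * x1^2 + g^2 * x2^2) \<le> V x"
  proof -
    have "g^2 \<le> (\<gamma> 1)^2" "g^2 \<le> (\<gamma> 2)^2" using g by (auto simp: g_def intro!: power_mono)
    then have "g^2 * x1^2 + g^2 * x2^2 \<le> (\<gamma> 1)^2 * x1^2 + (\<gamma> 2)^2 * x2^2"
      by (intro add_mono mult_right_mono) auto
    also have "\<dots> = (\<Sum>j\<in>{1, 2}. (\<gamma> j)^2 * (x $ e j)^2)" by (simp add: x1_def x2_def)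
    also have "\<dots> \<le> (\<Sum>j=1..?d. (\<gamma> j)^2 * (x $ e j)^2)"
      using d by (intro sum_mono2) auto
    finally show ?thesis unfolding V by simp
  qed
  have "cmod (rot_form e x a v) \<le> s * (x2 * v1 + x1 * v2)"
  proof -
    have "cmod (of_real (x $ e 2) * v (e 1) - of_real (x $ e 1) * v (e 2)) \<le> x2 * v1 + x1 * v2"
      using norm_triangle_ineq4[of "of_real (x $ e 2) * v (e 1)" "of_real (x $ e 1) * v (e 2)"]
      by (simp add: norm_mult x1_def x2_def v1_def v2_def)
    then show ?thesis using d by (simp add: rot_form_def norm_mult s_def mult_left_mono)
  qed
  then have "\<bar>\<Omega>\<bar> * cmod (rot_form e x a v) \<le> \<theta> * g * (s * (x2 * v1 + x1 * v2))"
    using \<theta> g by (simp add: mult_left_mono)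
  also have "\<dots> = \<theta> * (v1 * (g * x2 * s) + v2 * (g * x1 * s))" by (simp add: algebra_simps)
  also have "\<dots> \<le> \<theta> * (1 / 2 * (v1^2 + v2^2) + 1 / 2 * (g^2 * x1^2 + g^2 * x2^2) * s^2)"
  proof (rule mult_left_mono[OF _ \<theta>(1)])
    show "v1 * (g * x2 * s) + v2 * (g * x1 * s) \<le> 1 / 2 * (v1^2 + v2^2) + 1 / 2 * (g^2 * x1^2 + g^2 * x2^2) * s^2"
      using sum_squares_bound[of v1 "g * x2 * s"] sum_squares_bound[of v2 "g * x1 * s"]
      by (simp add: power_mult_distrib algebra_simps)
  qed
  also have "\<dots> \<le> \<theta> * (1 / 2 * (\<Sum>i\<in>UNIV. (cmod (v i))^2) + V x * s^2)"
    using grad pot \<theta>(1) by (intro mult_left_mono add_mono mult_right_mono) auto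
  finally show "\<bar>\<Omega>\<bar> * cmod (rot_form e x a v)
      \<le> \<bar>\<Omega>\<bar> / min (\<gamma> 1) (\<gamma> 2) * (1 / 2 * (\<Sum>i\<in>UNIV. (cmod (v i))^2) + V x * (cmod a)^2)"
    by (simp add: \<theta>_def g_def s_def)
qed

theorem theorem3p1:
  fixes V :: "real^'n::finite \<Rightarrow> real"
    and e :: "nat \<Rightarrow> 'n"
    and \<beta> \<omega> \<Omega> p :: real
  assumes coords: "bij_betw e {1..CARD('n)} UNIV"
    and beta: "\<beta> > 0"
    and omega: "ereal \<omega> < - lambda0 e V \<Omega>"
    and p_gt: "1 < p"
    and p_lt: "CARD('n) \<ge> 3 \<longrightarrow> p < (real CARD('n) + 2) / (real CARD('n) - 2)"
    and cases:
      "(\<Omega> = 0 \<and> (\<forall>x. V x \<ge> 0) \<and> filterlim V at_top at_infinity) \<or>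
       (CARD('n) \<ge> 2 \<and>
        (\<exists>\<gamma> :: nat \<Rightarrow> real.
           (\<forall>j\<in>{1..CARD('n)}. \<gamma> j > 0) \<and>
           (\<forall>x. V x = 1 / 2 * (\<Sum>j=1..CARD('n). (\<gamma> j)\<^sup>2 * (x $ e j)\<^sup>2)) \<and>
           0 < \<bar>\<Omega>\<bar> \<and> \<bar>\<Omega>\<bar> < min (\<gamma> 1) (\<gamma> 2)))"
  shows "\<exists>\<phi>\<^sub>g \<in> X_space V.
      ereal (action e V \<beta> p \<Omega> \<omega> \<phi>\<^sub>g) = (INF \<phi> \<in> X_space V. ereal (action e V \<beta> p \<Omega> \<omega> \<phi>))
    \<and> (INF \<phi> \<in> X_space V. ereal (action e V \<beta> p \<Omega> \<omega> \<phi>))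
        = (INF \<phi> \<in> nehari_manifold e V \<beta> p \<Omega> \<omega>. ereal (action e V \<beta> p \<Omega> \<omega> \<phi>))"
proof -
  obtain \<theta> where "action_functional e V \<beta> p \<Omega> \<theta>"
    using cases
  proof
    assume "\<Omega> = 0 \<and> (\<forall>x. V x \<ge> 0) \<and> filterlim V at_top at_infinity"
    then show ?thesis using that action_functional_confining[OF beta p_gt p_lt] by blast
  next
    assume "CARD('n) \<ge> 2 \<and>
        (\<exists>\<gamma> :: nat \<Rightarrow> real.
           (\<forall>j\<in>{1..CARD('n)}. \<gamma> j > 0) \<and>
           (\<forall>x. V x = 1 / 2 * (\<Sum>j=1..CARD('n). (\<gamma> j)\<^sup>2 * (x $ e j)\<^sup>2)) \<and>
           0 < \<bar>\<Omega>\<bar> \<and> \<bar>\<Omega>\<bar> < min (\<gamma> 1) (\<gamma> 2))"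
    then obtain \<gamma> :: "nat \<Rightarrow> real" where d: "CARD('n) \<ge> 2" and \<gamma>: "\<forall>j\<in>{1..CARD('n)}. \<gamma> j > 0"
      and V: "\<forall>x. V x = 1 / 2 * (\<Sum>j=1..CARD('n). (\<gamma> j)\<^sup>2 * (x $ e j)\<^sup>2)"
      and \<Omega>: "\<bar>\<Omega>\<bar> < min (\<gamma> 1) (\<gamma> 2)" by blast
    show ?thesis
      by (rule that[OF action_functional_harmonic[OF coords beta p_gt p_lt d bspec[OF \<gamma>] spec[OF V] \<Omega>]])
  qed
  then interpret action_functional e V \<beta> p \<Omega> \<omega> \<theta> .
  have "lambda0 e V \<Omega> < ereal (- \<omega>)"
    using omega by (metis ereal_less_uminus_reorder uminus_ereal.simps(1))
  \<comment> \<open>A normalized function whose quadratic energy is below \<open>- \<omega>\<close>.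
    As its square norm is \<open>1\<close>, adding \<open>\<omega>\<close> times the square norm
    gives a negative number.\<close>
  then obtain u where u: "u \<in> X_space V" "Lp_norm 2 u = 1"
    and less: "1 / 2 * (Lp_norm 2 (weak_gradient u))\<^sup>2
               + (\<integral>x. V x * (cmod (u x))\<^sup>2 \<partial>lebesgue) + L_rot e \<Omega> u < - \<omega>"
    unfolding lambda0_def INF_less_iff by auto
  have "(\<integral>x. (cmod (u x))\<^sup>2 \<partial>lebesgue) = 1"
    using u(2) by (simp flip: Lp_norm_2_square)
  then have "(\<integral>x. quad x (u x) (\<lambda>i. weak_partial i u x) \<partial>lebesgue) + \<omega> * (\<integral>x. (cmod (u x))\<^sup>2 \<partial>lebesgue) < 0"
    using less unfolding quadratic_part_eq[OF u(1)] by simp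
  from ground_state_exists[OF u(1) this] show ?thesis .
qed

end
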